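(* The function $\rho\mapsto\sigma(\rho)^2:=8\int_0^\infty e^{-\rho s}K(s,0)\,ds$ on $(0,\infty)$ is continuous and satisfies $$\lim_{\rho\to+0}\sigma(\rho)^2=8\int_0^\infty K(s,0)\,ds=0,\qquad\lim_{\rho\to+\infty}\sigma(\rho)^2=0.$$ In particular, there exists $\rho^*\in(0,\infty)$ such that $\sigma(\rho^* )^2=\sup_{\rho\in(0,\infty)}\sigma(\rho)^2$.
   Context: Let $\mathcal{T}=(\mathcal{T}_t)_{t\ge0}$ solve $\mathcal{T}_t=\mathcal{T}_0+t-2\int_{(0,t]\times\mathbb{R}_+}\mathcal{T}_{s-}1_{\{z\le\mathcal{T}_{s-}\}}N(ds,dz)$ with $\mathcal{T}_0\sim\mathcal{N}(0,1)$ independent of $N$, where $N$ is a Poisson random measure on $\mathbb{R}_+\times\mathbb{R}_+$ with intensity $ds\,dz$; this process is strictly stationary. Set $K(s,t)=\mathbb{E}[\mathcal{T}_s\mathcal{T}_t]$. *)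

theory Defs
  imports "HOL-Probability.Probability"
begin

text \<open>The law with \<open>mean = 0\<close> is the point mass at 0 (it is not covered by
  \<^const>\<open>poisson_pmf\<close>, which needs a positive rate); the one with
  \<open>mean = \<infinity>\<close> is the point mass at \<open>\<infinity>\<close>.\<close>

definition poisson_distributed :: "'a measure \<Rightarrow> ('a \<Rightarrow> ennreal) \<Rightarrow> ennreal \<Rightarrow> bool" where
  "poisson_distributed M X mean \<longleftrightarrow>
     X \<in> borel_measurable M \<and>
     (mean = \<infinity> \<longrightarrow> (AE \<omega> in M. X \<omega> = \<infinity>)) \<and>
     (mean < \<infinity> \<longrightarrow>
        (\<forall>k::nat. measure M {\<omega> \<in> space M. X \<omega> = of_nat k}
                   = enn2real mean ^ k / fact k * exp (- enn2real mean)))"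

definition poisson_random_measure ::
    "'a measure \<Rightarrow> 'b measure \<Rightarrow> ('a \<Rightarrow> 'b measure) \<Rightarrow> bool" where
  "poisson_random_measure M \<mu> N \<longleftrightarrow>
     (\<forall>\<omega>\<in>space M. sets (N \<omega>) = sets \<mu>) \<and>
     (\<forall>\<omega>\<in>space M. \<forall>A\<in>sets \<mu>. \<exists>n. emeasure (N \<omega>) A = ennreal_of_enat n) \<and>
     (\<forall>A\<in>sets \<mu>. poisson_distributed M (\<lambda>\<omega>. emeasure (N \<omega>) A) (emeasure \<mu> A)) \<and>
     (\<forall>(n::nat) A. disjoint_family_on A {..<n} \<and> (\<forall>i<n. A i \<in> sets \<mu>) \<longrightarrow>
        prob_space.indep_vars M (\<lambda>_. borel) (\<lambda>i \<omega>. emeasure (N \<omega>) (A i)) {..<n})"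

definition quadrant_lborel :: "(real \<times> real) measure" where
  "quadrant_lborel = restrict_space lborel ({0..} \<times> {0..})"

definition cadlag :: "(real \<Rightarrow> real) \<Rightarrow> bool" where
  "cadlag f \<longleftrightarrow>
     (\<forall>t\<ge>0. continuous (at_right t) f) \<and> (\<forall>t>0. \<exists>l. (f \<longlongrightarrow> l) (at_left t))"

definition left_lim :: "(real \<Rightarrow> real) \<Rightarrow> real \<Rightarrow> real" where
  "left_lim f s = Lim (at_left s) f"

definition jump_integrand :: "(real \<Rightarrow> real) \<Rightarrow> real \<times> real \<Rightarrow> real" where
  "jump_integrand f = (\<lambda>(s, z). left_lim f s * indicator {z. z \<le> left_lim f s} z)"

text \<open>A process is a function of time and then of the sample point; only its values at
  times \<open>t \<ge> 0\<close> matter. The equation holds pathwise, almost surely for all times at once.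
  The integrability clause is there because the Bochner integral of a non-integrable function
  is 0 by convention.\<close>

definition telegraph_solution ::
    "'a measure \<Rightarrow> ('a \<Rightarrow> (real \<times> real) measure) \<Rightarrow> (real \<Rightarrow> 'a \<Rightarrow> real) \<Rightarrow> bool" where
  "telegraph_solution M N T \<longleftrightarrow>
     (\<forall>t\<ge>0. T t \<in> borel_measurable M) \<and>
     (AE \<omega> in M. cadlag (\<lambda>t. T t \<omega>) \<and>
        (\<forall>t\<ge>0. set_integrable (N \<omega>) ({0<..t} \<times> {0..}) (jump_integrand (\<lambda>s. T s \<omega>)) \<and>
               T t \<omega> = T 0 \<omega> + t
                 - 2 * (LINT p : {0<..t} \<times> {0..} | N \<omega>. jump_integrand (\<lambda>s. T s \<omega>) p)))"

text \<open>Independence of a real random variable from the whole random measure: the sigma-algebra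
  of the latter is the one generated by its values on measurable sets. The library's
  \<open>indep_var\<close> does not apply, because it needs both variables to take values in
  the same type.\<close>

definition indep_of_random_measure ::
    "'a measure \<Rightarrow> 'b measure \<Rightarrow> ('a \<Rightarrow> real) \<Rightarrow> ('a \<Rightarrow> 'b measure) \<Rightarrow> bool" where
  "indep_of_random_measure M \<mu> X N \<longleftrightarrow>
     prob_space.indep_set M
       (sets (vimage_algebra (space M) X borel))
       (sets (vimage_algebra (space M)
                (\<lambda>\<omega>. \<lambda>A\<in>sets \<mu>. emeasure (N \<omega>) A)
                (Pi\<^sub>M (sets \<mu>) (\<lambda>_. borel))))"

definition covK :: "'a measure \<Rightarrow> (real \<Rightarrow> 'a \<Rightarrow> real) \<Rightarrow> real \<Rightarrow> real \<Rightarrow> real" where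
  "covK M T s t = (LINT \<omega>|M. T s \<omega> * T t \<omega>)"

definition sigma_sq :: "'a measure \<Rightarrow> (real \<Rightarrow> 'a \<Rightarrow> real) \<Rightarrow> real \<Rightarrow> real" where
  "sigma_sq M T \<rho> = 8 * (LINT s : {0..} | lborel. exp (- \<rho> * s) * covK M T s 0)"

end

theory Submission
  imports Defs "HOL-Real_Asymp.Real_Asymp"
begin

text \<open>Write \<open>T\<close> for the process. Between jumps it moves up with unit speed; from a positive position \<open>x\<close> it
jumps to \<open>-x\<close> with rate \<open>x\<close>; from a position \<open>x \<le> 0\<close> it does not jump. Everything rests on two
observations.

First, a jump preserves \<open>T\<^sup>2\<close>, so \<open>T\<^sup>2\<close> changes only by twice the time integral of \<open>T\<close>. Hence the integral of
\<open>T\<close> from a start at \<open>x\<close> up to the first return to \<open>0\<close> equals \<open>- x\<^sup>2 / 2\<close>, whatever the jump time is, and the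
integral over all times of the mean started at \<open>x\<close> is a constant minus \<open>x\<^sup>2 / 2\<close>. This is an even function
of \<open>x\<close>; integrated against \<open>x\<close> times the normal density it vanishes, which is
\<open>\<integral>\<^sub>0\<^sup>\<infinity> K(s, 0) ds = 0\<close> (\<open>cov_formula_integral\<close>).

Second, these integrals converge absolutely. From \<open>0\<close> the process climbs for a time \<open>r\<close> with density
\<open>r exp (- r\<^sup>2 / 2)\<close>, jumps to \<open>- r\<close> and is back at \<open>0\<close> at time \<open>2 r\<close>. So the mean \<open>f\<close> started at \<open>0\<close> solves the
renewal equation \<open>f t = a t + \<integral> r exp (- r\<^sup>2 / 2) f (t - 2 r) dr\<close>, whose kernel has mass \<open>1\<close>. Integrating the
equation once gives \<open>A t = 2 \<integral> exp (- r\<^sup>2 / 2) f (t - 2 r) dr\<close> for the antiderivative \<open>A\<close> of \<open>a\<close>, and \<open>A\<close>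
has Gaussian decay. Subtracting a quarter of it changes the kernel to \<open>(r - 1/2) exp (- r\<^sup>2 / 2)\<close>, whose
\<open>L\<^sup>1\<close> norm is below \<open>1\<close>; therefore \<open>f\<close> is integrable (\<open>renewal_solution_l1\<close>).

It remains to show that \<open>K(t, 0)\<close> is the Gaussian average of \<open>x\<close> times the mean \<open>cmean t x\<close> that is defined
through the renewal equation. The process is compared with a Markov chain on a lattice of mesh \<open>t / n\<close> that
reads only the numbers of points of the random measure in rectangles. Its expectations follow \<open>cmean\<close> up to
an error that vanishes with the mesh (\<open>euler_consistency\<close>, \<open>echain_weak_error\<close>), and the path stays close
to the chain outside an event of small probability (\<open>euler_coupling\<close>, \<open>bad_event_small\<close>). Letting
\<open>n\<close> tend to infinity gives \<open>covK_eq_cov_formula\<close>.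

The remaining assertions follow by dominated convergence. The maximum is attained because the damped
integral is continuous, tends to \<open>0\<close> at both ends, and is positive for large \<open>\<rho>\<close>, since \<open>K(s, 0)\<close> is close
to \<open>K(0, 0) = 1\<close> for small \<open>s\<close>.\<close>

section \<open>Contraction of convolutions\<close>

text \<open>On bounded continuous functions the integral operator has norm at most \<open>\<integral>\<bar>\<kappa>\<bar> < 1\<close>, so Banach's fixed point
theorem applies. The step \<open>2 r\<close> is the length of a cycle of the process that jumps at time \<open>r\<close>.\<close>

lemma convolution_contraction_fixpoint:
  fixes \<kappa> \<alpha> :: "real \<Rightarrow> real"
  assumes \<kappa>: "integrable lborel \<kappa>" "(LINT r|lborel. \<bar>\<kappa> r\<bar>) < 1"
    and \<alpha>: "continuous_on UNIV \<alpha>" "bounded (range \<alpha>)"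
  obtains n where "continuous_on UNIV n" "bounded (range n)"
    "\<And>t. n t = \<alpha> t + (LINT r|lborel. \<kappa> r * n (t - 2 * r))"
proof -
  define q where "q = (LINT r|lborel. \<bar>\<kappa> r\<bar>)"
  have q: "0 \<le> q" "q < 1" using \<kappa>(2) by (auto simp: q_def)
  have meas: "(\<lambda>r. g (t - 2 * r)) \<in> borel_measurable borel" if "continuous_on UNIV g" for g :: "real \<Rightarrow> real" and t
    by (intro borel_measurable_continuous_onI continuous_on_compose2[OF that] continuous_intros) auto
  have bd: "\<bar>apply_bcontfun g t\<bar> \<le> norm g" for g :: "real \<Rightarrow>\<^sub>C real" and t
    using norm_bounded[of g t] by simp
  have cb: "continuous_on UNIV (apply_bcontfun g)" for g :: "real \<Rightarrow>\<^sub>C real"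
    by (rule continuous_on_apply_bcontfun)
  have int: "integrable lborel (\<lambda>r. \<kappa> r * apply_bcontfun g (t - 2 * r))" for g :: "real \<Rightarrow>\<^sub>C real" and t
  proof (rule Bochner_Integration.integrable_bound)
    show "integrable lborel (\<lambda>r. norm g * \<bar>\<kappa> r\<bar>)" using \<kappa>(1) by auto
    show "(\<lambda>r. \<kappa> r * apply_bcontfun g (t - 2 * r)) \<in> borel_measurable lborel"
      using \<kappa>(1) meas[OF cb] by measurable
    show "AE r in lborel. norm (\<kappa> r * apply_bcontfun g (t - 2 * r)) \<le> norm (norm g * \<bar>\<kappa> r\<bar>)"
      by (intro AE_I2) (auto simp: abs_mult mult.commute[of "norm g"] intro!: mult_left_mono bd)
  qed
  have bdi: "\<bar>LINT r|lborel. \<kappa> r * apply_bcontfun g (t - 2 * r)\<bar> \<le> q * norm g" for g :: "real \<Rightarrow>\<^sub>C real" and t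
  proof -
    have "\<bar>LINT r|lborel. \<kappa> r * apply_bcontfun g (t - 2 * r)\<bar> \<le> (LINT r|lborel. \<bar>\<kappa> r * apply_bcontfun g (t - 2 * r)\<bar>)"
      by (rule integral_abs_bound)
    also have "\<dots> \<le> (LINT r|lborel. \<bar>\<kappa> r\<bar> * norm g)"
      by (intro integral_mono integrable_abs int integrable_mult_left)
         (use \<kappa>(1) in \<open>auto simp: abs_mult intro!: mult_left_mono bd\<close>)
    finally show ?thesis by (simp add: q_def)
  qed
  have cont: "continuous_on UNIV (\<lambda>t. LINT r|lborel. \<kappa> r * apply_bcontfun g (t - 2 * r))" for g :: "real \<Rightarrow>\<^sub>C real"
    unfolding continuous_on_sequentially comp_def
  proof (intro ballI allI impI, elim conjE)
    fix x and t :: real assume x: "x \<longlonglongrightarrow> t"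
    show "(\<lambda>i. LINT r|lborel. \<kappa> r * apply_bcontfun g (x i - 2 * r)) \<longlonglongrightarrow> (LINT r|lborel. \<kappa> r * apply_bcontfun g (t - 2 * r))"
    proof (rule integral_dominated_convergence)
      show "integrable lborel (\<lambda>r. norm g * \<bar>\<kappa> r\<bar>)" using \<kappa>(1) by auto
      show "AE r in lborel. (\<lambda>i. \<kappa> r * apply_bcontfun g (x i - 2 * r)) \<longlonglongrightarrow> \<kappa> r * apply_bcontfun g (t - 2 * r)"
        by (intro AE_I2 tendsto_intros x continuous_on_tendsto_compose[OF cb]) auto
      show "AE r in lborel. norm (\<kappa> r * apply_bcontfun g (x i - 2 * r)) \<le> norm g * \<bar>\<kappa> r\<bar>" for i
        by (intro AE_I2) (auto simp: abs_mult mult.commute[of "norm g"] intro!: mult_left_mono bd)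
    qed (use int in \<open>auto intro: borel_measurable_integrable\<close>)
  qed
  define \<Phi> where "\<Phi> g = Bcontfun (\<lambda>t. \<alpha> t + (LINT r|lborel. \<kappa> r * apply_bcontfun g (t - 2 * r)))" for g
  have \<Phi>: "apply_bcontfun (\<Phi> g) t = \<alpha> t + (LINT r|lborel. \<kappa> r * apply_bcontfun g (t - 2 * r))" for g t
  proof -
    have "(\<lambda>t. \<alpha> t + (LINT r|lborel. \<kappa> r * apply_bcontfun g (t - 2 * r))) \<in> bcontfun"
    proof -
      have "bounded (range (\<lambda>t. LINT r|lborel. \<kappa> r * apply_bcontfun g (t - 2 * r)))"
        using bdi[of g] by (auto simp: bounded_iff)
      then have "bounded (range (\<lambda>t. \<alpha> t + (LINT r|lborel. \<kappa> r * apply_bcontfun g (t - 2 * r))))"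
        using bounded_plus_comp[OF \<alpha>(2)] by blast
      then show ?thesis unfolding bcontfun_def using cont \<alpha>(1) by (auto intro!: continuous_intros)
    qed
    then show ?thesis by (simp add: \<Phi>_def Bcontfun_inverse)
  qed
  have "\<exists>!x. \<Phi> x = x"
  proof (rule banach_fix_type)
    show "0 \<le> q" "q < 1" using q by auto
    show "\<forall>x y. dist (\<Phi> x) (\<Phi> y) \<le> q * dist x y"
    proof (intro allI dist_bound)
      fix x y t
      have "dist (apply_bcontfun (\<Phi> x) t) (apply_bcontfun (\<Phi> y) t)
         = \<bar>LINT r|lborel. \<kappa> r * apply_bcontfun (x - y) (t - 2 * r)\<bar>"
        using Bochner_Integration.integral_diff[OF int[of x t] int[of y t]]
        by (simp add: \<Phi> dist_real_def right_diff_distrib)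
      also have "\<dots> \<le> q * dist x y" using bdi[of "x - y" t] by (simp add: dist_norm)
      finally show "dist (apply_bcontfun (\<Phi> x) t) (apply_bcontfun (\<Phi> y) t) \<le> q * dist x y" .
    qed
  qed
  then obtain x where x: "\<Phi> x = x" by blast
  show ?thesis
  proof (rule that[of "apply_bcontfun x"])
    show "bounded (range (apply_bcontfun x))" using bd[of x] by (auto simp: bounded_iff)
    show "apply_bcontfun x t = \<alpha> t + (LINT r|lborel. \<kappa> r * apply_bcontfun x (t - 2 * r))" for t
      by (subst x[symmetric]) (rule \<Phi>)
  qed (rule cb)
qed

section \<open>The renewal equation for the mean started at zero\<close>

lemma continuous_antiderivative:
  fixes g :: "real \<Rightarrow> real"
  assumes "continuous_on UNIV g"
  obtains G where "\<And>x. (G has_real_derivative g x) (at x)"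
proof -
  have "isCont g x" for x using assms by (simp add: continuous_on_eq_continuous_at)
  then obtain G where "\<forall>x. -\<infinity> < ereal x \<longrightarrow> ereal x < \<infinity> \<longrightarrow> (G has_vector_derivative g x) (at x)"
    using einterval_antiderivative[of "-\<infinity>" \<infinity> g] by auto
  then show ?thesis by (intro that[of G]) (auto simp: has_real_derivative_iff_has_vector_derivative)
qed

text \<open>Only differences of this antiderivative occur, so the additive constant is left open.\<close>

definition gauss_prim :: "real \<Rightarrow> real" where
  "gauss_prim = (SOME E. \<forall>x. (E has_real_derivative exp (- (x\<^sup>2) / 2)) (at x))"

lemma gauss_prim_deriv: "(gauss_prim has_real_derivative exp (- (x\<^sup>2) / 2)) (at x)"
proof -
  have "continuous_on UNIV (\<lambda>x::real. exp (- (x\<^sup>2) / 2))" by (intro continuous_intros) auto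
  then obtain E where "\<And>x. (E has_real_derivative exp (- (x\<^sup>2) / 2)) (at x)"
    using continuous_antiderivative by blast
  then have "\<exists>E. \<forall>x. (E has_real_derivative exp (- (x\<^sup>2) / 2)) (at x)" by blast
  from someI_ex[OF this] show ?thesis unfolding gauss_prim_def by blast
qed

lemma continuous_on_gauss_prim [continuous_intros]:
  assumes "continuous_on S f" shows "continuous_on S (\<lambda>x. gauss_prim (f x))"
proof -
  have "continuous_on UNIV gauss_prim"
    using gauss_prim_deriv by (meson DERIV_isCont continuous_at_imp_continuous_on)
  then show ?thesis using assms by (rule continuous_on_compose2) auto
qed

lemma gauss_prim_bounds:
  assumes "0 \<le> (x::real)" "x \<le> y"
  shows "0 \<le> gauss_prim y - gauss_prim x" "gauss_prim y - gauss_prim x \<le> (y - x) * exp (- (x\<^sup>2) / 2)"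
proof -
  show "0 \<le> gauss_prim y - gauss_prim x"
    using DERIV_nonneg_imp_nondecreasing[OF assms(2), of gauss_prim] gauss_prim_deriv by fastforce
  show "gauss_prim y - gauss_prim x \<le> (y - x) * exp (- (x\<^sup>2) / 2)"
  proof (cases "x = y")
    case False
    then obtain z where z: "x < z" "z < y" "gauss_prim y - gauss_prim x = (y - x) * exp (- (z\<^sup>2) / 2)"
      using MVT2[of x y gauss_prim "\<lambda>x. exp (- (x\<^sup>2) / 2)"] gauss_prim_deriv assms by force
    have "x\<^sup>2 \<le> z\<^sup>2" using z assms by (intro power_mono) auto
    then show ?thesis unfolding z(3) using assms by (intro mult_left_mono) auto
  qed auto
qed

text \<open>The part of the mean at time \<open>t\<close>, started at \<open>0\<close>, that comes from the first cycle still running at \<open>t\<close>. It is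
\<open>t exp (- t\<^sup>2 / 2)\<close> (no jump yet) plus \<open>\<integral> r exp (- r\<^sup>2 / 2) (t - 2 r) dr\<close> over \<open>t / 2 \<le> r \<le> t\<close> (a jump at time
\<open>r\<close>, and no return to \<open>0\<close> yet), after an integration by parts.\<close>

definition ren_source :: "real \<Rightarrow> real" where
  "ren_source t = (if t \<le> 0 then 0 else 2 * t * exp (- (t\<^sup>2) / 2) - 2 * (gauss_prim t - gauss_prim (t / 2)))"

text \<open>The antiderivative of \<open>ren_source\<close> that vanishes at \<open>0\<close>. It also tends to \<open>0\<close> at infinity, because the
ascent to \<open>r\<close> and the ascent from \<open>- r\<close> contribute opposite areas to a cycle.\<close>

definition ren_source_int :: "real \<Rightarrow> real" where
  "ren_source_int t = (if t \<le> 0 then 0 else 4 * exp (- (t\<^sup>2) / 8) - 4 * exp (- (t\<^sup>2) / 2)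
                 - 2 * t * (gauss_prim t - gauss_prim (t / 2)))"

lemma continuous_ren_source: "continuous_on UNIV ren_source"
proof -
  have "continuous_on ({..0} \<union> {0..}) (\<lambda>t. if t \<le> 0 then 0 else 2 * t * exp (- (t\<^sup>2) / 2) - 2 * (gauss_prim t - gauss_prim (t / 2)))"
    by (intro continuous_on_If continuous_intros) auto
  moreover have "{..0} \<union> {0..} = (UNIV :: real set)" by auto
  ultimately show ?thesis unfolding ren_source_def[abs_def] by simp
qed

lemma continuous_ren_source_int: "continuous_on UNIV ren_source_int"
proof -
  have "continuous_on ({..0} \<union> {0..}) (\<lambda>t. if t \<le> 0 then 0 else 4 * exp (- (t\<^sup>2) / 8) - 4 * exp (- (t\<^sup>2) / 2)
                 - 2 * t * (gauss_prim t - gauss_prim (t / 2)))"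
    by (intro continuous_on_If continuous_intros) auto
  moreover have "{..0} \<union> {0..} = (UNIV :: real set)" by auto
  ultimately show ?thesis unfolding ren_source_int_def[abs_def] by simp
qed

lemma ren_source_int_deriv: assumes "0 < t" shows "(ren_source_int has_real_derivative ren_source t) (at t)"
proof -
  have "((\<lambda>t. 4 * exp (- (t\<^sup>2) / 8) - 4 * exp (- (t\<^sup>2) / 2)
                 - 2 * t * (gauss_prim t - gauss_prim (t / 2))) has_real_derivative ren_source t) (at t)"
    using assms
    by (auto intro!: derivative_eq_intros DERIV_chain2[OF gauss_prim_deriv] simp: ren_source_def power_divide field_simps power2_eq_square)
  moreover have "\<forall>\<^sub>F s in nhds t. ren_source_int s = 4 * exp (- (s\<^sup>2) / 8) - 4 * exp (- (s\<^sup>2) / 2)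
                 - 2 * s * (gauss_prim s - gauss_prim (s / 2))"
    using eventually_nhds_in_open[of "{0<..}" t] assms
    by (auto elim!: eventually_mono simp: ren_source_int_def)
  ultimately show ?thesis by (subst DERIV_cong_ev[OF refl _ refl]) auto
qed

lemma gauss8_le: assumes "0 \<le> (t::real)" shows "exp (- (t\<^sup>2) / 2) \<le> exp (- (t\<^sup>2) / 8)"
  using assms by auto

lemma abs_ren_source: "\<bar>ren_source t\<bar> \<le> (3 + \<bar>t\<bar>^2) * exp (- (t\<^sup>2) / 8) * 2" 
proof (cases "t \<le> 0")
  case False
  let ?e = "exp (- (t\<^sup>2) / 8)"
  have 1: "\<bar>gauss_prim t - gauss_prim (t / 2)\<bar> \<le> t/2 * ?e"
    using gauss_prim_bounds[of "t/2" t] False by (auto simp: power_divide)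
  have 2: "t * exp (- (t\<^sup>2) / 2) \<le> t * ?e" using False by (intro mult_left_mono) auto
  have "\<bar>ren_source t\<bar> \<le> \<bar>2 * t * exp (- (t\<^sup>2) / 2)\<bar> + \<bar>2 * (gauss_prim t - gauss_prim (t / 2))\<bar>"
  proof -
    have "ren_source t = 2 * t * exp (- (t\<^sup>2) / 2) - 2 * (gauss_prim t - gauss_prim (t / 2))"
      using False by (simp add: ren_source_def)
    then show ?thesis by (simp only: abs_triangle_ineq4)
  qed
  also have "\<bar>2 * t * exp (- (t\<^sup>2) / 2)\<bar> = 2 * (t * exp (- (t\<^sup>2) / 2))" using False by simp
  also have "\<bar>2 * (gauss_prim t - gauss_prim (t / 2))\<bar> = 2 * \<bar>gauss_prim t - gauss_prim (t / 2)\<bar>"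
    by (simp only: abs_mult abs_numeral)
  also have "2 * (t * exp (- (t\<^sup>2) / 2)) + 2 * \<bar>gauss_prim t - gauss_prim (t / 2)\<bar> \<le> 2 * (t * ?e) + 2 * (t / 2 * ?e)"
    by (intro add_mono mult_left_mono 1 2) auto
  also have "\<dots> = (3/2 * t) * ?e * 2" by (simp add: algebra_simps)
  also have "\<dots> \<le> (3 + \<bar>t\<bar>^2) * ?e * 2"
  proof -
    have "0 \<le> (t - 3/4)^2" by simp
    then have "3/2 * t \<le> 3 + \<bar>t\<bar>^2" unfolding power2_diff power2_abs by (simp add: power2_eq_square)
    then show ?thesis by (intro mult_right_mono) auto
  qed
  finally show ?thesis .
qed (auto simp: ren_source_def)

lemma abs_ren_source_int: "\<bar>ren_source_int t\<bar> \<le> (8 + \<bar>t\<bar>^2) * exp (- (t\<^sup>2) / 8)"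
proof (cases "t \<le> 0")
  case False
  let ?e = "exp (- (t\<^sup>2) / 8)"
  have 1: "\<bar>gauss_prim t - gauss_prim (t / 2)\<bar> \<le> t/2 * ?e"
    using gauss_prim_bounds[of "t/2" t] False by (auto simp: power_divide)
  have "\<bar>ren_source_int t\<bar> \<le> \<bar>4 * ?e - 4 * exp (- (t\<^sup>2) / 2)\<bar> + \<bar>2 * t * (gauss_prim t - gauss_prim (t / 2))\<bar>"
  proof -
    have "ren_source_int t = (4 * ?e - 4 * exp (- (t\<^sup>2) / 2)) - 2 * t * (gauss_prim t - gauss_prim (t / 2))"
      using False by (simp add: ren_source_int_def)
    then show ?thesis by (simp only: abs_triangle_ineq4)
  qed
  also have "\<bar>4 * ?e - 4 * exp (- (t\<^sup>2) / 2)\<bar> \<le> 4 * ?e + 4 * exp (- (t\<^sup>2) / 2)"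
    using abs_triangle_ineq4[of "4 * ?e" "4 * exp (- (t\<^sup>2) / 2)"] by simp
  also have "\<dots> \<le> 8 * ?e" using gauss8_le[of t] False by auto
  also have "\<bar>2 * t * (gauss_prim t - gauss_prim (t / 2))\<bar> \<le> 2 * t * (t/2 * ?e)"
    using 1 False unfolding abs_mult by (intro mult_mono) auto
  finally show ?thesis using False by (simp add: algebra_simps power2_eq_square)
qed (auto simp: ren_source_int_def)

lemma integrable_gauss8: "integrable lborel (\<lambda>t::real. (c + d * \<bar>t\<bar>^2) * exp (- (t\<^sup>2) / 8))"
proof -
  have "integrable lborel (\<lambda>t. normal_density 0 2 t * (t - 0) ^ 0)" "integrable lborel (\<lambda>t. normal_density 0 2 t * (t - 0) ^ 2)"
    by (intro integrable_normal_moment; simp)+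
  then have "integrable lborel (\<lambda>t. sqrt (2 * pi * 2\<^sup>2) * (c * (normal_density 0 2 t * (t - 0) ^ 0) + d * (normal_density 0 2 t * (t - 0) ^ 2)))"
    by (intro integrable_mult_right Bochner_Integration.integrable_add)
  moreover have "sqrt (2 * pi * 2\<^sup>2) * (c * (normal_density 0 2 t * (t - 0) ^ 0) + d * (normal_density 0 2 t * (t - 0) ^ 2))
     = (c + d * \<bar>t\<bar>^2) * exp (- (t\<^sup>2) / 8)" for t :: real
    by (simp add: normal_density_def field_simps)
  ultimately show ?thesis by (simp only:)
qed

lemma integrable_ren: "integrable lborel ren_source" "integrable lborel ren_source_int"
proof -
  show "integrable lborel ren_source"
    by (rule Bochner_Integration.integrable_bound[OF integrable_gauss8[of 6 2]])
       (use continuous_ren_source abs_ren_source in \<open>auto intro!: borel_measurable_continuous_onI AE_I2 order_trans[OF abs_ren_source] simp: algebra_simps\<close>)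
  show "integrable lborel ren_source_int"
    by (rule Bochner_Integration.integrable_bound[OF integrable_gauss8[of 8 1]])
       (use continuous_ren_source_int abs_ren_source_int in \<open>auto intro!: borel_measurable_continuous_onI AE_I2 order_trans[OF abs_ren_source_int] simp: algebra_simps\<close>)
qed

lemma exp_ge_2r: "2 * r \<le> exp (r::real)" 
proof (cases "r \<le> 1")
  case True then show ?thesis using exp_ge_add_one_self[of r] by linarith
next
  case False
  then show ?thesis using exp_lower_Taylor_quadratic[of r] sum_power2_ge_zero[of "r-1" 0]
    by (simp add: power2_eq_square algebra_simps)
qed

lemma integrable_exp_Ici: "integrable lborel (\<lambda>r::real. indicator {0..} r * exp (-r))"
  and integral_exp_Ici: "(LINT r|lborel. indicator {0..} r * exp (-r::real)) = 1"
proof -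
  have "(\<integral>\<^sup>+r. ennreal (indicator {0..} r * exp (-r)) \<partial>lborel) = (\<integral>\<^sup>+r. ennreal (r^0 * exp (-r)) * indicator {0..} r \<partial>lborel)"
    by (intro nn_integral_cong) (auto simp: indicator_def)
  also have "\<dots> = ennreal 1" unfolding nn_intergal_power_times_exp_Ici by simp
  finally have "has_bochner_integral lborel (\<lambda>r::real. indicator {0..} r * exp (-r)) 1"
    by (intro has_bochner_integral_nn_integral) auto
  then show "integrable lborel (\<lambda>r::real. indicator {0..} r * exp (-r))"
    "(LINT r|lborel. indicator {0..} r * exp (-r::real)) = 1"
    by (auto simp: has_bochner_integral_iff)
qed

text \<open>The kernel of the renewal equation has mass \<open>1\<close>. Multiplying a solution by \<open>exp (- t)\<close> replaces it by
\<open>r exp (- r\<^sup>2 / 2 - 2 r)\<close>, of mass at most \<open>1/2\<close>.\<close>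

lemma renewal_solution:
  obtains f :: "real \<Rightarrow> real" where "continuous_on UNIV f" "\<And>t. t \<le> 0 \<Longrightarrow> f t = 0"
    "\<And>t R. 0 \<le> R \<Longrightarrow> t \<le> 2 * R \<Longrightarrow>
       f t = ren_source t + integral {0..R} (\<lambda>r. r * exp (- (r\<^sup>2) / 2) * f (t - 2 * r))"
proof -
  define \<kappa> where "\<kappa> r = indicator {0..} r * (r * exp (- (r\<^sup>2) / 2 - 2 * r))" for r :: real
  define \<alpha> where "\<alpha> t = exp (- \<bar>t\<bar>) * ren_source t" for t
  have \<kappa>m: "\<kappa> \<in> borel_measurable borel" unfolding \<kappa>_def by measurable
  have \<kappa>b: "\<bar>\<kappa> r\<bar> \<le> 1/2 * (indicator {0..} r * exp (-r))" for r
  proof (cases "0 \<le> r")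
    case True
    have "r * exp (- (r\<^sup>2) / 2 - 2 * r) \<le> r * exp (- 2 * r)" using True by (intro mult_left_mono) auto
    also have "\<dots> = (2 * r * exp (-r)) * exp (-r) / 2" by (simp flip: exp_add)
    also have "\<dots> \<le> 1 * exp (-r) / 2"
      using exp_ge_2r[of r] by (intro divide_right_mono mult_right_mono) (auto simp: exp_minus field_simps)
    finally show ?thesis using True by (simp add: \<kappa>_def)
  qed (simp add: \<kappa>_def)
  have \<kappa>i: "integrable lborel \<kappa>"
    by (rule Bochner_Integration.integrable_bound[OF integrable_mult_right[OF integrable_exp_Ici, of "1/2"]])
       (use \<kappa>m \<kappa>b in \<open>auto intro!: AE_I2\<close>)
  have "(LINT r|lborel. \<bar>\<kappa> r\<bar>) \<le> (LINT r|lborel. 1/2 * (indicator {0..} r * exp (-r)))"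
    using \<kappa>i integrable_exp_Ici \<kappa>b by (intro integral_mono) auto
  also have "\<dots> = 1/2" using integral_exp_Ici by simp
  finally have \<kappa>n: "(LINT r|lborel. \<bar>\<kappa> r\<bar>) \<le> 1/2" .
  have \<alpha>: "continuous_on UNIV \<alpha>" unfolding \<alpha>_def[abs_def] by (intro continuous_intros continuous_ren_source)
  have \<alpha>b: "\<bar>\<alpha> t\<bar> \<le> 16" for t
  proof -
    have "1 + t\<^sup>2 / 8 \<le> exp (t\<^sup>2 / 8)" by (rule exp_ge_add_one_self)
    then have "(3 + \<bar>t\<bar>^2) * exp (- (t\<^sup>2) / 8) \<le> 8" by (simp add: exp_minus field_simps)
    then have "\<bar>ren_source t\<bar> \<le> 16" using abs_ren_source[of t] by linarith
    moreover have "\<bar>\<alpha> t\<bar> \<le> 1 * \<bar>ren_source t\<bar>" unfolding \<alpha>_def abs_mult by (intro mult_right_mono) auto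
    ultimately show ?thesis by simp
  qed
  have \<kappa>n': "(LINT r|lborel. \<bar>\<kappa> r\<bar>) < 1" using \<kappa>n by simp
  have \<alpha>b': "bounded (range \<alpha>)" using \<alpha>b by (auto simp: bounded_iff)
  obtain n where n: "continuous_on UNIV n" "bounded (range n)"
    "\<And>t. n t = \<alpha> t + (LINT r|lborel. \<kappa> r * n (t - 2 * r))"
    using convolution_contraction_fixpoint[OF \<kappa>i \<kappa>n' \<alpha> \<alpha>b'] by blast
  obtain B where B: "\<And>t. \<bar>n t\<bar> \<le> B" using n(2) by (auto simp: bounded_iff)
  \<comment> \<open>On the negative axis the source vanishes and the equation does not look to the right, so there the
    supremum of \<open>\<bar>n\<bar>\<close> is at most half of itself.\<close>
  have n0: "n t = 0" if "t \<le> 0" for t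
  proof -
    define S where "S = (SUP t\<in>{..0}. \<bar>n t\<bar>)"
    have bdd: "bdd_above ((\<lambda>t. \<bar>n t\<bar>) ` {..0})" using B by (auto simp: bdd_above_def)
    have S: "\<bar>n t\<bar> \<le> S" if "t \<le> 0" for t unfolding S_def using bdd that by (intro cSUP_upper) auto
    have le: "\<bar>n t\<bar> \<le> 1/2 * S" if t: "t \<le> 0" for t
    proof -
      have pt: "\<bar>\<kappa> r * n (t - 2 * r)\<bar> \<le> \<bar>\<kappa> r\<bar> * S" for r
        unfolding abs_mult using S[of "t - 2 * r"] t by (cases "0 \<le> r") (auto simp: \<kappa>_def intro!: mult_left_mono)
      have "n t = (LINT r|lborel. \<kappa> r * n (t - 2 * r))" using n(3)[of t] t by (simp add: \<alpha>_def ren_source_def)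
      also have "\<bar>\<dots>\<bar> \<le> (LINT r|lborel. \<bar>\<kappa> r * n (t - 2 * r)\<bar>)" by (rule integral_abs_bound)
      also have "\<dots> \<le> (LINT r|lborel. \<bar>\<kappa> r\<bar> * S)"
      proof (rule integral_mono)
        show i: "integrable lborel (\<lambda>r. \<bar>\<kappa> r\<bar> * S)" using \<kappa>i by auto
        show "integrable lborel (\<lambda>r. \<bar>\<kappa> r * n (t - 2 * r)\<bar>)"
        proof (rule Bochner_Integration.integrable_bound[OF i])
          have "(\<lambda>r. n (t - 2 * r)) \<in> borel_measurable borel"
            by (intro borel_measurable_continuous_onI continuous_on_compose2[OF n(1)] continuous_intros) auto
          then show "(\<lambda>r. \<bar>\<kappa> r * n (t - 2 * r)\<bar>) \<in> borel_measurable lborel" using \<kappa>m by measurable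
          show "AE r in lborel. norm \<bar>\<kappa> r * n (t - 2 * r)\<bar> \<le> norm (\<bar>\<kappa> r\<bar> * S)"
            by (intro AE_I2) (simp, rule order_trans[OF pt abs_ge_self])
        qed
      qed (rule pt)
      also have "\<dots> = (LINT r|lborel. \<bar>\<kappa> r\<bar>) * S" by simp
      also have "\<dots> \<le> 1/2 * S" using \<kappa>n S[of 0] by (intro mult_right_mono) auto
      finally show ?thesis by simp
    qed
    have "S \<le> 1/2 * S" unfolding S_def using le[unfolded S_def] by (intro cSUP_least) auto
    then show ?thesis using S[OF that] by simp
  qed
  define f where "f t = exp t * n t" for t
  show ?thesis
  proof (rule that[of f])
    show fc: "continuous_on UNIV f" unfolding f_def[abs_def] by (intro continuous_intros n(1))
    show f0: "\<And>t. t \<le> 0 \<Longrightarrow> f t = 0" by (simp add: f_def n0)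
    fix t R :: real assume R: "0 \<le> R" "t \<le> 2 * R"
    let ?g = "\<lambda>r. r * exp (- (r\<^sup>2) / 2) * f (t - 2 * r)"
    have gc: "continuous_on {0..R} ?g"
      by (intro continuous_intros continuous_on_compose2[OF fc]) auto
    have "exp t * (\<kappa> r * n (t - 2 * r)) = indicator {0..R} r *\<^sub>R ?g r" for r
      using R n0[of "t - 2 * r"] by (auto simp: \<kappa>_def f_def indicator_def field_simps simp flip: exp_add)
    then have "exp t * (LINT r|lborel. \<kappa> r * n (t - 2 * r)) = (LINT r:{0..R}|lborel. ?g r)"
      unfolding set_lebesgue_integral_def by (simp flip: Bochner_Integration.integral_mult_right_zero)
    also have "\<dots> = integral {0..R} ?g"
      by (rule set_borel_integral_eq_integral) (rule borel_integrable_atLeastAtMost', rule gc)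
    finally have "exp t * (LINT r|lborel. \<kappa> r * n (t - 2 * r)) = integral {0..R} ?g" .
    moreover have "exp t * \<alpha> t = ren_source t"
      by (cases "t \<le> 0") (auto simp: \<alpha>_def ren_source_def simp flip: exp_add)
    ultimately show "f t = ren_source t + integral {0..R} ?g"
      unfolding f_def by (subst n(3)) (simp add: distrib_left)
  qed
qed

text \<open>With \<open>F\<close> the antiderivative of \<open>f\<close>, integrating the equation gives
\<open>F t = A t + \<integral> r exp (- r\<^sup>2 / 2) F (t - 2 r) dr\<close>, and an integration by parts turns the last term into
\<open>F t - 2 \<integral> exp (- r\<^sup>2 / 2) f (t - 2 r) dr\<close>.\<close>

lemma renewal_primitive:
  assumes fc: "continuous_on UNIV f" and f0: "\<And>t. t \<le> 0 \<Longrightarrow> f t = 0"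
    and ren: "\<And>t R. 0 \<le> R \<Longrightarrow> t \<le> 2 * R \<Longrightarrow>
       f t = ren_source t + integral {0..R} (\<lambda>r. r * exp (- (r\<^sup>2) / 2) * f (t - 2 * r))"
    and R: "0 < R" "t \<le> 2 * R"
  shows "ren_source_int t = 2 * integral {0..R} (\<lambda>r. exp (- (r\<^sup>2) / 2) * f (t - 2 * r))"
proof (cases "t \<le> 0")
  case True
  have "integral {0..R} (\<lambda>r. exp (- (r\<^sup>2) / 2) * f (t - 2 * r)) = integral {0..R} (\<lambda>r. 0)"
    using True by (intro integral_cong) (auto simp: f0)
  then show ?thesis using True by (simp add: ren_source_int_def)
next
  case False
  obtain G where G: "\<And>x. (G has_real_derivative f x) (at x)"
    using continuous_antiderivative[OF fc] by blast
  define F where "F x = G x - G 0" for x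
  have F: "(F has_real_derivative f x) (at x)" for x
    unfolding F_def by (auto intro!: derivative_eq_intros G)
  have F0: "F x = 0" if x: "x \<le> 0" for x
  proof (cases "x = 0")
    case False
    then obtain z where "x < z" "z < 0" "F 0 - F x = (0 - x) * f z"
      using MVT2[of x 0 F f] F x by force
    then show ?thesis by (simp add: f0 F_def)
  qed (simp add: F_def)
  have Fc: "continuous_on S (\<lambda>x. F (g x))" if "continuous_on S g" for S :: "'b::topological_space set" and g
  proof -
    have "continuous_on UNIV F" using F by (meson DERIV_isCont continuous_at_imp_continuous_on)
    then show ?thesis using that by (rule continuous_on_compose2) auto
  qed
  have fc': "continuous_on S (\<lambda>x. f (g x))" if "continuous_on S g" for S :: "'b::topological_space set" and g
    using fc that by (rule continuous_on_compose2) auto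
  define k where "k r = r * exp (- (r\<^sup>2) / 2)" for r :: real
  have kc: "continuous_on S (\<lambda>x. k (g x))" if "continuous_on S g" for S :: "'b::topological_space set" and g
    unfolding k_def using that by (intro continuous_intros) auto
  \<comment> \<open>The integrated renewal equation is obtained by comparing derivatives in \<open>t\<close>, starting from \<open>t = 0\<close>.\<close>
  have dI: "((\<lambda>x. integral {0..R} (\<lambda>r. k r * F (x - 2 * r))) has_real_derivative
      integral {0..R} (\<lambda>r. k r * f (x - 2 * r))) (at x)" for x
    unfolding cbox_interval[symmetric]
  proof (rule leibniz_rule_field_derivative[where U = UNIV])
    show "((\<lambda>x. k t * F (x - 2 * t)) has_real_derivative k t * f (x - 2 * t)) (at x within UNIV)" for x t
      using DERIV_cmult[OF DERIV_chain2[OF F DERIV_diff[OF DERIV_ident DERIV_const]]] by auto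
    show "(\<lambda>r. k r * F (x - 2 * r)) integrable_on cbox 0 R" for x
      by (intro integrable_continuous continuous_intros Fc kc)
    show "continuous_on (UNIV \<times> cbox 0 R) (\<lambda>(x, t). k t * f (x - 2 * t))"
      unfolding case_prod_unfold by (intro continuous_intros fc' kc)
  qed auto
  define h where "h x = F x - ren_source_int x - integral {0..R} (\<lambda>r. k r * F (x - 2 * r))" for x
  have "h t = h 0"
  proof (rule DERIV_isconst_end[of 0 t h])
    show "0 < t" using False by simp
    show "continuous_on {0..t} h" unfolding h_def
      by (intro continuous_intros Fc continuous_on_subset[OF continuous_ren_source_int]
            continuous_at_imp_continuous_on ballI DERIV_isCont[OF dI]) auto
    fix x assume x: "0 < x" "x < t"
    have "(h has_real_derivative f x - ren_source x - integral {0..R} (\<lambda>r. k r * f (x - 2 * r))) (at x)"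
      unfolding h_def by (intro DERIV_diff F ren_source_int_deriv x dI)
    then show "(h has_real_derivative 0) (at x)"
      using ren[of R x] R x by (simp add: k_def)
  qed
  moreover have "h 0 = 0"
  proof -
    have "integral {0..R} (\<lambda>r. k r * F (0 - 2 * r)) = integral {0..R} (\<lambda>r. 0)"
      by (intro integral_cong) (auto simp: F0)
    then show ?thesis by (simp add: h_def F0 ren_source_int_def)
  qed
  ultimately have 1: "F t - ren_source_int t = integral {0..R} (\<lambda>r. k r * F (t - 2 * r))" by (simp add: h_def)
  define g where "g r = - (exp (- (r\<^sup>2) / 2) * F (t - 2 * r))" for r
  have "((\<lambda>r. k r * F (t - 2 * r) + 2 * (exp (- (r\<^sup>2) / 2) * f (t - 2 * r))) has_integral (g R - g 0)) {0..R}"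
  proof (rule fundamental_theorem_of_calculus)
    fix r assume "r \<in> {0..R}"
    have "(g has_real_derivative k r * F (t - 2 * r) + 2 * (exp (- (r\<^sup>2) / 2) * f (t - 2 * r))) (at r)"
      unfolding g_def by (auto intro!: derivative_eq_intros DERIV_chain2[OF F] simp: k_def algebra_simps)
    then show "(g has_vector_derivative k r * F (t - 2 * r) + 2 * (exp (- (r\<^sup>2) / 2) * f (t - 2 * r))) (at r within {0..R})"
      by (simp add: has_real_derivative_iff_has_vector_derivative has_vector_derivative_at_within)
  qed (use R in auto)
  then have "integral {0..R} (\<lambda>r. k r * F (t - 2 * r) + 2 * (exp (- (r\<^sup>2) / 2) * f (t - 2 * r))) = F t"
    using R by (auto simp: integral_unique g_def F0)
  moreover have "integral {0..R} (\<lambda>r. k r * F (t - 2 * r) + 2 * (exp (- (r\<^sup>2) / 2) * f (t - 2 * r)))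
     = integral {0..R} (\<lambda>r. k r * F (t - 2 * r)) + integral {0..R} (\<lambda>r. 2 * (exp (- (r\<^sup>2) / 2) * f (t - 2 * r)))"
    by (intro Henstock_Kurzweil_Integration.integral_add integrable_continuous_real continuous_intros Fc fc' kc) auto
  ultimately show ?thesis using 1 by simp
qed

text \<open>The kernel is at most \<open>1/2 - r\<close> on \<open>[0, 1/2]\<close>, \<open>r - 1/2\<close> on \<open>[1/2, 1]\<close> and \<open>r exp (- r\<^sup>2 / 2)\<close> beyond, with
integrals \<open>1/8\<close>, \<open>1/8\<close> and at most \<open>exp (- 1/2) \<le> 2/3\<close>.\<close>

lemma kernel_l1_bound:
  fixes R :: real
  assumes "0 \<le> R"
  shows "integral {0..R} (\<lambda>r. \<bar>r - 1/2\<bar> * exp (- (r\<^sup>2) / 2)) \<le> 11 / 12"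
proof -
  define k where "k r = \<bar>r - 1/2\<bar> * exp (- (r\<^sup>2) / 2)" for r :: real
  have kc: "continuous_on S k" for S unfolding k_def by (intro continuous_intros) auto
  have ki: "k integrable_on {a..b}" for a b by (intro integrable_continuous_real kc)
  have k0: "0 \<le> k r" for r by (simp add: k_def)
  define S :: real where "S = max R 1"
  have 1: "integral {0..1/2} k \<le> 1 / 8"
  proof -
    have "((\<lambda>r. 1/2 - r) has_integral ((1/2) * (1/2) - (1/2)^2 / 2 - ((1/2) * 0 - 0^2/2))) {0..1/2::real}"
      by (rule fundamental_theorem_of_calculus)
         (auto intro!: derivative_eq_intros simp flip: has_real_derivative_iff_has_vector_derivative)
    then have "((\<lambda>r. 1/2 - r) has_integral 1/8) {0..1/2::real}" by (simp add: power2_eq_square)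
    moreover have "k r \<le> 1/2 - r" if "r \<in> {0..1/2}" for r
      using that mult_left_mono[of "exp (- (r\<^sup>2) / 2)" 1 "1/2 - r"] by (auto simp: k_def)
    ultimately show ?thesis
      using integral_le[OF ki, of "\<lambda>r. 1/2 - r" 0 "1/2"] by (auto simp: has_integral_iff)
  qed
  have 2: "integral {1/2..1} k \<le> 1 / 8"
  proof -
    have "((\<lambda>r. r - 1/2) has_integral (1^2 / 2 - (1/2) * 1 - ((1/2)^2/2 - (1/2) * (1/2)))) {1/2..1::real}"
      by (rule fundamental_theorem_of_calculus)
         (auto intro!: derivative_eq_intros simp flip: has_real_derivative_iff_has_vector_derivative)
    then have "((\<lambda>r. r - 1/2) has_integral 1/8) {1/2..1::real}" by (simp add: power2_eq_square)
    moreover have "k r \<le> r - 1/2" if "r \<in> {1/2..1}" for r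
      using that mult_left_mono[of "exp (- (r\<^sup>2) / 2)" 1 "r - 1/2"] by (auto simp: k_def)
    ultimately show ?thesis
      using integral_le[OF ki, of "\<lambda>r. r - 1/2" "1/2" 1] by (auto simp: has_integral_iff)
  qed
  have 3: "integral {1..S} k \<le> 2 / 3"
  proof -
    have "((\<lambda>r. r * exp (- (r\<^sup>2) / 2)) has_integral (- exp (- (S^2) / 2) - (- exp (- (1^2) / 2)))) {1..S}"
      by (rule fundamental_theorem_of_calculus)
         (auto intro!: derivative_eq_intros simp: S_def simp flip: has_real_derivative_iff_has_vector_derivative)
    moreover have "k r \<le> r * exp (- (r\<^sup>2) / 2)" if "r \<in> {1..S}" for r
      using that unfolding k_def by (intro mult_right_mono) auto
    ultimately have "integral {1..S} k \<le> - exp (- (S^2) / 2) + exp (- (1^2) / 2)"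
      using integral_le[OF ki, of "\<lambda>r. r * exp (- (r\<^sup>2) / 2)" 1 S] by (auto simp: has_integral_iff)
    also have "\<dots> \<le> exp (- (1/2))" by simp
    also have "\<dots> \<le> 2 / 3" using exp_ge_add_one_self[of "1/2"] by (simp add: exp_minus field_simps)
    finally show ?thesis .
  qed
  have "integral {0..R} k \<le> integral {0..S} k"
    using k0 by (intro integral_subset_le ki) (auto simp: S_def)
  also have "\<dots> = integral {0..1/2} k + integral {1/2..1} k + integral {1..S} k"
    using Henstock_Kurzweil_Integration.integral_combine[OF _ _ ki, of 0 "1/2" 1] Henstock_Kurzweil_Integration.integral_combine[OF _ _ ki, of 0 1 S] by (simp add: S_def)
  finally show ?thesis using 1 2 3 by (simp add: k_def[abs_def])
qed

text \<open>Subtracting a quarter of the identity of \<open>renewal_primitive\<close> from the renewal equation gives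
\<open>f = a + A / 4 + \<integral> (r - 1/2) exp (- r\<^sup>2 / 2) f (\<sqdot> - 2 r) dr\<close>. The norms \<open>J\<close> of \<open>f\<close> on \<open>[0, T]\<close> thus satisfy
\<open>J \<le> C + 11/12 J\<close> with \<open>C\<close> independent of \<open>T\<close>.\<close>

lemma renewal_solution_l1:
  assumes fc: "continuous_on UNIV f" and f0: "\<And>t. t \<le> 0 \<Longrightarrow> f t = 0"
    and ren: "\<And>t R. 0 \<le> R \<Longrightarrow> t \<le> 2 * R \<Longrightarrow>
       f t = ren_source t + integral {0..R} (\<lambda>r. r * exp (- (r\<^sup>2) / 2) * f (t - 2 * r))"
  shows "integrable lborel f"
proof -
  define b where "b t = \<bar>ren_source t\<bar> + \<bar>ren_source_int t\<bar>" for t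
  define k where "k r = \<bar>r - 1/2\<bar> * exp (- (r\<^sup>2) / 2)" for r :: real
  have bi: "integrable lborel b" unfolding b_def using integrable_ren by auto
  have bc: "continuous_on S b" for S
    unfolding b_def[abs_def] by (intro continuous_intros continuous_on_subset[OF continuous_ren_source] continuous_on_subset[OF continuous_ren_source_int]) auto
  have fc': "continuous_on S (\<lambda>x. f (g x))" if "continuous_on S g" for S :: "'b::topological_space set" and g
    using fc that by (rule continuous_on_compose2) auto
  have kc: "continuous_on S (\<lambda>x. k (g x))" if "continuous_on S g" for S :: "'b::topological_space set" and g
    unfolding k_def using that by (intro continuous_intros) auto
  define C where "C = (LINT t|lborel. b t)"
  have J: "integral {0..T} (\<lambda>t. \<bar>f t\<bar>) \<le> 12 * C" if T: "0 < T" for T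
  proof -
    define J where "J = integral {0..T} (\<lambda>t. \<bar>f t\<bar>)"
    have pt: "\<bar>f t\<bar> \<le> b t + integral {0..T} (\<lambda>r. k r * \<bar>f (t - 2 * r)\<bar>)" if "t \<in> {0..T}" for t
    proof -
      have t: "t \<le> 2 * T" using that T by auto
      let ?i = "\<lambda>r. (r - 1/2) * exp (- (r\<^sup>2) / 2) * f (t - 2 * r)"
      have i1: "(\<lambda>r. r * exp (- (r\<^sup>2) / 2) * f (t - 2 * r)) integrable_on {0..T}"
        by (intro integrable_continuous_real continuous_intros fc') auto
      have i2: "(\<lambda>r. exp (- (r\<^sup>2) / 2) * f (t - 2 * r)) integrable_on {0..T}"
        by (intro integrable_continuous_real continuous_intros fc') auto
      have "integral {0..T} ?i = integral {0..T} (\<lambda>r. r * exp (- (r\<^sup>2) / 2) * f (t - 2 * r) - (1/2) * (exp (- (r\<^sup>2) / 2) * f (t - 2 * r)))"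
        by (intro integral_cong) (simp add: algebra_simps)
      also have "\<dots> = integral {0..T} (\<lambda>r. r * exp (- (r\<^sup>2) / 2) * f (t - 2 * r)) - (1/2) * integral {0..T} (\<lambda>r. exp (- (r\<^sup>2) / 2) * f (t - 2 * r))"
        by (subst Henstock_Kurzweil_Integration.integral_diff[OF i1 integrable_on_mult_right[OF i2]]) simp
      finally have "f t = ren_source t + ren_source_int t / 4 + integral {0..T} ?i"
        using ren[OF _ t] renewal_primitive[OF fc f0 ren T t] T by simp
      moreover have "norm (integral {0..T} ?i) \<le> integral {0..T} (\<lambda>r. k r * \<bar>f (t - 2 * r)\<bar>)"
        by (rule integral_norm_bound_integral)
           (auto intro!: integrable_continuous_real continuous_intros fc' kc simp: abs_mult k_def)
      ultimately show ?thesis by (auto simp: b_def)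
    qed
    have c2: "continuous_on (cbox (0, 0) (T, T)) (\<lambda>(t, r). k r * \<bar>f (t - 2 * r)\<bar>)"
      unfolding case_prod_unfold by (intro continuous_intros fc' kc)
    have c1: "(\<lambda>t. integral {0..T} (\<lambda>r. k r * \<bar>f (t - 2 * r)\<bar>)) integrable_on {0..T}"
      using integrable_continuous_real[OF integral_continuous_on_param[of "{0..T}" 0 T "\<lambda>t r. k r * \<bar>f (t - 2 * r)\<bar>"]] c2
      by (simp add: cbox_Pair_eq)
    have sh: "integral {0..T} (\<lambda>t. \<bar>f (t - 2 * r)\<bar>) \<le> J" if r: "r \<in> {0..T}" for r
    proof -
      have i: "(\<lambda>t. \<bar>f t\<bar>) integrable_on {a..c}" for a c
        by (intro integrable_continuous_real continuous_intros fc')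
      have "integral {0..T} (\<lambda>t. \<bar>f (t - 2 * r)\<bar>) = integral {0 + (- 2 * r)..T + (- 2 * r)} (\<lambda>t. \<bar>f t\<bar>)"
        using integral_shift_real_ivl[of "- 2 * r" "- 2 * r" "T - 2 * r" "\<lambda>t. \<bar>f t\<bar>"] by simp
      also have "\<dots> \<le> integral {- 2 * r..T} (\<lambda>t. \<bar>f t\<bar>)"
        using r by (intro integral_subset_le i) auto
      also have "\<dots> = integral {- 2 * r..0} (\<lambda>t. \<bar>f t\<bar>) + J"
        unfolding J_def using r by (subst Henstock_Kurzweil_Integration.integral_combine[OF _ _ i]) auto
      also have "integral {- 2 * r..0} (\<lambda>t. \<bar>f t\<bar>) = integral {- 2 * r..0} (\<lambda>t. 0)"
        by (intro integral_cong) (auto simp: f0)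
      finally show ?thesis by simp
    qed
    have bint: "integral {0..T} b \<le> C"
    proof -
      have "set_integrable lborel {0..T} b" by (rule borel_integrable_atLeastAtMost') (rule bc)
      then have "integral {0..T} b = (LINT t:{0..T}|lborel. b t)"
        by (rule set_borel_integral_eq_integral(2)[symmetric])
      also have "\<dots> \<le> C" unfolding C_def set_lebesgue_integral_def
        by (rule integral_mono) (use bi \<open>set_integrable lborel {0..T} b\<close> in \<open>auto simp: b_def indicator_def set_integrable_def\<close>)
      finally show ?thesis .
    qed
    have "J \<le> integral {0..T} (\<lambda>t. b t + integral {0..T} (\<lambda>r. k r * \<bar>f (t - 2 * r)\<bar>))"
      unfolding J_def
      by (intro integral_le Henstock_Kurzweil_Integration.integrable_add c1 pt) (auto intro!: integrable_continuous_real continuous_intros fc' bc)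
    also have "\<dots> = integral {0..T} b + integral {0..T} (\<lambda>t. integral {0..T} (\<lambda>r. k r * \<bar>f (t - 2 * r)\<bar>))"
      by (intro Henstock_Kurzweil_Integration.integral_add c1 integrable_continuous_real bc)
    also have "integral {0..T} (\<lambda>t. integral {0..T} (\<lambda>r. k r * \<bar>f (t - 2 * r)\<bar>))
        = integral {0..T} (\<lambda>r. integral {0..T} (\<lambda>t. k r * \<bar>f (t - 2 * r)\<bar>))"
      using integral_swap_continuous[OF c2] by simp
    also have "\<dots> \<le> integral {0..T} (\<lambda>r. k r * J)"
    proof (rule integral_le)
      show "(\<lambda>r. integral {0..T} (\<lambda>t. k r * \<bar>f (t - 2 * r)\<bar>)) integrable_on {0..T}"
        unfolding cbox_interval[symmetric]
        by (intro integrable_continuous integral_continuous_on_param)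
           (auto simp: case_prod_unfold intro!: continuous_intros fc' kc)
      show "(\<lambda>r. k r * J) integrable_on {0..T}" by (intro integrable_continuous_real continuous_intros kc)
      fix r assume r: "r \<in> {0..T}"
      show "integral {0..T} (\<lambda>t. k r * \<bar>f (t - 2 * r)\<bar>) \<le> k r * J"
        using sh[OF r] by (simp add: mult_left_mono k_def)
    qed
    also have "\<dots> = integral {0..T} k * J" by simp
    also have "\<dots> \<le> 11 / 12 * J"
    proof (rule mult_right_mono)
      show "integral {0..T} k \<le> 11 / 12" using kernel_l1_bound[of T] T by (simp add: k_def[abs_def])
      show "0 \<le> J" unfolding J_def
        by (intro integral_nonneg integrable_continuous_real continuous_intros fc') auto
    qed
    finally have "J \<le> C + 11 / 12 * J" using bint by simp
    then show ?thesis by (simp add: J_def)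
  qed
  have "(\<lambda>t. \<bar>f t\<bar>) integrable_on {0..} \<and> (\<lambda>n. integral {0..} (\<lambda>t. if t \<in> {0..real n + 1} then \<bar>f t\<bar> else 0)) \<longlonglongrightarrow> integral {0..} (\<lambda>t. \<bar>f t\<bar>)"
  proof (rule monotone_convergence_increasing)
    have i: "(\<lambda>t. \<bar>f t\<bar>) integrable_on {a..c}" for a c
      by (intro integrable_continuous_real continuous_intros fc')
    have hi: "((\<lambda>t. if t \<in> {0..real n + 1} then \<bar>f t\<bar> else 0) has_integral integral {0..real n + 1} (\<lambda>t. \<bar>f t\<bar>)) {0..}" for n
      by (subst has_integral_restrict) (auto intro!: integrable_integral i)
    have eq: "integral {0..} (\<lambda>t. if t \<in> {0..real n + 1} then \<bar>f t\<bar> else 0) = integral {0..real n + 1} (\<lambda>t. \<bar>f t\<bar>)" for n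
      using hi by (rule integral_unique)
    show "(\<lambda>t. if t \<in> {0..real n + 1} then \<bar>f t\<bar> else 0) integrable_on {0..}" for n
      using hi by blast
    show "(\<lambda>n. if x \<in> {0..real n + 1} then \<bar>f x\<bar> else 0) \<longlonglongrightarrow> \<bar>f x\<bar>" if "x \<in> {0..}" for x
    proof (rule tendsto_eventually)
      have "\<forall>\<^sub>F n in sequentially. x \<le> real n" using eventually_ge_at_top[of "nat \<lceil>x\<rceil>"]
        by eventually_elim linarith
      then show "\<forall>\<^sub>F n in sequentially. (if x \<in> {0..real n + 1} then \<bar>f x\<bar> else 0) = \<bar>f x\<bar>"
        by eventually_elim (use that in auto)
    qed
    have "0 \<le> integral {0..real n + 1} (\<lambda>t. \<bar>f t\<bar>)" for n by (intro integral_nonneg i) auto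
    then show "bounded (range (\<lambda>n. integral {0..} (\<lambda>t. if t \<in> {0..real n + 1} then \<bar>f t\<bar> else 0)))"
      unfolding eq using J by (auto simp: bounded_iff intro!: exI[of _ "12 * C"])
  qed auto
  then have abs: "(\<lambda>t. \<bar>f t\<bar>) absolutely_integrable_on {0..}"
    by (intro nonnegative_absolutely_integrable_1) auto
  have fm: "f \<in> borel_measurable borel" using fc by (rule borel_measurable_continuous_onI)
  from abs have "set_integrable lborel {0..} (\<lambda>t. \<bar>f t\<bar>)"
    unfolding set_integrable_def
    by (subst (asm) integrable_completion) 
       (use fm in auto)
  then have "integrable lborel (\<lambda>t. indicator {0..} t *\<^sub>R \<bar>f t\<bar>)" by (simp add: set_integrable_def)
  moreover have "indicator {0..} t *\<^sub>R \<bar>f t\<bar> = \<bar>f t\<bar>" for t using f0[of t] by (auto simp: indicator_def)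
  ultimately have "integrable lborel (\<lambda>t. \<bar>f t\<bar>)" by (simp only:)
  then show ?thesis using fm by (subst (asm) integrable_abs_iff) auto
qed

section \<open>The conditional mean given the starting point\<close>

definition ren_sol :: "real \<Rightarrow> real" where
  "ren_sol = (SOME f. continuous_on UNIV f \<and> (\<forall>t\<le>0. f t = 0) \<and> (\<forall>t R. 0 \<le> R \<longrightarrow> t \<le> 2 * R \<longrightarrow>
       f t = ren_source t + integral {0..R} (\<lambda>r. r * exp (- (r\<^sup>2) / 2) * f (t - 2 * r))))"

lemma ren_sol: "continuous_on UNIV ren_sol" "\<And>t. t \<le> 0 \<Longrightarrow> ren_sol t = 0"
  "\<And>t R. 0 \<le> R \<Longrightarrow> t \<le> 2 * R \<Longrightarrow>
       ren_sol t = ren_source t + integral {0..R} (\<lambda>r. r * exp (- (r\<^sup>2) / 2) * ren_sol (t - 2 * r))"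
proof -
  obtain f where "continuous_on UNIV f" "\<And>t. t \<le> 0 \<Longrightarrow> f t = 0"
    "\<And>t R. 0 \<le> R \<Longrightarrow> t \<le> 2 * R \<Longrightarrow>
       f t = ren_source t + integral {0..R} (\<lambda>r. r * exp (- (r\<^sup>2) / 2) * f (t - 2 * r))"
    using renewal_solution by blast
  then have "\<exists>f. continuous_on UNIV f \<and> (\<forall>t\<le>0. f t = 0) \<and> (\<forall>t R. 0 \<le> R \<longrightarrow> t \<le> 2 * R \<longrightarrow>
       f t = ren_source t + integral {0..R} (\<lambda>r. r * exp (- (r\<^sup>2) / 2) * f (t - 2 * r)))"
    by blast
  from someI_ex[OF this] show "continuous_on UNIV ren_sol" "\<And>t. t \<le> 0 \<Longrightarrow> ren_sol t = 0"
  "\<And>t R. 0 \<le> R \<Longrightarrow> t \<le> 2 * R \<Longrightarrow>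
       ren_sol t = ren_source t + integral {0..R} (\<lambda>r. r * exp (- (r\<^sup>2) / 2) * ren_sol (t - 2 * r))"
    unfolding ren_sol_def by blast+
qed

lemma integrable_ren_sol: "integrable lborel ren_sol"
  by (rule renewal_solution_l1[OF ren_sol])

text \<open>The mean at time \<open>t\<close> of the process started at \<open>0\<close>, continued by the identity to negative times: from \<open>x \<le> 0\<close>
the process moves to \<open>0\<close> without jumping, so \<open>mean0 (t + x)\<close> is its mean at time \<open>t\<close> whether or not \<open>0\<close> has
been reached by then.\<close>

definition mean0 :: "real \<Rightarrow> real" where
  "mean0 t = (if t \<le> 0 then t else ren_sol t)"

lemma mean0_neg: "t \<le> 0 \<Longrightarrow> mean0 t = t" by (simp add: mean0_def)

lemma continuous_mean0: "continuous_on UNIV mean0"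
proof -
  have "continuous_on ({..0} \<union> {0..}) (\<lambda>t. if t \<le> 0 then t else ren_sol t)"
    by (intro continuous_on_If continuous_intros continuous_on_subset[OF ren_sol(1)]) (auto simp: ren_sol(2))
  moreover have "{..0} \<union> {0..} = (UNIV :: real set)" by auto
  ultimately show ?thesis unfolding mean0_def[abs_def] by simp
qed

lemma continuous_on_mean0 [continuous_intros]:
  "continuous_on S g \<Longrightarrow> continuous_on S (\<lambda>x. mean0 (g x))"
  by (rule continuous_on_compose2[OF continuous_mean0]) auto

lemma measurable_mean0 [measurable]: "mean0 \<in> borel_measurable borel"
  by (rule borel_measurable_continuous_onI[OF continuous_mean0])

text \<open>The continuation by the identity absorbs the second part of \<open>ren_source\<close> into the integral.\<close>

lemma mean0_renewal:
  assumes c: "0 \<le> c"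
  shows "mean0 c = integral {0..c} (\<lambda>y. y * exp (- (y\<^sup>2) / 2) * mean0 (c - 2 * y)) + c * exp (- (c\<^sup>2) / 2)"
proof (cases "c = 0")
  case False
  then have c': "0 < c" using c by simp
  let ?g = "\<lambda>y. y * exp (- (y\<^sup>2) / 2) * mean0 (c - 2 * y)"
  have gi: "?g integrable_on {a..b}" for a b
    by (intro integrable_continuous_real continuous_intros) auto
  have 1: "integral {0..c/2} ?g = integral {0..c/2} (\<lambda>r. r * exp (- (r\<^sup>2) / 2) * ren_sol (c - 2 * r))"
    by (intro integral_cong) (auto simp: mean0_def ren_sol(2))
  define h where "h y = - exp (- (y\<^sup>2) / 2) * (c - 2 * y) - 2 * gauss_prim y" for y
  have "((\<lambda>y. y * exp (- (y\<^sup>2) / 2) * (c - 2 * y)) has_integral (h c - h (c / 2))) {c/2..c}"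
  proof (rule fundamental_theorem_of_calculus)
    fix y :: real
    have "(h has_real_derivative y * exp (- (y\<^sup>2) / 2) * (c - 2 * y)) (at y)"
      unfolding h_def by (auto intro!: derivative_eq_intros gauss_prim_deriv simp: algebra_simps)
    then show "(h has_vector_derivative y * exp (- (y\<^sup>2) / 2) * (c - 2 * y)) (at y within {c/2..c})"
      by (simp add: has_real_derivative_iff_has_vector_derivative has_vector_derivative_at_within)
  qed (use c in auto)
  then have "integral {c/2..c} (\<lambda>y. y * exp (- (y\<^sup>2) / 2) * (c - 2 * y)) = h c - h (c / 2)" by (rule integral_unique)
  moreover have "integral {c/2..c} ?g = integral {c/2..c} (\<lambda>y. y * exp (- (y\<^sup>2) / 2) * (c - 2 * y))"
    by (intro integral_cong) (auto simp: mean0_def)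
  ultimately have 2: "integral {c/2..c} ?g = c * exp (- (c\<^sup>2) / 2) - 2 * (gauss_prim c - gauss_prim (c / 2))"
    by (simp add: h_def)
  have "integral {0..c} ?g = integral {0..c/2} ?g + integral {c/2..c} ?g"
    using Henstock_Kurzweil_Integration.integral_combine[OF _ _ gi, of 0 "c/2" c] c by simp
  then show ?thesis using ren_sol(3)[of "c/2" c] c' 1 2 by (simp add: mean0_def ren_source_def)
qed (simp add: mean0_def)

text \<open>The mean at time \<open>t\<close> of the process started at \<open>x\<close>. For \<open>x > 0\<close> the height \<open>y\<close> just before the first jump has
density \<open>y exp ((x\<^sup>2 - y\<^sup>2) / 2)\<close>; the jump happens at time \<open>y - x\<close> and leads to \<open>- y\<close>, from where the mean at
time \<open>t\<close> is \<open>mean0 (t - (y - x) - y)\<close>. The last summand belongs to the paths without a jump up to time \<open>t\<close>.\<close>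

definition cmean :: "real \<Rightarrow> real \<Rightarrow> real" where
  "cmean t x = (if x \<le> 0 then mean0 (t + x)
     else exp (x\<^sup>2 / 2) * (integral {x..t + x} (\<lambda>y. y * exp (- (y\<^sup>2) / 2) * mean0 (t + x - 2 * y))
            + (t + x) * exp (- ((t + x)\<^sup>2) / 2)))"

text \<open>At \<open>x = 0\<close> both branches of the definition agree; this is the renewal equation.\<close>

lemma cmean_nonneg:
  assumes "0 \<le> x" "0 \<le> t"
  shows "cmean t x = exp (x\<^sup>2 / 2) * (integral {x..t + x} (\<lambda>y. y * exp (- (y\<^sup>2) / 2) * mean0 (t + x - 2 * y))
            + (t + x) * exp (- ((t + x)\<^sup>2) / 2))"
  using mean0_renewal[of t] assms by (cases "x = 0") (auto simp: cmean_def)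

lemma cmean_0: "cmean 0 x = x"
  by (simp add: cmean_def mean0_neg flip: exp_add)

text \<open>For \<open>x \<ge> 0\<close> this is the density of the first jump time from \<open>x\<close>. For \<open>x < 0\<close> any probability density serves,
since \<open>jump_cmean\<close> is then constant in \<open>r\<close>; with this choice one integral covers all starting points.\<close>

definition jump_dens :: "real \<Rightarrow> real \<Rightarrow> real" where
  "jump_dens x r = indicator {0..} r * ((max x 0 + r) * exp (- (max x 0 * r + r\<^sup>2 / 2)))"

text \<open>The mean at time \<open>t\<close> given the start \<open>x\<close> and, if \<open>x > 0\<close>, the first jump time \<open>r\<close>.\<close>

definition jump_cmean :: "real \<Rightarrow> real \<Rightarrow> real \<Rightarrow> real" where
  "jump_cmean t x r = (if x \<le> 0 then mean0 (t + x) else if r \<le> t then mean0 (t - x - 2 * r) else t + x)"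

lemma jump_tail:
  fixes y t :: real
  assumes "0 \<le> y" "0 \<le> t"
  shows "has_bochner_integral lborel (\<lambda>r. indicator {t..} r * ((y + r) * exp (- (y * r + r\<^sup>2 / 2)))) (exp (- (y * t + t\<^sup>2 / 2)))"
proof -
  have "(\<integral>\<^sup>+r. ennreal ((y + r) * exp (- (y * r + r\<^sup>2 / 2))) * indicator {t..} r \<partial>lborel) = 0 - (- exp (- (y * t + t\<^sup>2 / 2)))"
  proof (rule nn_integral_FTC_atLeast)
    show "((\<lambda>r. - exp (- (y * r + r\<^sup>2 / 2))) has_real_derivative (y + r) * exp (- (y * r + r\<^sup>2 / 2))) (at r)" for r
      by (auto intro!: derivative_eq_intros simp: algebra_simps)
    show "((\<lambda>r. - exp (- (y * r + r\<^sup>2 / 2))) \<longlongrightarrow> 0) at_top"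
    proof (rule tendsto_0_le[where K=1])
      show "((\<lambda>r::real. exp (- r)) \<longlongrightarrow> 0) at_top"
        using exp_at_bot filterlim_uminus_at_bot_at_top filterlim_compose by blast
      show "\<forall>\<^sub>F r in at_top. norm (- exp (- (y * r + r\<^sup>2 / 2))) \<le> norm (exp (- r)) * 1"
      proof (rule eventually_mono[OF eventually_ge_at_top[of 2]])
        fix r :: real assume r: "2 \<le> r"
        have yr: "0 \<le> y * r" using r assms by simp
        have "r * 2 \<le> r * r" using r by (intro mult_left_mono) auto
        then show "norm (- exp (- (y * r + r\<^sup>2 / 2))) \<le> norm (exp (- r)) * 1"
          using yr by (simp add: power2_eq_square)
      qed
    qed
  qed (use assms in auto)
  moreover have "ennreal ((y + r) * exp (- (y * r + r\<^sup>2 / 2))) * indicator {t..} r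
     = ennreal (indicator {t..} r * ((y + r) * exp (- (y * r + r\<^sup>2 / 2))))" for r
    by (auto simp: indicator_def)
  ultimately show ?thesis
    using assms by (intro has_bochner_integral_nn_integral) (auto simp: indicator_def)
qed

lemma jump_dens_nonneg: "0 \<le> jump_dens x r"
  by (auto simp: jump_dens_def indicator_def)

lemma jump_dens_measurable [measurable]: "case_prod jump_dens \<in> borel_measurable (borel \<Otimes>\<^sub>M borel)"
  unfolding jump_dens_def case_prod_unfold by measurable

lemma jump_dens_measurable1 [measurable]: "jump_dens x \<in> borel_measurable borel"
  unfolding jump_dens_def[abs_def] by measurable

lemma jump_cmean_measurable [measurable]:
  "(\<lambda>(t, x, r). jump_cmean t x r) \<in> borel_measurable (borel \<Otimes>\<^sub>M borel \<Otimes>\<^sub>M borel)"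
  unfolding jump_cmean_def case_prod_unfold by measurable

lemma jump_cmean_measurable1 [measurable]: "jump_cmean t x \<in> borel_measurable borel"
  unfolding jump_cmean_def[abs_def] by (cases "x \<le> 0") simp_all

lemma jump_dens_integral: "integrable lborel (jump_dens x)" "(LINT r|lborel. jump_dens x r) = 1"
  using jump_tail[of "max x 0" 0] by (simp_all add: has_bochner_integral_iff jump_dens_def[abs_def])

lemma mean0_bound:
  obtains B where "0 \<le> B" "\<And>u. u \<le> t \<Longrightarrow> \<bar>mean0 u\<bar> \<le> B + \<bar>u\<bar>"
proof -
  have "bounded (mean0 ` {0..t})"
    by (intro compact_imp_bounded compact_continuous_image continuous_intros) auto
  then obtain B where "\<forall>x\<in>mean0 ` {0..t}. norm x \<le> B" unfolding bounded_iff by blast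
  then have B: "\<And>u. u \<in> {0..t} \<Longrightarrow> \<bar>mean0 u\<bar> \<le> B" by simp
  show ?thesis
  proof (rule that[of "\<bar>B\<bar>"])
    fix u assume "u \<le> t"
    then show "\<bar>mean0 u\<bar> \<le> \<bar>B\<bar> + \<bar>u\<bar>" using B[of u] by (cases "u \<le> 0") (auto simp: mean0_neg)
  qed auto
qed

lemma jump_cmean_bound:
  obtains B where "0 \<le> B" "\<And>s x r. 0 \<le> s \<Longrightarrow> s \<le> t \<Longrightarrow> 0 \<le> r \<Longrightarrow> \<bar>jump_cmean s x r\<bar> \<le> B + \<bar>x\<bar>"
proof -
  obtain B where B: "0 \<le> B" "\<And>u. u \<le> t \<Longrightarrow> \<bar>mean0 u\<bar> \<le> B + \<bar>u\<bar>" using mean0_bound[of t] by blast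
  show ?thesis
  proof (rule that[of "B + \<bar>t\<bar>"])
    fix s x r :: real assume s: "0 \<le> s" "s \<le> t" "0 \<le> r"
    show "\<bar>jump_cmean s x r\<bar> \<le> B + \<bar>t\<bar> + \<bar>x\<bar>"
      unfolding jump_cmean_def using B(2)[of "s + x"] B(2)[of "s - x - 2 * r"] B(1) s by auto
  qed (use B in auto)
qed

lemma cmean_kernel_integrable:
  assumes "0 \<le> t" shows "integrable lborel (\<lambda>r. jump_dens x r * jump_cmean t x r)"
proof -
  obtain B where B: "0 \<le> B" "\<And>s x r. 0 \<le> s \<Longrightarrow> s \<le> t \<Longrightarrow> 0 \<le> r \<Longrightarrow> \<bar>jump_cmean s x r\<bar> \<le> B + \<bar>x\<bar>"
    using jump_cmean_bound[of t] by blast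
  show ?thesis
  proof (rule Bochner_Integration.integrable_bound)
    show "integrable lborel (\<lambda>r. jump_dens x r * (B + \<bar>x\<bar>))" using jump_dens_integral(1) by auto
    show "AE r in lborel. norm (jump_dens x r * jump_cmean t x r) \<le> norm (jump_dens x r * (B + \<bar>x\<bar>))"
    proof (rule AE_I2)
      fix r
      show "norm (jump_dens x r * jump_cmean t x r) \<le> norm (jump_dens x r * (B + \<bar>x\<bar>))"
        using B(2)[of t r x] B(1) assms jump_dens_nonneg[of x r]
        by (cases "0 \<le> r") (auto simp: abs_mult jump_dens_def intro!: mult_left_mono)
    qed
  qed auto
qed

lemma cmean_kernel:
  assumes t: "0 \<le> t"
  shows "cmean t x = (LINT r|lborel. jump_dens x r * jump_cmean t x r)"
proof (cases "x \<le> 0")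
  case True
  then show ?thesis by (simp add: cmean_def jump_cmean_def jump_dens_integral)
next
  case False
  let ?k = "\<lambda>r. (x + r) * exp (- (x * r + r\<^sup>2 / 2))"
  let ?g = "\<lambda>r. ?k r * mean0 (t - x - 2 * r)"
  have i1: "set_integrable lborel {0..t} ?g"
    by (intro borel_integrable_atLeastAtMost' continuous_intros) auto
  have i2: "has_bochner_integral lborel (\<lambda>r. indicator {t..} r * ?k r) (exp (- (x * t + t\<^sup>2 / 2)))"
    using jump_tail[of x t] t False by simp
  have "(LINT r|lborel. jump_dens x r * jump_cmean t x r)
     = (LINT r|lborel. indicator {0..t} r *\<^sub>R ?g r + indicator {t..} r * ?k r * (t + x))"
  proof (rule integral_cong_AE)
    have "AE r in lborel. r \<noteq> t" by (rule AE_lborel_singleton)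
    then show "AE r in lborel. jump_dens x r * jump_cmean t x r = indicator {0..t} r *\<^sub>R ?g r + indicator {t..} r * ?k r * (t + x)"
      by eventually_elim (use False t in \<open>auto simp: jump_dens_def jump_cmean_def indicator_def\<close>)
  qed measurable
  also have "\<dots> = (LINT r:{0..t}|lborel. ?g r) + (LINT r|lborel. indicator {t..} r * ?k r) * (t + x)"
    unfolding set_lebesgue_integral_def using i1 i2
    by (subst Bochner_Integration.integral_add) (auto simp: set_integrable_def has_bochner_integral_iff)
  also have "(LINT r|lborel. indicator {t..} r * ?k r) = exp (- (x * t + t\<^sup>2 / 2))"
    using i2 by (simp add: has_bochner_integral_iff)
  also have "(LINT r:{0..t}|lborel. ?g r) = integral {0..t} ?g"
    by (rule set_borel_integral_eq_integral(2)[OF i1])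
  also have "\<dots> = integral {x..t + x} (\<lambda>y. exp (x\<^sup>2 / 2) * (y * exp (- (y\<^sup>2) / 2) * mean0 (t + x - 2 * y)))"
    using integral_shift_real_ivl[of x x "t + x" "\<lambda>y. exp (x\<^sup>2 / 2) * (y * exp (- (y\<^sup>2) / 2) * mean0 (t + x - 2 * y))"]
    by (simp add: algebra_simps power2_sum add_divide_distrib diff_divide_distrib flip: exp_add)
  also have "\<dots> = exp (x\<^sup>2 / 2) * integral {x..t + x} (\<lambda>y. y * exp (- (y\<^sup>2) / 2) * mean0 (t + x - 2 * y))"
    by simp
  moreover have "exp (- (x * t + t\<^sup>2 / 2)) = exp (x\<^sup>2 / 2) * exp (- ((t + x)\<^sup>2) / 2)"
    by (simp add: power2_sum add_divide_distrib diff_divide_distrib algebra_simps flip: exp_add)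
  ultimately show ?thesis using False
    by (simp add: cmean_def distrib_left) (simp add: algebra_simps)
qed

lemma cmean_bound:
  obtains B where "0 \<le> B" "\<And>s x. 0 \<le> s \<Longrightarrow> s \<le> t \<Longrightarrow> \<bar>cmean s x\<bar> \<le> B + \<bar>x\<bar>"
proof -
  obtain B where B: "0 \<le> B" "\<And>s x r. 0 \<le> s \<Longrightarrow> s \<le> t \<Longrightarrow> 0 \<le> r \<Longrightarrow> \<bar>jump_cmean s x r\<bar> \<le> B + \<bar>x\<bar>"
    using jump_cmean_bound[of t] by blast
  show ?thesis
  proof (rule that[OF B(1)])
    fix s x assume s: "0 \<le> s" "s \<le> t"
    have "\<bar>cmean s x\<bar> \<le> (LINT r|lborel. \<bar>jump_dens x r * jump_cmean s x r\<bar>)"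
      unfolding cmean_kernel[OF s(1)] by (rule integral_abs_bound)
    also have "\<dots> \<le> (LINT r|lborel. jump_dens x r * (B + \<bar>x\<bar>))"
    proof (rule integral_mono)
      fix r
      show "\<bar>jump_dens x r * jump_cmean s x r\<bar> \<le> jump_dens x r * (B + \<bar>x\<bar>)"
        using B(2)[of s r x] B(1) s jump_dens_nonneg[of x r]
        by (cases "0 \<le> r") (auto simp: abs_mult jump_dens_def intro!: mult_left_mono)
    qed (use cmean_kernel_integrable[OF s(1)] jump_dens_integral(1) in auto)
    also have "\<dots> = B + \<bar>x\<bar>" using jump_dens_integral(2) by simp
    finally show "\<bar>cmean s x\<bar> \<le> B + \<bar>x\<bar>" .
  qed
qed

text \<open>Splitting off \<open>x \<le> y \<le> x + d\<close> in the definition conditions on the first jump in \<open>[0, d]\<close> and keeps \<open>t + x\<close>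
fixed. Freezing the jump rate at \<open>x\<close> changes the probabilities by at most \<open>d\<^sup>2 / 2\<close>; freezing the position after
the jump costs the modulus of continuity \<open>w\<close> of \<open>mean0\<close> times the probability of a jump.\<close>

lemma cmean_one_step:
  assumes x: "0 \<le> x" and d: "0 < d" "d \<le> t"
    and w: "\<And>u. \<bar>u - (t - d - x)\<bar> \<le> d \<Longrightarrow> \<bar>mean0 u - mean0 (t - d - x)\<bar> \<le> w"
    and C: "\<bar>cmean (t - d) (x + d)\<bar> \<le> C" "\<bar>mean0 (t - d - x)\<bar> \<le> C"
  shows "\<bar>cmean t x - (exp (- (d * x)) * cmean (t - d) (x + d) + (1 - exp (- (d * x))) * mean0 (t - d - x))\<bar>
     \<le> d\<^sup>2 * C + w * (d * x + d\<^sup>2)"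
proof -
  define q where "q = exp (- (d * x + d\<^sup>2 / 2))"
  define p where "p = exp (- (d * x))"
  define m where "m = mean0 (t - d - x)"
  define k where "k y = exp (x\<^sup>2 / 2) * (y * exp (- (y\<^sup>2) / 2))" for y
  let ?g = "\<lambda>y. y * exp (- (y\<^sup>2) / 2) * mean0 (t + x - 2 * y)"
  have gi: "?g integrable_on {a..b}" for a b
    by (intro integrable_continuous_real continuous_intros) auto
  have ki: "k integrable_on {a..b}" for a b unfolding k_def
    by (intro integrable_continuous_real continuous_intros) auto
  have ki': "(\<lambda>y. k y * mean0 (t + x - 2 * y)) integrable_on {a..b}" for a b unfolding k_def
    by (intro integrable_continuous_real continuous_intros) auto
  have "(k has_integral (- exp (x\<^sup>2 / 2 - (x + d)\<^sup>2 / 2) - (- exp (x\<^sup>2 / 2 - x\<^sup>2 / 2)))) {x..x + d}"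
  proof (rule fundamental_theorem_of_calculus)
    fix y :: real
    have "((\<lambda>y. - exp (x\<^sup>2 / 2 - y\<^sup>2 / 2)) has_real_derivative k y) (at y)"
      unfolding k_def by (auto intro!: derivative_eq_intros simp: algebra_simps simp flip: exp_add)
    then show "((\<lambda>y. - exp (x\<^sup>2 / 2 - y\<^sup>2 / 2)) has_vector_derivative k y) (at y within {x..x + d})"
      by (simp add: has_real_derivative_iff_has_vector_derivative has_vector_derivative_at_within)
  qed (use d in auto)
  moreover have "- exp (x\<^sup>2 / 2 - (x + d)\<^sup>2 / 2) - (- exp (x\<^sup>2 / 2 - x\<^sup>2 / 2)) = 1 - q"
    unfolding q_def by (simp add: power2_sum add_divide_distrib algebra_simps)
  ultimately have kq: "(k has_integral (1 - q)) {x..x + d}" by simp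
  have split: "integral {x..t + x} ?g = integral {x..x + d} ?g + integral {x + d..t + x} ?g"
    using Henstock_Kurzweil_Integration.integral_combine[OF _ _ gi, of x "x + d" "t + x"] d by simp
  have "cmean t x = exp (x\<^sup>2 / 2) * (integral {x..t + x} ?g + (t + x) * exp (- ((t + x)\<^sup>2) / 2))"
    by (rule cmean_nonneg) (use x d in auto)
  also have "\<dots> = exp (x\<^sup>2 / 2) * integral {x..x + d} ?g
      + exp (x\<^sup>2 / 2) * (integral {x + d..t + x} ?g + (t + x) * exp (- ((t + x)\<^sup>2) / 2))"
    by (simp only: split distrib_left add.assoc)
  also have "exp (x\<^sup>2 / 2) * (integral {x + d..t + x} ?g + (t + x) * exp (- ((t + x)\<^sup>2) / 2)) = q * cmean (t - d) (x + d)"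
  proof -
    have "exp (x\<^sup>2 / 2) = q * exp ((x + d)\<^sup>2 / 2)"
      unfolding q_def by (simp add: power2_sum add_divide_distrib algebra_simps flip: exp_add)
    then show ?thesis using x d by (subst cmean_nonneg) auto
  qed
  also have "exp (x\<^sup>2 / 2) * integral {x..x + d} ?g = integral {x..x + d} (\<lambda>y. k y * mean0 (t + x - 2 * y))"
    unfolding k_def by (simp add: mult.assoc)
  also have "\<dots> = integral {x..x + d} (\<lambda>y. k y * (mean0 (t + x - 2 * y) - m)) + (1 - q) * m"
  proof -
    have "integral {x..x + d} (\<lambda>y. k y * (mean0 (t + x - 2 * y) - m))
       = integral {x..x + d} (\<lambda>y. k y * mean0 (t + x - 2 * y)) - integral {x..x + d} (\<lambda>y. k y * m)"
      unfolding right_diff_distrib by (intro Henstock_Kurzweil_Integration.integral_diff ki' integrable_on_mult_left ki)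
    then show ?thesis using kq by (simp add: integral_unique)
  qed
  finally have eq: "cmean t x - (p * cmean (t - d) (x + d) + (1 - p) * m)
     = integral {x..x + d} (\<lambda>y. k y * (mean0 (t + x - 2 * y) - m)) + (q - p) * cmean (t - d) (x + d) - (q - p) * m"
    by (simp add: algebra_simps)
  have "norm (integral {x..x + d} (\<lambda>y. k y * (mean0 (t + x - 2 * y) - m))) \<le> integral {x..x + d} (\<lambda>y. k y * w)"
  proof (rule integral_norm_bound_integral)
    show "(\<lambda>y. k y * (mean0 (t + x - 2 * y) - m)) integrable_on {x..x + d}" unfolding k_def
      by (intro integrable_continuous_real continuous_intros) auto
    fix y assume y: "y \<in> {x..x + d}"
    have "\<bar>mean0 (t + x - 2 * y) - m\<bar> \<le> w" unfolding m_def by (rule w) (use y in auto)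
    then show "norm (k y * (mean0 (t + x - 2 * y) - m)) \<le> k y * w"
      using y x by (auto simp: abs_mult k_def intro!: mult_left_mono)
  qed (intro integrable_on_mult_left ki)
  also have "\<dots> = (1 - q) * w" using kq by (simp add: integral_unique)
  finally have 1: "\<bar>integral {x..x + d} (\<lambda>y. k y * (mean0 (t + x - 2 * y) - m))\<bar> \<le> (1 - q) * w" by simp
  have w0: "0 \<le> w" using w[of "t - d - x"] d by simp
  have q1: "1 - q \<le> d * x + d\<^sup>2" unfolding q_def
    using exp_ge_add_one_self[of "- (d * x + d\<^sup>2 / 2)"] zero_le_power2[of d] by linarith
  have pq: "\<bar>q - p\<bar> \<le> d\<^sup>2 / 2"
  proof -
    have "q = p * exp (- (d\<^sup>2 / 2))" unfolding q_def p_def by (simp flip: exp_add)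
    then have "p - q = p * (1 - exp (- (d\<^sup>2 / 2)))" by (simp add: algebra_simps)
    also have "\<dots> \<le> 1 * (d\<^sup>2 / 2)"
      using exp_ge_add_one_self[of "- (d\<^sup>2 / 2)"] x d by (intro mult_mono) (auto simp: p_def)
    finally have "p - q \<le> d\<^sup>2 / 2" by simp
    moreover have "q \<le> p" unfolding q_def p_def by simp
    ultimately show ?thesis by simp
  qed
  have 2: "\<bar>(q - p) * cmean (t - d) (x + d)\<bar> \<le> d\<^sup>2 / 2 * C" "\<bar>(q - p) * m\<bar> \<le> d\<^sup>2 / 2 * C"
    unfolding abs_mult using pq C by (intro mult_mono; auto simp: m_def)+
  have 3: "(1 - q) * w \<le> (d * x + d\<^sup>2) * w" using q1 w0 by (rule mult_right_mono)
  have tri: "\<bar>a + b - c\<bar> \<le> \<bar>a\<bar> + \<bar>b\<bar> + \<bar>c\<bar>" for a b c :: real by linarith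
  have "\<bar>cmean t x - (p * cmean (t - d) (x + d) + (1 - p) * m)\<bar>
     \<le> (d * x + d\<^sup>2) * w + d\<^sup>2 / 2 * C + d\<^sup>2 / 2 * C"
    unfolding eq by (intro order_trans[OF tri] add_mono 2 order_trans[OF 1 3])
  then show ?thesis unfolding p_def m_def by (simp add: algebra_simps)
qed

lemma cmean_continuous:
  assumes t: "0 \<le> t" and x: "x \<noteq> 0" and X: "X \<longlonglongrightarrow> x"
  shows "(\<lambda>n. cmean t (X n)) \<longlonglongrightarrow> cmean t x"
proof (cases "x < 0")
  case True
  have "\<forall>\<^sub>F n in sequentially. cmean t (X n) = mean0 (t + X n)"
    using order_tendstoD(2)[OF X True] by eventually_elim (auto simp: cmean_def)
  moreover have "(\<lambda>n. mean0 (t + X n)) \<longlonglongrightarrow> mean0 (t + x)"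
    by (intro continuous_on_tendsto_compose[OF continuous_mean0] tendsto_intros X) auto
  ultimately show ?thesis using True by (simp add: cmean_def tendsto_cong)
next
  case False
  then have x0: "0 < x" using x by simp
  have ev: "\<forall>\<^sub>F n in sequentially. 0 < X n" using order_tendstoD(1)[OF X x0] .
  obtain K where K: "\<And>n. \<bar>X n\<bar> \<le> K" using convergent_imp_Bseq[of X] X unfolding Bseq_def convergent_def by auto
  obtain B where B: "0 \<le> B" "\<And>s x r. 0 \<le> s \<Longrightarrow> s \<le> t \<Longrightarrow> 0 \<le> r \<Longrightarrow> \<bar>jump_cmean s x r\<bar> \<le> B + \<bar>x\<bar>"
    using jump_cmean_bound[of t] by blast
  have K0: "0 \<le> K" using K[of 0] by linarith
  have vk: "cmean t y = (LINT r|lborel. jump_dens y r * jump_cmean t y r)" for y by (rule cmean_kernel[OF t])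
  show ?thesis unfolding vk
  proof (rule integral_dominated_convergence)
    show "integrable lborel (\<lambda>r. (jump_dens 0 r + K * (indicator {0..} r * exp (- r\<^sup>2 / 2))) * (B + K))"
    proof (intro integrable_mult_left Bochner_Integration.integrable_add integrable_mult_right jump_dens_integral)
      have "integrable lborel (\<lambda>r. indicator {0..} r *\<^sub>R (sqrt (2 * pi) * std_normal_density r))"
        by (intro integrable_mult_indicator integrable_mult_right) (use integrable_std_normal_moment[of 0] in auto)
      then show "integrable lborel (\<lambda>r::real. indicator {0..} r * exp (- r\<^sup>2 / 2))"
        by (simp add: normal_density_def)
    qed
    show "AE r in lborel. (\<lambda>n. jump_dens (X n) r * jump_cmean t (X n) r) \<longlonglongrightarrow> jump_dens x r * jump_cmean t x r"
    proof (rule AE_I2)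
      fix r
      have "(\<lambda>n. if r \<le> t then mean0 (t - X n - 2 * r) else t + X n) \<longlonglongrightarrow> jump_cmean t x r"
        using x0 by (auto simp: jump_cmean_def intro!: tendsto_intros X continuous_on_tendsto_compose[OF continuous_mean0])
      moreover have "\<forall>\<^sub>F n in sequentially. jump_cmean t (X n) r = (if r \<le> t then mean0 (t - X n - 2 * r) else t + X n)"
        using ev by eventually_elim (auto simp: jump_cmean_def)
      ultimately have "(\<lambda>n. jump_cmean t (X n) r) \<longlonglongrightarrow> jump_cmean t x r" by (simp add: tendsto_cong)
      then show "(\<lambda>n. jump_dens (X n) r * jump_cmean t (X n) r) \<longlonglongrightarrow> jump_dens x r * jump_cmean t x r"
        unfolding jump_dens_def by (intro tendsto_intros X)
    qed
    fix n
    show "AE r in lborel. norm (jump_dens (X n) r * jump_cmean t (X n) r)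
         \<le> (jump_dens 0 r + K * (indicator {0..} r * exp (- r\<^sup>2 / 2))) * (B + K)"
    proof (rule AE_I2)
      fix r
      show "norm (jump_dens (X n) r * jump_cmean t (X n) r)
         \<le> (jump_dens 0 r + K * (indicator {0..} r * exp (- r\<^sup>2 / 2))) * (B + K)"
      proof (cases "0 \<le> r")
        case True
        have "\<bar>jump_cmean t (X n) r\<bar> \<le> B + K" using B(2)[of t r "X n"] t True K[of n] by linarith
        moreover have "\<bar>jump_dens (X n) r\<bar> \<le> jump_dens 0 r + K * (indicator {0..} r * exp (- r\<^sup>2 / 2))"
        proof -
          have "(max (X n) 0 + r) * exp (- (max (X n) 0 * r + r\<^sup>2 / 2)) \<le> (K + r) * exp (- (r\<^sup>2 / 2))"
            using K[of n] True K0 by (intro mult_mono) (auto simp: max_def)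
          then show ?thesis using True jump_dens_nonneg[of "X n" r] by (simp add: jump_dens_def algebra_simps)
        qed
        ultimately show ?thesis unfolding real_norm_def abs_mult by (intro mult_mono) (use jump_dens_nonneg K0 in auto)
      qed (simp add: jump_dens_def)
    qed
  qed auto
qed

section \<open>The covariance formula and its integral\<close>

lemma integrable_normal_poly: "integrable lborel (\<lambda>x. std_normal_density x * (1 + \<bar>x\<bar>) ^ k)"
proof -
  have "integrable lborel (\<lambda>x. \<Sum>i\<le>k. real (k choose i) * (std_normal_density x * \<bar>x\<bar> ^ i))"
    by (intro Bochner_Integration.integrable_sum integrable_mult_right integrable_std_normal_moment_abs)
  moreover have "(\<Sum>i\<le>k. real (k choose i) * (std_normal_density x * \<bar>x\<bar> ^ i)) = std_normal_density x * (1 + \<bar>x\<bar>) ^ k" for x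
    unfolding add.commute[of 1] binomial_ring sum_distrib_left by (intro sum.cong) auto
  ultimately show ?thesis by (simp only:)
qed

text \<open>The starting point \<open>x\<close> times the joint density of the starting point and the jump time.\<close>

definition start_jump_weight :: "real \<times> real \<Rightarrow> real" where
  "start_jump_weight = (\<lambda>(x, r). std_normal_density x * x * jump_dens x r)"

lemma start_jump_weight_measurable [measurable]: "start_jump_weight \<in> borel_measurable (borel \<Otimes>\<^sub>M borel)"
  unfolding start_jump_weight_def by measurable

text \<open>The weight is at most a constant times \<open>(1 + \<bar>x\<bar>)\<^sup>2 (1 + r)\<close> times a product of two normal densities, which leaves room for the
polynomial bound on \<open>g\<close>.\<close>

lemma start_jump_weight_weighted_integrable:
  assumes g: "g \<in> borel_measurable (borel \<Otimes>\<^sub>M borel)"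
    and b: "\<And>x r. 0 \<le> r \<Longrightarrow> \<bar>g (x, r)\<bar> \<le> C * ((1 + \<bar>x\<bar>)\<^sup>2 * (1 + r)\<^sup>2)"
  shows "integrable (lborel \<Otimes>\<^sub>M lborel) (\<lambda>p. start_jump_weight p * g p)"
proof -
  define G where "G x = std_normal_density x * (1 + \<bar>x\<bar>) ^ 4" for x
  have Gi: "integrable lborel G" unfolding G_def by (rule integrable_normal_poly)
  have Gm [measurable]: "G \<in> borel_measurable borel" unfolding G_def by measurable
  have G0: "0 \<le> G x" for x by (simp add: G_def)
  have C0: "0 \<le> C" using b[of 0 0] by simp
  have GG: "integrable (lborel \<Otimes>\<^sub>M lborel) (\<lambda>(x, r). G x * G r)"
    by (rule lborel_pair.Fubini_integrable) (use Gi G0 in \<open>auto simp: abs_mult\<close>)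
  show ?thesis
  proof (rule Bochner_Integration.integrable_bound)
    show "integrable (lborel \<Otimes>\<^sub>M lborel) (\<lambda>p. (C * sqrt (2 * pi)) * (case p of (x, r) \<Rightarrow> G x * G r))"
      using GG by (rule integrable_mult_right)
    show "(\<lambda>p. start_jump_weight p * g p) \<in> borel_measurable (lborel \<Otimes>\<^sub>M lborel)" using g by measurable
    show "AE p in lborel \<Otimes>\<^sub>M lborel. norm (start_jump_weight p * g p) \<le> norm (C * sqrt (2 * pi) * (case p of (x, r) \<Rightarrow> G x * G r))"
    proof (rule AE_I2, clarify)
      fix x r :: real
      have "\<bar>start_jump_weight (x, r) * g (x, r)\<bar> \<le> C * sqrt (2 * pi) * (G x * G r)"
      proof (cases "0 \<le> r")
        case True
        have "jump_dens x r \<le> (\<bar>x\<bar> + r) * exp (- (r\<^sup>2 / 2))"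
          unfolding jump_dens_def using True by (auto intro!: mult_mono simp: max_def)
        also have "\<dots> \<le> ((1 + \<bar>x\<bar>) * (1 + r)) * exp (- (r\<^sup>2 / 2))"
          using True by (intro mult_right_mono) (auto simp: algebra_simps)
        also have "exp (- (r\<^sup>2 / 2)) = sqrt (2 * pi) * std_normal_density r" by (simp add: normal_density_def)
        finally have j: "jump_dens x r \<le> (1 + \<bar>x\<bar>) * (1 + r) * (sqrt (2 * pi) * std_normal_density r)" .
        have "\<bar>start_jump_weight (x, r) * g (x, r)\<bar> = std_normal_density x * \<bar>x\<bar> * jump_dens x r * \<bar>g (x, r)\<bar>"
          using jump_dens_nonneg[of x r] by (simp add: start_jump_weight_def abs_mult)
        also have "\<dots> \<le> std_normal_density x * (1 + \<bar>x\<bar>) * ((1 + \<bar>x\<bar>) * (1 + r) * (sqrt (2 * pi) * std_normal_density r)) * (C * ((1 + \<bar>x\<bar>)\<^sup>2 * (1 + r)\<^sup>2))"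
          using True jump_dens_nonneg[of x r] by (intro mult_mono j b) auto
        also have "\<dots> = C * sqrt (2 * pi) * (G x * (std_normal_density r * (1 + r) ^ 3))"
          by (simp add: G_def power2_eq_square power3_eq_cube power4_eq_xxxx)
        also have "\<dots> \<le> C * sqrt (2 * pi) * (G x * G r)"
          unfolding G_def using True C0
          by (intro mult_left_mono) (auto intro!: mult_nonneg_nonneg power_increasing)
        finally show ?thesis .
      qed (use C0 G0 in \<open>simp add: start_jump_weight_def jump_dens_def\<close>)
      then show "norm (start_jump_weight (x, r) * g (x, r)) \<le> norm (C * sqrt (2 * pi) * (G x * G r))"
        using C0 G0[of x] G0[of r] by simp
    qed
  qed
qed

definition ren_sol_total :: real where "ren_sol_total = (LINT u|lborel. ren_sol u)"
definition ren_sol_norm :: real where "ren_sol_norm = (LINT u|lborel. \<bar>ren_sol u\<bar>)"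

lemma linear_integral:
  assumes "a \<le> (b::real)"
  shows "has_bochner_integral lborel (\<lambda>u. indicator {a..b} u * (u + c)) ((b + c)\<^sup>2 / 2 - (a + c)\<^sup>2 / 2)"
  unfolding mult.commute[of "indicator _ _"]
  by (rule has_bochner_integral_FTC_Icc_real) (use assms in \<open>auto intro!: derivative_eq_intros\<close>)

lemma mean0_tail:
  assumes a: "a \<le> 0"
  shows "has_bochner_integral lborel (\<lambda>u. indicator {a..} u * mean0 u) (ren_sol_total - a\<^sup>2 / 2)"
    and "(LINT u|lborel. \<bar>indicator {a..} u * mean0 u\<bar>) \<le> a\<^sup>2 / 2 + ren_sol_norm"
proof -
  have eq: "indicator {a..} u * mean0 u = indicator {a..0} u * (u + 0) + ren_sol u" for u
    using a by (auto simp: mean0_def indicator_def ren_sol(2))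
  have i0: "has_bochner_integral lborel (\<lambda>u. indicator {a..0} u * (u + 0)) (- (a\<^sup>2 / 2))"
    using linear_integral[OF a, of 0] by simp
  show 1: "has_bochner_integral lborel (\<lambda>u. indicator {a..} u * mean0 u) (ren_sol_total - a\<^sup>2 / 2)"
    unfolding eq using has_bochner_integral_add[OF i0 has_bochner_integral_integrable[OF integrable_ren_sol]]
    by (simp add: ren_sol_total_def)
  have "(LINT u|lborel. \<bar>indicator {a..} u * mean0 u\<bar>) \<le> (LINT u|lborel. - (indicator {a..0} u * (u + 0)) + \<bar>ren_sol u\<bar>)"
  proof (rule integral_mono)
    show "integrable lborel (\<lambda>u. \<bar>indicator {a..} u * mean0 u\<bar>)" using 1 by (auto simp: has_bochner_integral_iff)
    show "integrable lborel (\<lambda>u. - (indicator {a..0} u * (u + 0)) + \<bar>ren_sol u\<bar>)"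
      using i0 integrable_ren_sol by (auto simp: has_bochner_integral_iff)
    show "\<bar>indicator {a..} u * mean0 u\<bar> \<le> - (indicator {a..0} u * (u + 0)) + \<bar>ren_sol u\<bar>" for u
      unfolding eq by (auto simp: indicator_def)
  qed
  also have "\<dots> = a\<^sup>2 / 2 + ren_sol_norm"
    using i0 integrable_ren_sol by (subst Bochner_Integration.integral_add) (auto simp: has_bochner_integral_iff ren_sol_norm_def)
  finally show "(LINT u|lborel. \<bar>indicator {a..} u * mean0 u\<bar>) \<le> a\<^sup>2 / 2 + ren_sol_norm" .
qed

lemma mean0_tail_shift:
  assumes a: "r + c \<le> 0"
  shows "has_bochner_integral lborel (\<lambda>s. indicator {r..} s * mean0 (s + c)) (ren_sol_total - (r + c)\<^sup>2 / 2)"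
    and "(LINT s|lborel. \<bar>indicator {r..} s * mean0 (s + c)\<bar>) \<le> (r + c)\<^sup>2 / 2 + ren_sol_norm"
proof -
  have eq: "indicator {r + c..} (c + 1 * s) * mean0 (c + 1 * s) = indicator {r..} s * mean0 (s + c)" for s
    by (auto simp: indicator_def add.commute)
  show "has_bochner_integral lborel (\<lambda>s. indicator {r..} s * mean0 (s + c)) (ren_sol_total - (r + c)\<^sup>2 / 2)"
    using mean0_tail(1)[OF a] lborel_has_bochner_integral_real_affine_iff[of 1 "\<lambda>u. indicator {r + c..} u * mean0 u" _ c]
    unfolding eq by simp
  show "(LINT s|lborel. \<bar>indicator {r..} s * mean0 (s + c)\<bar>) \<le> (r + c)\<^sup>2 / 2 + ren_sol_norm"
    using mean0_tail(2)[OF a] lborel_integral_real_affine[of 1 "\<lambda>u. \<bar>indicator {r + c..} u * mean0 u\<bar>" c]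
    unfolding eq by simp
qed

lemma ren_sol_norm_nonneg: "0 \<le> ren_sol_norm" by (simp add: ren_sol_norm_def)

text \<open>The value does not depend on the jump time \<open>r\<close>. For \<open>x > 0\<close> the ascent contributes \<open>((x + r)\<^sup>2 - x\<^sup>2) / 2\<close> and the
way from \<open>- (x + r)\<close> back to \<open>0\<close> contributes \<open>- (x + r)\<^sup>2 / 2\<close>; the rest is the integral of the mean started at \<open>0\<close>.\<close>

lemma jump_cmean_time:
  assumes r: "0 \<le> r"
  shows "has_bochner_integral lborel (\<lambda>s. indicator {0..} s * jump_cmean s x r) (ren_sol_total - x\<^sup>2 / 2)"
    and "(LINT s|lborel. \<bar>indicator {0..} s * jump_cmean s x r\<bar>) \<le> (\<bar>x\<bar> + r)\<^sup>2 + ren_sol_norm"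
proof -
  have "has_bochner_integral lborel (\<lambda>s. indicator {0..} s * jump_cmean s x r) (ren_sol_total - x\<^sup>2 / 2)
     \<and> (LINT s|lborel. \<bar>indicator {0..} s * jump_cmean s x r\<bar>) \<le> (\<bar>x\<bar> + r)\<^sup>2 + ren_sol_norm"
  proof (cases "x \<le> 0")
    case True
    have "x\<^sup>2 / 2 \<le> (\<bar>x\<bar> + r)\<^sup>2"
    proof -
      have "\<bar>x\<bar>\<^sup>2 \<le> (\<bar>x\<bar> + r)\<^sup>2" using r by (intro power_mono) auto
      then show ?thesis using zero_le_power2[of x] by (simp only: power2_abs)
    qed
    then show ?thesis using mean0_tail_shift[of 0 x] True by (simp add: jump_cmean_def)
  next
    case False
    have i1: "has_bochner_integral lborel (\<lambda>s. indicator {0..r} s * (s + x)) ((r + x)\<^sup>2 / 2 - x\<^sup>2 / 2)"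
      using linear_integral[OF r, of x] by simp
    have ra: "r + (- x - 2 * r) \<le> 0" using r False by simp
    have i2: "has_bochner_integral lborel (\<lambda>s. indicator {r..} s * mean0 (s + (- x - 2 * r))) (ren_sol_total - (r + x)\<^sup>2 / 2)"
      using mean0_tail_shift(1)[OF ra] by (simp add: power2_commute[of "- x"] power2_minus algebra_simps power2_eq_square)
    have i3: "(LINT s|lborel. \<bar>indicator {r..} s * mean0 (s + (- x - 2 * r))\<bar>) \<le> (r + x)\<^sup>2 / 2 + ren_sol_norm"
      using mean0_tail_shift(2)[OF ra] by (simp add: algebra_simps power2_eq_square)
    let ?f = "\<lambda>s. indicator {0..r} s * (s + x) + indicator {r..} s * mean0 (s + (- x - 2 * r))"
    have eq: "AE s in lborel. indicator {0..} s * jump_cmean s x r = ?f s"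
      using AE_lborel_singleton[of r]
      by eventually_elim (use False r in \<open>auto simp: jump_cmean_def indicator_def algebra_simps\<close>)
    have vm: "(\<lambda>s. jump_cmean s x r) \<in> borel_measurable borel" unfolding jump_cmean_def by measurable
    have h: "has_bochner_integral lborel ?f (ren_sol_total - x\<^sup>2 / 2)"
      using has_bochner_integral_add[OF i1 i2] by simp
    have 1: "has_bochner_integral lborel (\<lambda>s. indicator {0..} s * jump_cmean s x r) (ren_sol_total - x\<^sup>2 / 2)"
      by (subst has_bochner_integral_cong_AE[OF _ _ eq]) (use vm h in \<open>auto\<close>)
    have "(LINT s|lborel. \<bar>indicator {0..} s * jump_cmean s x r\<bar>) = (LINT s|lborel. \<bar>?f s\<bar>)"
      by (rule integral_cong_AE) (use vm eq in auto)
    also have "\<dots> \<le> (LINT s|lborel. indicator {0..r} s * (s + x) + \<bar>indicator {r..} s * mean0 (s + (- x - 2 * r))\<bar>)"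
    proof (rule integral_mono)
      show "\<bar>?f s\<bar> \<le> indicator {0..r} s * (s + x) + \<bar>indicator {r..} s * mean0 (s + (- x - 2 * r))\<bar>" for s
        using False by (auto simp: indicator_def)
    qed (use h i1 i2 in \<open>auto simp: has_bochner_integral_iff\<close>)
    also have "\<dots> = ((r + x)\<^sup>2 / 2 - x\<^sup>2 / 2) + (LINT s|lborel. \<bar>indicator {r..} s * mean0 (s + (- x - 2 * r))\<bar>)"
      using i1 i2 by (subst Bochner_Integration.integral_add) (auto simp: has_bochner_integral_iff)
    also have "\<dots> \<le> (r + x)\<^sup>2 / 2 + ((r + x)\<^sup>2 / 2 + ren_sol_norm)" using i3 zero_le_power2[of x] by linarith
    finally show ?thesis using 1 False by (simp add: add.commute)
  qed
  then show "has_bochner_integral lborel (\<lambda>s. indicator {0..} s * jump_cmean s x r) (ren_sol_total - x\<^sup>2 / 2)"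
    "(LINT s|lborel. \<bar>indicator {0..} s * jump_cmean s x r\<bar>) \<le> (\<bar>x\<bar> + r)\<^sup>2 + ren_sol_norm" by auto
qed

lemma poly_dom: 
  fixes x r c :: real
  assumes "0 \<le> r" "0 \<le> c" shows "(\<bar>x\<bar> + r)\<^sup>2 + c \<le> (1 + c) * ((1 + \<bar>x\<bar>)\<^sup>2 * (1 + r)\<^sup>2)"
proof -
  define P where "P = (1 + \<bar>x\<bar>)\<^sup>2 * (1 + r)\<^sup>2"
  have "\<bar>x\<bar> + r \<le> (1 + \<bar>x\<bar>) * (1 + r)" using assms by (simp add: algebra_simps)
  then have 1: "(\<bar>x\<bar> + r)\<^sup>2 \<le> P" unfolding P_def power_mult_distrib[symmetric]
    using assms by (intro power_mono) auto
  have "1 * 1 \<le> P" unfolding P_def using assms by (intro mult_mono) auto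
  then have "c * 1 \<le> c * P" using assms by (intro mult_left_mono) auto
  then show ?thesis using 1 unfolding P_def by (simp add: algebra_simps)
qed

text \<open>This will be identified with \<open>K(s, 0)\<close> by conditioning on the normally distributed start.\<close>

definition cov_formula :: "real \<Rightarrow> real" where
  "cov_formula s = (LINT x|lborel. std_normal_density x * x * cmean s x)"

text \<open>By Fubini's theorem time can be integrated first. That leaves \<open>x (c - x\<^sup>2 / 2)\<close> for a constant \<open>c\<close>, an odd
function, to be integrated against the normal density.\<close>

lemma cov_formula_integral:
  shows "set_integrable lborel {0..} cov_formula" "(LINT s:{0..}|lborel. cov_formula s) = 0"
proof -
  interpret Q: pair_sigma_finite "lborel \<Otimes>\<^sub>M lborel :: (real \<times> real) measure" "lborel :: real measure"
    by (intro pair_sigma_finite.intro lborel_pair.sigma_finite_measure_axioms sigma_finite_lborel)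
  define G where "G p s = start_jump_weight p * (indicator {0..} s * jump_cmean s (fst p) (snd p))" for p :: "real \<times> real" and s
  have Gm: "case_prod G \<in> borel_measurable ((lborel \<Otimes>\<^sub>M lborel) \<Otimes>\<^sub>M lborel)"
  proof -
    have "(\<lambda>z. (snd z, fst (fst z), snd (fst z))) \<in> (borel \<Otimes>\<^sub>M borel) \<Otimes>\<^sub>M borel \<rightarrow>\<^sub>M (borel \<Otimes>\<^sub>M borel \<Otimes>\<^sub>M borel :: (real \<times> real \<times> real) measure)"
      by measurable
    from measurable_compose[OF this jump_cmean_measurable(1)]
    have [measurable]: "(\<lambda>z. jump_cmean (snd z) (fst (fst z)) (snd (fst z))) \<in> borel_measurable ((borel \<Otimes>\<^sub>M borel) \<Otimes>\<^sub>M borel)"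
      by (simp only: prod.case)
    have "case_prod G \<in> borel_measurable ((borel \<Otimes>\<^sub>M borel) \<Otimes>\<^sub>M borel)"
      unfolding G_def case_prod_unfold by measurable
    also have "borel_measurable ((borel \<Otimes>\<^sub>M borel) \<Otimes>\<^sub>M borel) = borel_measurable ((lborel \<Otimes>\<^sub>M lborel :: (real \<times> real) measure) \<Otimes>\<^sub>M lborel)"
      by (intro measurable_cong_sets sets_pair_measure_cong) auto
    finally show ?thesis .
  qed
  have Gs: "has_bochner_integral lborel (G p) (start_jump_weight p * (ren_sol_total - (fst p)\<^sup>2 / 2))" for p
  proof (cases "0 \<le> snd p")
    case True
    show ?thesis unfolding G_def by (rule has_bochner_integral_mult_right) (rule jump_cmean_time(1)[OF True])
  next
    case False
    then have "start_jump_weight p = 0" by (simp add: start_jump_weight_def jump_dens_def case_prod_unfold)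
    then show ?thesis by (simp add: G_def[abs_def] has_bochner_integral_zero)
  qed
  have Gn: "(LINT s|lborel. norm (G p s)) \<le> \<bar>start_jump_weight p\<bar> * ((\<bar>fst p\<bar> + snd p)\<^sup>2 + ren_sol_norm)" for p
  proof (cases "0 \<le> snd p")
    case True
    have "(LINT s|lborel. norm (G p s)) = \<bar>start_jump_weight p\<bar> * (LINT s|lborel. \<bar>indicator {0..} s * jump_cmean s (fst p) (snd p)\<bar>)"
      by (simp add: G_def abs_mult)
    then show ?thesis using jump_cmean_time(2)[OF True, of "fst p"] by (simp add: mult_left_mono)
  next
    case False
    then have "start_jump_weight p = 0" by (simp add: start_jump_weight_def jump_dens_def case_prod_unfold)
    then show ?thesis by (simp add: G_def[abs_def])
  qed
  have wi: "integrable (lborel \<Otimes>\<^sub>M lborel) (\<lambda>p. start_jump_weight p * ((\<bar>fst p\<bar> + snd p)\<^sup>2 + ren_sol_norm))"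
  proof (rule start_jump_weight_weighted_integrable)
    show "\<bar>(\<bar>fst (x, r)\<bar> + snd (x, r))\<^sup>2 + ren_sol_norm\<bar> \<le> (1 + ren_sol_norm) * ((1 + \<bar>x\<bar>)\<^sup>2 * (1 + r)\<^sup>2)"
      if "0 \<le> r" for x r
      using poly_dom[OF that ren_sol_norm_nonneg, of x] ren_sol_norm_nonneg by simp
  qed measurable
  have Gi: "integrable ((lborel \<Otimes>\<^sub>M lborel) \<Otimes>\<^sub>M lborel) (case_prod G)"
  proof (rule Q.Fubini_integrable)
    show "integrable (lborel \<Otimes>\<^sub>M lborel) (\<lambda>p. LINT s|lborel. norm (case (p, s) of (x, xa) \<Rightarrow> G x xa))"
    proof (rule Bochner_Integration.integrable_bound[OF wi])
      show "(\<lambda>p. LINT s|lborel. norm (case (p, s) of (x, xa) \<Rightarrow> G x xa)) \<in> borel_measurable (lborel \<Otimes>\<^sub>M lborel)"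
        by (rule lborel.borel_measurable_lebesgue_integral) (use Gm in \<open>simp add: case_prod_unfold\<close>)
      show "AE p in lborel \<Otimes>\<^sub>M lborel. norm (LINT s|lborel. norm (case (p, s) of (x, xa) \<Rightarrow> G x xa))
             \<le> norm (start_jump_weight p * ((\<bar>fst p\<bar> + snd p)\<^sup>2 + ren_sol_norm))"
        by (rule AE_I2) (use Gn ren_sol_norm_nonneg in \<open>auto simp: abs_mult\<close>)
    qed
    show "AE p in lborel \<Otimes>\<^sub>M lborel. integrable lborel (\<lambda>s. case (p, s) of (x, xa) \<Rightarrow> G x xa)"
      using Gs by (auto simp: has_bochner_integral_iff)
  qed (rule Gm)
  have K: "(LINT p|(lborel \<Otimes>\<^sub>M lborel). G p s) = indicator {0..} s * cov_formula s" for s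
  proof (cases "0 \<le> s")
    case True
    obtain B where B: "0 \<le> B" "\<And>u x r. 0 \<le> u \<Longrightarrow> u \<le> s \<Longrightarrow> 0 \<le> r \<Longrightarrow> \<bar>jump_cmean u x r\<bar> \<le> B + \<bar>x\<bar>"
      using jump_cmean_bound[of s] by blast
    have "integrable (lborel \<Otimes>\<^sub>M lborel) (\<lambda>p. start_jump_weight p * jump_cmean s (fst p) (snd p))"
    proof (rule start_jump_weight_weighted_integrable)
      fix x r :: real assume r: "0 \<le> r"
      define P where "P = (1 + \<bar>x\<bar>)\<^sup>2 * (1 + r)\<^sup>2"
      have "(1 + \<bar>x\<bar>) * 1 \<le> (1 + \<bar>x\<bar>) * (1 + \<bar>x\<bar>)" by (intro mult_left_mono) auto
      also have "\<dots> * 1 \<le> P" unfolding P_def using r one_le_power[of "1 + r" 2]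
        by (intro mult_mono) (auto simp: power2_eq_square)
      finally have "1 + \<bar>x\<bar> \<le> P" by simp
      moreover have "B * 1 \<le> B * P" using calculation B(1) by (intro mult_left_mono) auto
      moreover have "\<bar>jump_cmean s x r\<bar> \<le> B + \<bar>x\<bar>" using B(2)[of s r x] True r by simp
      ultimately show "\<bar>jump_cmean s (fst (x, r)) (snd (x, r))\<bar> \<le> (B + 1) * ((1 + \<bar>x\<bar>)\<^sup>2 * (1 + r)\<^sup>2)"
        unfolding P_def[symmetric] by (simp add: algebra_simps)
    next
      have "(\<lambda>p. (s, fst p, snd p)) \<in> borel \<Otimes>\<^sub>M borel \<rightarrow>\<^sub>M (borel \<Otimes>\<^sub>M borel \<Otimes>\<^sub>M borel :: (real \<times> real \<times> real) measure)"
        by measurable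
      from measurable_compose[OF this jump_cmean_measurable(1)]
      show "(\<lambda>p. jump_cmean s (fst p) (snd p)) \<in> borel_measurable (borel \<Otimes>\<^sub>M borel)" by (simp only: prod.case)
    qed
    then have "integrable (lborel \<Otimes>\<^sub>M lborel) (case_prod (\<lambda>x r. start_jump_weight (x, r) * jump_cmean s x r))"
      by (simp add: case_prod_unfold)
    from lborel_pair.integral_fst[OF this]
    have "(LINT p|(lborel \<Otimes>\<^sub>M lborel). start_jump_weight p * jump_cmean s (fst p) (snd p)) = (LINT x|lborel. LINT r|lborel. start_jump_weight (x, r) * jump_cmean s x r)"
      by (simp add: case_prod_unfold)
    also have "\<dots> = cov_formula s"
      unfolding cov_formula_def cmean_kernel[OF True] by (simp add: start_jump_weight_def mult.assoc)
    finally show ?thesis using True by (simp add: G_def)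
  qed (simp add: G_def)
  have "integrable lborel (\<lambda>s. indicator {0..} s * cov_formula s)"
    using Q.integrable_snd[OF Gi] by (simp add: K)
  then show "set_integrable lborel {0..} cov_formula" by (simp add: set_integrable_def)
  have "(LINT s:{0..}|lborel. cov_formula s) = (LINT s|lborel. LINT p|(lborel \<Otimes>\<^sub>M lborel). G p s)"
    by (simp add: K set_lebesgue_integral_def)
  also have "\<dots> = (LINT p|(lborel \<Otimes>\<^sub>M lborel). LINT s|lborel. G p s)"
    by (rule Q.Fubini_integral[OF Gi])
  also have "\<dots> = (LINT p|(lborel \<Otimes>\<^sub>M lborel). start_jump_weight p * (ren_sol_total - (fst p)\<^sup>2 / 2))"
    using Gs by (simp add: has_bochner_integral_iff)
  also have "\<dots> = (LINT x|lborel. LINT r|lborel. start_jump_weight (x, r) * (ren_sol_total - x\<^sup>2 / 2))"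
  proof -
    have "integrable (lborel \<Otimes>\<^sub>M lborel) (\<lambda>p. LINT s|lborel. G p s)"
      by (rule Q.integrable_fst[OF Gi])
    moreover have "(LINT s|lborel. G p s) = (case p of (x, r) \<Rightarrow> start_jump_weight (x, r) * (ren_sol_total - x\<^sup>2 / 2))" for p
      using Gs[of p] by (simp add: has_bochner_integral_iff case_prod_unfold)
    ultimately have "integrable (lborel \<Otimes>\<^sub>M lborel) (case_prod (\<lambda>x r. start_jump_weight (x, r) * (ren_sol_total - x\<^sup>2 / 2)))"
      by simp
    from lborel_pair.integral_fst[OF this] show ?thesis by (simp add: case_prod_unfold)
  qed
  also have "\<dots> = (LINT x|lborel. ren_sol_total * (std_normal_density x * x ^ (2 * 0 + 1)) - 1/2 * (std_normal_density x * x ^ (2 * 1 + 1)))"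
  proof (intro Bochner_Integration.integral_cong refl)
    fix x :: real
    have "(LINT r|lborel. start_jump_weight (x, r) * (ren_sol_total - x\<^sup>2 / 2)) = std_normal_density x * x * (ren_sol_total - x\<^sup>2 / 2)"
      by (simp add: start_jump_weight_def jump_dens_integral(2))
    also have "\<dots> = ren_sol_total * (std_normal_density x * x ^ (2 * 0 + 1)) - 1/2 * (std_normal_density x * x ^ (2 * 1 + 1))"
      by (simp add: algebra_simps power2_eq_square power3_eq_cube)
    finally show "(LINT r|lborel. start_jump_weight (x, r) * (ren_sol_total - x\<^sup>2 / 2))
      = ren_sol_total * (std_normal_density x * x ^ (2 * 0 + 1)) - 1/2 * (std_normal_density x * x ^ (2 * 1 + 1))" .
  qed
  also have "\<dots> = 0"
    using std_normal_moment_odd[of 0] std_normal_moment_odd[of 1]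
    by (subst Bochner_Integration.integral_diff)
       (auto simp: has_bochner_integral_iff simp del: power_Suc mult_Suc_right)
  finally show "(LINT s:{0..}|lborel. cov_formula s) = 0" .
qed

section \<open>Damped integrals and existence of a maximum\<close>

lemma damped_transform:
  fixes k :: "real \<Rightarrow> real"
  defines "L \<equiv> \<lambda>\<rho>. LINT s:{0..}|lborel. exp (- \<rho> * s) * k s"
  assumes k: "set_integrable lborel {0..} k"
  shows damped_integrable: "0 \<le> \<rho> \<Longrightarrow> set_integrable lborel {0..} (\<lambda>s. exp (- \<rho> * s) * k s)"
    and damped_continuous: "continuous_on {0..} L"
    and damped_at_top: "(L \<longlongrightarrow> 0) at_top"
proof -
  define g where "g s = indicator {0..} s * k s" for s
  have gi: "integrable lborel g" using k by (simp add: g_def[abs_def] set_integrable_def)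
  have gm [measurable]: "g \<in> borel_measurable borel" using borel_measurable_integrable[OF gi] by simp
  have L: "L \<rho> = (LINT s|lborel. exp (- \<rho> * s) * g s)" for \<rho>
    unfolding L_def set_lebesgue_integral_def g_def by (intro Bochner_Integration.integral_cong) auto
  have bd: "norm (exp (- \<rho> * s) * g s) \<le> norm (g s)" if "0 \<le> \<rho>" for \<rho> s
    using that by (auto simp: g_def indicator_def abs_mult intro!: mult_left_le_one_le)
  show "set_integrable lborel {0..} (\<lambda>s. exp (- \<rho> * s) * k s)" if \<rho>: "0 \<le> \<rho>"
  proof -
    have "integrable lborel (\<lambda>s. exp (- \<rho> * s) * g s)"
      by (rule Bochner_Integration.integrable_bound[OF gi]) (use bd[OF \<rho>] in auto)
    moreover have "exp (- \<rho> * s) * g s = indicator {0..} s *\<^sub>R (exp (- \<rho> * s) * k s)" for s by (simp add: g_def)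
    ultimately show ?thesis unfolding set_integrable_def by (simp only:)
  qed
  show "continuous_on {0..} L"
    unfolding continuous_on_sequentially comp_def L
  proof (intro ballI allI impI, elim conjE)
    fix x :: "nat \<Rightarrow> real" and a :: real
    assume x: "\<forall>n. x n \<in> {0..}" "x \<longlonglongrightarrow> a"
    show "(\<lambda>n. LINT s|lborel. exp (- x n * s) * g s) \<longlonglongrightarrow> (LINT s|lborel. exp (- a * s) * g s)"
    proof (rule integral_dominated_convergence)
      show "integrable lborel (\<lambda>s. norm (g s))" using gi by auto
      show "AE s in lborel. (\<lambda>n. exp (- x n * s) * g s) \<longlonglongrightarrow> exp (- a * s) * g s"
        by (intro AE_I2 tendsto_intros x)
      show "AE s in lborel. norm (exp (- x n * s) * g s) \<le> norm (g s)" for n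
        using bd[of "x n"] x(1) by auto
    qed measurable
  qed
  have "((\<lambda>\<rho>. LINT s|lborel. exp (- \<rho> * s) * g s) \<longlongrightarrow> integral\<^sup>L (lborel :: real measure) (\<lambda>s. 0 :: real)) at_top"
  proof (rule integral_dominated_convergence_at_top[where M = lborel and w = "\<lambda>s. norm (g s)"
        and s = "\<lambda>\<rho> s. exp (- \<rho> * s) * g s" and f = "\<lambda>_. 0"])
    show "integrable lborel (\<lambda>s. norm (g s))" using gi by auto
    show "\<forall>\<^sub>F \<rho> in at_top. AE s in lborel. norm (exp (- \<rho> * s) * g s) \<le> norm (g s)"
      using eventually_ge_at_top[of 0] by eventually_elim (use bd in auto)
    have "AE s::real in lborel. s \<noteq> 0" by (rule AE_lborel_singleton)
    then show "AE s in lborel. ((\<lambda>\<rho>. exp (- \<rho> * s) * g s) \<longlongrightarrow> 0) at_top"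
    proof eventually_elim
      fix s :: real assume s: "s \<noteq> 0"
      show "((\<lambda>\<rho>. exp (- \<rho> * s) * g s) \<longlongrightarrow> 0) at_top"
      proof (cases "0 < s")
        case True
        then show ?thesis by real_asymp
      qed (use s in \<open>simp add: g_def\<close>)
    qed
  qed measurable
  then show "(L \<longlongrightarrow> 0) at_top" unfolding L by simp
qed

text \<open>After multiplication by \<open>exp (\<rho> s0)\<close> the part of the integral over \<open>[0, s0 / 2]\<close> grows at least linearly in
\<open>\<rho>\<close>, by \<open>u \<le> exp u\<close>, while the part beyond \<open>s0\<close> stays bounded by the \<open>L\<^sup>1\<close> norm of \<open>k\<close>.\<close>

lemma damped_positive:
  fixes k :: "real \<Rightarrow> real"
  assumes k: "set_integrable lborel {0..} k" and s0: "0 < s0" "\<And>s. 0 \<le> s \<Longrightarrow> s \<le> s0 \<Longrightarrow> 1/2 \<le> k s"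
  obtains \<rho> where "0 < \<rho>" "0 < (LINT s:{0..}|lborel. exp (- \<rho> * s) * k s)"
proof -
  define g where "g s = indicator {0..} s * k s" for s
  have gi: "integrable lborel g" using k by (simp add: g_def[abs_def] set_integrable_def)
  define J where "J = (LINT s|lborel. \<bar>g s\<bar>)"
  have J0: "0 \<le> J" by (simp add: J_def)
  \<comment> \<open>Chosen so that the lower bound \<open>(s0 / 2) (\<rho> s0 / 4)\<close> for the part over \<open>[0, s0 / 2]\<close> exceeds \<open>J\<close>.\<close>
  define \<rho> where "\<rho> = (J + 1) * 16 / (s0 * s0)"
  have \<rho>: "0 < \<rho>" using s0 J0 by (simp add: \<rho>_def)
  let ?l = "\<lambda>s. indicator {0..s0/2} s * (\<rho> * s0 / 4) - \<bar>g s\<bar>"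
  have li: "integrable lborel ?l"
    by (intro Bochner_Integration.integrable_diff integrable_mult_left integrable_abs gi)
       (simp_all add: integrable_indicator_iff emeasure_lborel_Icc_eq)
  have ei: "integrable lborel (\<lambda>s. exp (- \<rho> * s) * g s)"
    using damped_integrable[OF k less_imp_le[OF \<rho>]] by (simp add: set_integrable_def g_def mult.left_commute)
  have pt: "?l s \<le> exp (\<rho> * s0) * (exp (- \<rho> * s) * g s)" for s
  proof -
    have e: "exp (\<rho> * s0) * (exp (- \<rho> * s) * g s) = exp (\<rho> * (s0 - s)) * g s"
      by (simp add: algebra_simps flip: exp_add)
    consider "s < 0" | "0 \<le> s" "s \<le> s0 / 2" | "s0 / 2 < s" "s \<le> s0" | "s0 < s" by linarith
    then show ?thesis
    proof cases
      case 1 then show ?thesis by (simp add: g_def)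
    next
      case 2
      have "\<rho> * s0 / 4 = (\<rho> * (s0 / 2)) * (1/2)" by simp
      also have "\<dots> \<le> exp (\<rho> * (s0 - s)) * g s"
      proof (rule mult_mono)
        have "\<rho> * (s0 / 2) \<le> \<rho> * (s0 - s)" using \<rho> 2 by (intro mult_left_mono) auto
        also have "\<dots> \<le> exp (\<rho> * (s0 - s))" using exp_ge_add_one_self[of "\<rho> * (s0 - s)"] by linarith
        finally show "\<rho> * (s0 / 2) \<le> exp (\<rho> * (s0 - s))" .
        show "1/2 \<le> g s" using s0(2)[of s] 2 s0(1) by (simp add: g_def)
      qed auto
      finally show ?thesis using 2 unfolding e by simp
    next
      case 3
      have "0 \<le> g s" using s0(2)[of s] 3 s0(1) by (simp add: g_def)
      then have "0 \<le> exp (\<rho> * (s0 - s)) * g s" by simp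
      then show ?thesis using 3 unfolding e by simp
    next
      case 4
      have "\<bar>exp (\<rho> * (s0 - s)) * g s\<bar> \<le> 1 * \<bar>g s\<bar>"
        unfolding abs_mult using 4 \<rho> by (intro mult_right_mono) (auto simp: mult_nonneg_nonpos)
      then show ?thesis using 4 s0 unfolding e by simp
    qed
  qed
  have "(LINT s|lborel. ?l s) = s0 / 2 * (\<rho> * s0 / 4) - J"
    unfolding J_def using s0 gi by (subst Bochner_Integration.integral_diff) auto
  also have "s0 / 2 * (\<rho> * s0 / 4) = 2 * (J + 1)" using s0 by (simp add: \<rho>_def field_simps)
  finally have "0 < (LINT s|lborel. ?l s)" using J0 by simp
  also have "\<dots> \<le> (LINT s|lborel. exp (\<rho> * s0) * (exp (- \<rho> * s) * g s))"
    by (intro integral_mono li integrable_mult_right ei pt)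
  finally have "0 < (LINT s|lborel. exp (- \<rho> * s) * g s)" by (simp add: zero_less_mult_iff)
  then have "0 < (LINT s:{0..}|lborel. exp (- \<rho> * s) * k s)"
    by (simp add: set_lebesgue_integral_def g_def mult.left_commute)
  then show ?thesis using that \<rho> by blast
qed

lemma maximum_exists_from_limits:
  fixes F :: "real \<Rightarrow> real"
  assumes c: "continuous_on {0<..} F" and l0: "(F \<longlongrightarrow> 0) (at_right 0)" and l1: "(F \<longlongrightarrow> 0) at_top"
    and p: "0 < p" "0 < F p"
  obtains m where "0 < m" "\<And>x. 0 < x \<Longrightarrow> F x \<le> F m"
proof -
  have "\<forall>\<^sub>F x in at_right 0. F x < F p" using order_tendstoD(2)[OF l0 p(2)] .
  then obtain a where a: "0 < a" "\<And>x. 0 < x \<Longrightarrow> x < a \<Longrightarrow> F x < F p"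
    unfolding eventually_at_right_field by auto
  have "\<forall>\<^sub>F x in at_top. F x < F p" using order_tendstoD(2)[OF l1 p(2)] .
  then obtain b where b: "\<And>x. b \<le> x \<Longrightarrow> F x < F p" unfolding eventually_at_top_linorder by auto
  define S where "S = {min a p..max b p}"
  have "compact S" "S \<noteq> {}" "p \<in> S" by (auto simp: S_def)
  moreover have "continuous_on S F" by (rule continuous_on_subset[OF c]) (use a p in \<open>auto simp: S_def\<close>)
  ultimately obtain m where m: "m \<in> S" "\<And>x. x \<in> S \<Longrightarrow> F x \<le> F m"
    using continuous_attains_sup[of S F] by blast
  show ?thesis
  proof (rule that[of m])
    show "0 < m" using m(1) a p by (auto simp: S_def)
    fix x :: real assume x: "0 < x"
    show "F x \<le> F m"
    proof (cases "x \<in> S")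
      case False
      then have "x < a \<or> b \<le> x" by (auto simp: S_def)
      then have "F x < F p" using a b x by blast
      then show ?thesis using m(2)[OF \<open>p \<in> S\<close>] by simp
    qed (rule m)
  qed
qed

section \<open>Paths of the telegraph equation\<close>

lemma quad_sets:
  assumes "A \<in> sets borel" "B \<in> sets borel" "A \<subseteq> {0..}" "B \<subseteq> {0..}"
  shows "A \<times> B \<in> sets quadrant_lborel"
proof -
  have "A \<times> B \<in> sets (borel :: (real \<times> real) measure)" using assms by (simp add: borel_Times)
  moreover have "{0..} \<times> {0..} \<in> sets (borel :: (real \<times> real) measure)" by (intro borel_Times) auto
  ultimately show ?thesis
    unfolding quadrant_lborel_def using assms by (subst sets_restrict_space_iff) auto
qed

lemma ennreal_of_enat_ge1: "ennreal_of_enat n \<noteq> 0 \<Longrightarrow> 1 \<le> ennreal_of_enat n"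
proof -
  assume n: "ennreal_of_enat n \<noteq> 0"
  then have "1 \<le> n" by (cases n) (auto simp: one_enat_def zero_enat_def)
  then have "ennreal_of_enat 1 \<le> ennreal_of_enat n" by (simp only: ennreal_of_enat_le_iff)
  then show "1 \<le> ennreal_of_enat n" by simp
qed

text \<open>The deterministic content of the equation: \<open>\<nu>\<close> is a realisation of the random measure and \<open>f\<close> the path.\<close>

locale telegraph_path =
  fixes \<nu> :: "(real \<times> real) measure" and f :: "real \<Rightarrow> real"
  assumes sets_\<nu>: "sets \<nu> = sets quadrant_lborel"
    and int_\<nu>: "\<And>A. A \<in> sets quadrant_lborel \<Longrightarrow> \<exists>n. emeasure \<nu> A = ennreal_of_enat n"
    and cadlag: "cadlag f"
    and ji: "\<And>t. 0 \<le> t \<Longrightarrow> set_integrable \<nu> ({0<..t} \<times> {0..}) (jump_integrand f)"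
    and eqn: "\<And>t. 0 \<le> t \<Longrightarrow> f t = f 0 + t - 2 * (LINT p : {0<..t} \<times> {0..} | \<nu>. jump_integrand f p)"
begin

lemma rect_sets [simp]: "A \<in> sets borel \<Longrightarrow> B \<in> sets borel \<Longrightarrow> A \<subseteq> {0..} \<Longrightarrow> B \<subseteq> {0..} \<Longrightarrow> A \<times> B \<in> sets \<nu>"
  using quad_sets sets_\<nu> by blast

lemma increment:
  assumes "0 \<le> a" "a \<le> s"
  shows "set_integrable \<nu> ({a<..s} \<times> {0..}) (jump_integrand f)"
    and "f s = f a + (s - a) - 2 * (LINT p : {a<..s} \<times> {0..} | \<nu>. jump_integrand f p)"
proof -
  have s: "{a<..s} \<times> {0..} \<in> sets \<nu>" using assms by (intro rect_sets) auto
  show 1: "set_integrable \<nu> ({a<..s} \<times> {0..}) (jump_integrand f)"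
    by (rule set_integrable_subset[OF ji[of s] s]) (use assms in auto)
  have "{0<..s} \<times> {0..} = ({0<..a} \<times> {0..}) \<union> ({a<..s} \<times> {0::real..})" using assms by auto
  then have "(LINT p : {0<..s} \<times> {0..} | \<nu>. jump_integrand f p)
      = (LINT p : {0<..a} \<times> {0..} | \<nu>. jump_integrand f p) + (LINT p : {a<..s} \<times> {0..} | \<nu>. jump_integrand f p)"
    using set_integral_Un[OF _ ji[of a] 1] assms by fastforce
  then show "f s = f a + (s - a) - 2 * (LINT p : {a<..s} \<times> {0..} | \<nu>. jump_integrand f p)"
    using eqn[of s] eqn[of a] assms by simp
qed

lemma left_lim_tendsto:
  assumes "0 < u" shows "(f \<longlongrightarrow> left_lim f u) (at_left u)"
proof -
  obtain l where l: "(f \<longlongrightarrow> l) (at_left u)" using cadlag assms unfolding cadlag_def by blast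
  then have "left_lim f u = l" unfolding left_lim_def by (intro tendsto_Lim) auto
  then show ?thesis using l by simp
qed

lemma left_lim_linear:
  assumes "0 \<le> a" "a < u" "\<And>v. a \<le> v \<Longrightarrow> v < u \<Longrightarrow> f v = f a + (v - a)"
  shows "left_lim f u = f a + (u - a)"
proof -
  have "((\<lambda>v. f a + (v - a)) \<longlongrightarrow> f a + (u - a)) (at_left u)"
    by (rule tendsto_add[OF tendsto_const tendsto_diff[OF tendsto_ident_at tendsto_const]])
  moreover have "\<forall>\<^sub>F v in at_left u. f a + (v - a) = f v"
    using assms(2) by (intro eventually_at_leftI[of a]) (auto intro!: assms(3)[symmetric])
  ultimately have "(f \<longlongrightarrow> f a + (u - a)) (at_left u)" by (rule Lim_transform_eventually)
  with left_lim_tendsto[of u] show ?thesis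
    using assms(1,2) tendsto_unique[of "at_left u" f] by auto
qed

lemma no_jump_if_left_lim_le:
  assumes "0 \<le> a" "a \<le> s" "\<And>u. a < u \<Longrightarrow> u \<le> s \<Longrightarrow> left_lim f u \<le> c"
    and null: "emeasure \<nu> ({a<..s} \<times> {0..c}) = 0"
  shows "f s = f a + (s - a)"
proof -
  have "AE p in \<nu>. p \<notin> {a<..s} \<times> {0..c}"
    using assms by (intro AE_not_in null_setsI rect_sets) auto
  then have "AE p in \<nu>. indicator ({a<..s} \<times> {0..}) p *\<^sub>R jump_integrand f p = 0"
  proof eventually_elim
    fix p assume p: "p \<notin> {a<..s} \<times> {0..c}"
    obtain u z where pz: "p = (u, z)" by (cases p)
    show "indicator ({a<..s} \<times> {0..}) p *\<^sub>R jump_integrand f p = 0"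
      using p assms(3)[of u] by (auto simp: pz jump_integrand_def indicator_def)
  qed
  then have "(LINT p : {a<..s} \<times> {0..} | \<nu>. jump_integrand f p) = 0"
    unfolding set_lebesgue_integral_def by (rule integral_eq_zero_AE)
  then show ?thesis using increment(2)[OF assms(1,2)] by simp
qed

text \<open>Let \<open>s'\<close> be the last time up to which the path is linear. If \<open>s' < b\<close>, right-continuity keeps the path below
\<open>f a + (b - a) \<le> c\<close> for a little longer, so it meets no point of \<open>\<nu>\<close> and remains linear: a contradiction.\<close>

lemma no_jump:
  assumes ab: "0 \<le> a" "a \<le> b" and c: "f a + (b - a) \<le> c"
    and null: "emeasure \<nu> ({a<..b} \<times> {0..c}) = 0"
    and s: "s \<in> {a..b}"
  shows "f s = f a + (s - a)"
proof -
  define S where "S = {s \<in> {a..b}. \<forall>v\<in>{a..s}. f v = f a + (v - a)}"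
  have aS: "a \<in> S" using ab by (auto simp: S_def)
  have bdd: "bdd_above S" by (auto simp: S_def intro: bdd_aboveI[of _ b])
  define s' where "s' = Sup S"
  have s': "a \<le> s'" unfolding s'_def by (rule cSup_upper[OF aS bdd])
  have Sne: "S \<noteq> {}" using aS by blast
  have s'b: "s' \<le> b" unfolding s'_def by (rule cSup_least[OF Sne]) (simp add: S_def)
  note s' = s' s'b
  have below: "f v = f a + (v - a)" if v: "a \<le> v" "v < s'" for v
  proof -
    obtain t where t: "t \<in> S" "v < t" using less_cSup_iff[of S v] Sne bdd v(2) unfolding s'_def by blast
    have "v \<in> {a..t}" using v t(2) by simp
    then show ?thesis using t(1) unfolding S_def by blast
  qed
  have ll: "left_lim f u = f a + (u - a)" if "a < u" "u \<le> s'" for u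
  proof (rule left_lim_linear)
    show "f v = f a + (v - a)" if "a \<le> v" "v < u" for v
      using that \<open>u \<le> s'\<close> by (intro below) auto
  qed (use that ab in auto)
  have nulls: "emeasure \<nu> ({a<..t} \<times> {0..c}) = 0" if "a \<le> t" "t \<le> b" for t
  proof -
    have "emeasure \<nu> ({a<..t} \<times> {0..c}) \<le> emeasure \<nu> ({a<..b} \<times> {0..c})"
      using that ab by (intro emeasure_mono rect_sets) auto
    then show ?thesis using null by simp
  qed
  have fs': "f s' = f a + (s' - a)"
    using s' ab c ll by (intro no_jump_if_left_lim_le[of a s' c] nulls) (auto intro: order_trans[OF _ c])
  have S': "f v = f a + (v - a)" if "a \<le> v" "v \<le> s'" for v
    using below[of v] fs' that by (cases "v = s'") auto
  have "s' = b"
  proof (rule ccontr)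
    assume "s' \<noteq> b"
    then have sb: "s' < b" using s' by simp
    have "(f \<longlongrightarrow> f s') (at_right s')"
      using cadlag s' ab unfolding cadlag_def by (auto simp: continuous_within)
    then have "\<forall>\<^sub>F v in at_right s'. f v < f a + (b - a)"
      by (rule order_tendstoD) (use sb fs' in simp)
    then obtain d where d: "s' < d" "\<And>v. s' < v \<Longrightarrow> v < d \<Longrightarrow> f v < f a + (b - a)"
      unfolding eventually_at_right_field by blast
    have ext: "f t = f a + (t - a)" if t: "s' < t" "t < d" "t \<le> b" for t
    proof (rule no_jump_if_left_lim_le)
      fix u assume u: "a < u" "u \<le> t"
      show "left_lim f u \<le> c"
      proof (cases "u \<le> s'")
        case False
        have "left_lim f u \<le> f a + (b - a)"
        proof (rule tendsto_upperbound[OF left_lim_tendsto])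
          show "\<forall>\<^sub>F v in at_left u. f v \<le> f a + (b - a)"
            using False d u t by (intro eventually_at_leftI[of s']) (auto intro!: less_imp_le)
        qed (use u ab in auto)
        then show ?thesis using c by simp
      qed (use ll u s' c in auto)
    qed (use s' ab t nulls in auto)
    define t where "t = (s' + min d b) / 2"
    have t: "s' < t" "t < d" "t < b" using d(1) sb by (auto simp: t_def min_def)
    have "t \<in> S" unfolding S_def
    proof (intro CollectI conjI ballI)
      fix v assume v: "v \<in> {a..t}"
      show "f v = f a + (v - a)"
        using S'[of v] ext[of v] v t by (cases "v \<le> s'") auto
    qed (use t s' in auto)
    then have "t \<le> s'" unfolding s'_def using bdd by (rule cSup_upper)
    then show False using t by simp
  qed
  then show ?thesis using S'[of s] s by simp
qed

text \<open>As \<open>\<nu>\<close> takes integer values and has mass at most \<open>1\<close> on the rectangle, all its mass there lies on one vertical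
line, at the first time \<open>u0\<close> at which mass appears below height \<open>f a\<close>. Up to \<open>u0\<close> the path is linear and so above
\<open>f a\<close>; at \<open>u0\<close> its sign changes; afterwards it is linear again.\<close>

lemma one_jump:
  assumes ab: "0 \<le> a" "a < b" and c: "f a + (b - a) \<le> c" and fa: "0 \<le> f a"
    and le1: "emeasure \<nu> ({a<..b} \<times> {0..c}) \<le> 1"
    and ne0: "emeasure \<nu> ({a<..b} \<times> {0..f a}) \<noteq> 0"
  shows "\<bar>f b + f a\<bar> \<le> b - a"
proof -
  have fc: "f a \<le> c" using ab c by simp
  define D where "D s = emeasure \<nu> ({a<..s} \<times> {0..f a})" for s
  have Dset: "{a<..s} \<times> {0..f a} \<in> sets \<nu>" for s using ab by (intro rect_sets) auto
  have D1: "1 \<le> D s" if "D s \<noteq> 0" for s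
    using int_\<nu>[of "{a<..s} \<times> {0..f a}"] that ennreal_of_enat_ge1 Dset[of s] sets_\<nu> unfolding D_def by auto
  have Dmono: "D s \<le> D t" if "s \<le> t" for s t unfolding D_def using that by (intro emeasure_mono Dset) auto
  have Db: "D b \<le> 1"
    unfolding D_def by (rule order_trans[OF emeasure_mono le1]) (use ab fc in \<open>auto intro!: rect_sets\<close>)
  define U where "U = {s \<in> {a..b}. D s \<noteq> 0}"
  have bU: "b \<in> U" using ab ne0 by (auto simp: U_def D_def)
  have bdd: "bdd_below U" by (auto simp: U_def intro: bdd_belowI[of _ a])
  define u0 where "u0 = Inf U"
  have u0b: "u0 \<le> b" unfolding u0_def by (rule cInf_lower[OF bU bdd])
  have Une: "U \<noteq> {}" using bU by blast
  have u0: "a \<le> u0" unfolding u0_def by (rule cInf_greatest[OF Une]) (simp add: U_def)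
  note u0 = u0 u0b
  have above: "D s \<noteq> 0" if "u0 < s" "s \<le> b" for s
  proof -
    obtain t where "t \<in> U" "t < s" using cInf_less_iff[of U s] Une bdd \<open>u0 < s\<close> unfolding u0_def by blast
    then show ?thesis using Dmono[of t s] by (auto simp: U_def)
  qed
  have below: "D s = 0" if "a \<le> s" "s < u0" for s
  proof (rule ccontr)
    assume "D s \<noteq> 0"
    then have "s \<in> U" using that u0 by (auto simp: U_def)
    then have "u0 \<le> s" unfolding u0_def using bdd by (rule cInf_lower)
    then show False using that by simp
  qed
  have Du0: "1 \<le> D u0"
  proof (cases "u0 = b")
    case True then show ?thesis using D1[of b] bU by (simp add: U_def)
  next
    case False
    define sn where "sn n = u0 + (b - u0) / (real n + 1)" for n
    have sn: "u0 < sn n" "sn n \<le> b" for n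
    proof -
      have p: "0 < b - u0" using False u0 by simp
      then show "u0 < sn n" by (simp add: sn_def)
      have "(b - u0) / (real n + 1) \<le> (b - u0) / 1" using p by (intro divide_left_mono) auto
      then show "sn n \<le> b" by (simp add: sn_def)
    qed
    have "(\<lambda>n. emeasure \<nu> ({a<..sn n} \<times> {0..f a})) \<longlonglongrightarrow> emeasure \<nu> (\<Inter>n. {a<..sn n} \<times> {0..f a})"
    proof (rule Lim_emeasure_decseq)
      show "decseq (\<lambda>n. {a<..sn n} \<times> {0..f a})"
      proof (rule decseq_SucI)
        fix n
        have "sn (Suc n) \<le> sn n" unfolding sn_def using u0 by (intro add_left_mono divide_left_mono) auto
        then show "{a<..sn (Suc n)} \<times> {0..f a} \<subseteq> {a<..sn n} \<times> {0..f a}" by auto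
      qed
      show "emeasure \<nu> ({a<..sn n} \<times> {0..f a}) \<noteq> \<infinity>" for n
      proof -
        have "D (sn n) \<le> 1" using Dmono[OF sn(2)[of n]] Db by (rule order_trans)
        then show ?thesis unfolding D_def by (auto simp: top_unique)
      qed
    qed (use Dset in auto)
    moreover have "(\<Inter>n. {a<..sn n} \<times> {0..f a}) = {a<..u0} \<times> {0..f a}"
    proof -
      have "v \<le> u0" if "\<And>n. v \<le> sn n" for v
      proof (rule LIMSEQ_le_const)
        have "(\<lambda>n. u0 + (b - u0) / (real n + 1)) \<longlonglongrightarrow> u0" by real_asymp
        then show "sn \<longlonglongrightarrow> u0" by (simp add: sn_def[abs_def])
      qed (use that in auto)
      moreover have "v \<le> sn n" if "v \<le> u0" for v n using sn(1)[of n] that by simp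
      ultimately show ?thesis by auto
    qed
    ultimately have "(\<lambda>n. D (sn n)) \<longlonglongrightarrow> D u0" by (simp add: D_def)
    then show ?thesis
      by (rule LIMSEQ_le_const) (use D1 above sn in auto)
  qed
  have au: "a < u0"
  proof (rule ccontr)
    assume "\<not> a < u0"
    then have "u0 = a" using u0 by simp
    then show False using Du0 by (simp add: D_def)
  qed
  define P where "P = {u0} \<times> {0..f a}"
  have Ps: "P \<in> sets \<nu>" unfolding P_def using u0 ab by (intro rect_sets) auto
  have P1: "1 \<le> emeasure \<nu> P"
  proof -
    define sn where "sn n = u0 - (u0 - a) / (real n + 1)" for n
    have sn: "a \<le> sn n" "sn n < u0" for n
    proof -
      have p: "0 < u0 - a" using au by simp
      then show "sn n < u0" by (simp add: sn_def)
      have "(u0 - a) / (real n + 1) \<le> (u0 - a) / 1" using p by (intro divide_left_mono) auto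
      then show "a \<le> sn n" by (simp add: sn_def)
    qed
    have "emeasure \<nu> (\<Union>n. {a<..sn n} \<times> {0..f a}) = 0"
      using below[OF sn] Dset by (intro emeasure_UN_eq_0) (auto simp: D_def)
    moreover have "(\<Union>n. {a<..sn n} \<times> {0..f a}) = {a<..<u0} \<times> {0..f a}"
    proof -
      have "\<exists>n. v \<le> sn n" if "v < u0" for v
      proof -
        have "(\<lambda>n. u0 - (u0 - a) / (real n + 1)) \<longlonglongrightarrow> u0" by real_asymp
        then have "\<forall>\<^sub>F n in sequentially. v < sn n" unfolding sn_def by (rule order_tendstoD(1)[OF _ that])
        then show ?thesis by (meson eventually_sequentially less_imp_le order_refl)
      qed
      moreover have "v < u0" if "v \<le> sn n" for v n using that sn(2)[of n] by simp
      ultimately show ?thesis by auto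
    qed
    ultimately have z: "emeasure \<nu> ({a<..<u0} \<times> {0..f a}) = 0" by simp
    have "{a<..u0} \<times> {0..f a} = ({a<..<u0} \<times> {0..f a}) \<union> P" using au by (auto simp: P_def)
    then have "D u0 \<le> emeasure \<nu> ({a<..<u0} \<times> {0..f a}) + emeasure \<nu> P"
      unfolding D_def using ab Ps by (simp only:) (intro emeasure_subadditive rect_sets, auto)
    then show ?thesis using Du0 z by simp
  qed
  \<comment> \<open>The line segment \<open>P\<close> exhausts the mass that the rectangle can have.\<close>
  have rest: "emeasure \<nu> E = 0" if E: "E \<in> sets \<nu>" "E \<subseteq> {a<..b} \<times> {0..c}" "E \<inter> P = {}" for E
  proof -
    have "emeasure \<nu> P + emeasure \<nu> E = emeasure \<nu> (P \<union> E)" using E Ps by (intro plus_emeasure) auto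
    also have "\<dots> \<le> emeasure \<nu> ({a<..b} \<times> {0..c})"
      using E au u0 fc ab by (intro emeasure_mono) (auto simp: P_def intro!: rect_sets)
    also have "\<dots> \<le> 1" by (rule le1)
    finally have *: "emeasure \<nu> P + emeasure \<nu> E \<le> 1" .
    have "1 + emeasure \<nu> E \<le> emeasure \<nu> P + emeasure \<nu> E" using P1 by (rule add_right_mono)
    also note *
    finally have "1 + emeasure \<nu> E \<le> 1 + 0" by simp
    then have "emeasure \<nu> E \<le> 0" by (subst (asm) ennreal_add_left_cancel_le) auto
    then show ?thesis by simp
  qed
  have P1': "emeasure \<nu> P = 1"
  proof (rule antisym)
    show "emeasure \<nu> P \<le> 1"
      by (rule order_trans[OF emeasure_mono le1]) (use ab au u0 fc in \<open>auto simp: P_def intro!: rect_sets\<close>)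
  qed (rule P1)
  have lin: "f v = f a + (v - a)" if "a \<le> v" "v < u0" for v
  proof (rule no_jump[of a v c])
    show "emeasure \<nu> ({a<..v} \<times> {0..c}) = 0"
      using that u0 ab by (intro rest rect_sets) (auto simp: P_def)
  qed (use that u0 c ab in auto)
  have ll: "left_lim f u = f a + (u - a)" if "a < u" "u \<le> u0" for u
  proof (rule left_lim_linear)
    show "f v = f a + (v - a)" if "a \<le> v" "v < u" for v
      using that \<open>u \<le> u0\<close> by (intro lin) auto
  qed (use that ab in auto)
  define y where "y = f a + (u0 - a)"
  have y: "f a \<le> y" "y \<le> c" using au u0 c by (auto simp: y_def)
  have "AE p in \<nu>. p \<notin> {a<..u0} \<times> {0..c} - P"
    using ab u0 Ps by (intro AE_not_in null_setsI rest sets.Diff rect_sets) auto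
  then have "AE p in \<nu>. indicator ({a<..u0} \<times> {0..}) p *\<^sub>R jump_integrand f p = indicator P p *\<^sub>R y"
  proof eventually_elim
    fix p assume p: "p \<notin> {a<..u0} \<times> {0..c} - P"
    obtain u z where pz: "p = (u, z)" by (cases p)
    show "indicator ({a<..u0} \<times> {0..}) p *\<^sub>R jump_integrand f p = indicator P p *\<^sub>R y"
    proof (cases "p \<in> P")
      case True
      then have "u = u0" "0 \<le> z" "z \<le> f a" by (auto simp: pz P_def)
      then show ?thesis using True ll[of u0] au y by (simp add: pz jump_integrand_def y_def)
    next
      case False
      then have "\<not> (a < u \<and> u \<le> u0 \<and> 0 \<le> z \<and> z \<le> c)" using p by (auto simp: pz)
      then have "\<not> (a < u \<and> u \<le> u0 \<and> 0 \<le> z) \<or> c < z" by auto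
      then show ?thesis using False ll[of u] c u0
        by (auto simp: pz jump_integrand_def indicator_def)
    qed
  qed
  then have "(LINT p : {a<..u0} \<times> {0..} | \<nu>. jump_integrand f p) = (LINT p|\<nu>. indicator P p *\<^sub>R y)"
    unfolding set_lebesgue_integral_def
    using increment(1)[of a u0] ab u0 Ps
    by (intro integral_cong_AE) (auto simp: set_integrable_def intro: borel_measurable_integrable)
  also have "\<dots> = y" using Ps P1' by (simp add: measure_def)
  finally have fu0: "f u0 = - y" using increment(2)[of a u0] ab u0 by (simp add: y_def)
  have "f b = f u0 + (b - u0)"
  proof (rule no_jump[of u0 b c])
    show "emeasure \<nu> ({u0<..b} \<times> {0..c}) = 0"
      using au u0 ab by (intro rest rect_sets) (auto simp: P_def)
    show "f u0 + (b - u0) \<le> c" using fu0 y fa c au u0 by simp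
  qed (use u0 ab in auto)
  then show ?thesis using fu0 au u0 by (auto simp: y_def)
qed

end

section \<open>Coupling a path with a lattice recursion\<close>

definition strip :: "real \<Rightarrow> nat \<Rightarrow> real set" where
  "strip \<delta> k = {real k * \<delta> <.. real (Suc k) * \<delta>}"

context telegraph_path begin

text \<open>The lattice recursion \<open>Z\<close> jumps in the \<open>k\<close>-th time strip if \<open>\<nu>\<close> has a point there below its own height. It
decides as the path does unless some point falls between the two heights, which \<open>window\<close> excludes as long as the
distance is at most \<open>\<delta> (L + 1)\<close>. Without a jump the distance does not change; a jump increases it by at most \<open>\<delta>\<close>,
because the jump of the path may occur anywhere in the strip; and there are at most \<open>L\<close> jumps.\<close>

lemma euler_coupling:
  fixes Z :: "nat \<Rightarrow> int" and n L :: nat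
  assumes \<delta>: "0 < \<delta>"
    and Z0: "Z 0 = \<lfloor>f 0 / \<delta>\<rfloor>"
    and ZS: "\<And>k. Z (Suc k) = (if emeasure \<nu> (strip \<delta> k \<times> {0..<\<delta> * Z k}) \<noteq> 0 then - Z k else Z k + 1)"
    and R: "\<bar>f 0\<bar> + real n * \<delta> \<le> R"
    and single: "\<And>k. k < n \<Longrightarrow> emeasure \<nu> (strip \<delta> k \<times> {0..R}) \<le> 1"
    and total: "emeasure \<nu> ({0<..real n * \<delta>} \<times> {0..R}) \<le> of_nat L"
    and window: "\<And>k. k < n \<Longrightarrow>
       emeasure \<nu> (strip \<delta> k \<times> ({\<delta> * Z k - \<delta> * (L + 2)..\<delta> * Z k + \<delta> * (L + 2)} \<inter> {0..})) = 0"
  shows "\<bar>f (real n * \<delta>)\<bar> \<le> \<bar>f 0\<bar> + real n * \<delta> \<and> \<bar>f (real n * \<delta>) - \<delta> * Z n\<bar> \<le> \<delta> * (L + 1)"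
proof -
  have strip_sub: "strip \<delta> k \<subseteq> {0..}" for k using \<delta> unfolding strip_def
    by (auto intro: order_trans[of 0 "real k * \<delta>"])
  have strip_s: "strip \<delta> k \<in> sets borel" for k by (simp add: strip_def)
  note rs = rect_sets[OF strip_s _ strip_sub]
  have key: "\<bar>f (real k * \<delta>)\<bar> \<le> \<bar>f 0\<bar> + real k * \<delta> \<and>
      (\<exists>c::nat. of_nat c \<le> emeasure \<nu> ({0<..real k * \<delta>} \<times> {0..R}) \<and> \<bar>f (real k * \<delta>) - \<delta> * Z k\<bar> \<le> \<delta> * (c + 1))"
    if "k \<le> n" for k
    using that
  proof (induction k)
    case 0
    have 1: "\<delta> * \<lfloor>f 0 / \<delta>\<rfloor> \<le> f 0"
      using mult_left_mono[OF of_int_floor_le[of "f 0 / \<delta>"], of \<delta>] \<delta> by simp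
    have 2: "f 0 \<le> \<delta> * (\<lfloor>f 0 / \<delta>\<rfloor> + 1)"
      using mult_left_mono[OF less_imp_le[OF real_of_int_floor_add_one_gt[of "f 0 / \<delta>"]], of \<delta>] \<delta> by simp
    have "\<bar>f 0 - \<delta> * Z 0\<bar> \<le> \<delta>" using 1 2 Z0 by (simp add: algebra_simps)
    then show ?case by (auto intro!: exI[of _ 0])
  next
    case (Suc k)
    define a where "a = real k * \<delta>"
    define b where "b = real (Suc k) * \<delta>"
    have ab: "0 \<le> a" "a < b" "b - a = \<delta>" using \<delta> by (auto simp: a_def b_def algebra_simps)
    have strip: "strip \<delta> k = {a<..b}" by (simp add: strip_def a_def b_def)
    have kn: "k < n" using Suc.prems by simp
    obtain c :: nat where c: "of_nat c \<le> emeasure \<nu> ({0<..a} \<times> {0..R})" "\<bar>f a - \<delta> * Z k\<bar> \<le> \<delta> * (c + 1)"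
      and fa: "\<bar>f a\<bar> \<le> \<bar>f 0\<bar> + a"
      using Suc.IH Suc.prems unfolding a_def by auto
    have bR: "\<bar>f 0\<bar> + b \<le> R"
    proof -
      have "real (Suc k) * \<delta> \<le> real n * \<delta>" using Suc.prems \<delta> by (intro mult_right_mono) auto
      then show ?thesis using R by (simp add: b_def)
    qed
    have cL: "real c \<le> real L"
    proof -
      have "emeasure \<nu> ({0<..a} \<times> {0..R}) \<le> emeasure \<nu> ({0<..real n * \<delta>} \<times> {0..R})"
      proof (intro emeasure_mono rect_sets)
        have "a \<le> real n * \<delta>" unfolding a_def using kn \<delta> by (intro mult_right_mono) auto
        then show "{0<..a} \<times> {0..R} \<subseteq> {0<..real n * \<delta>} \<times> {0..R}" by auto
      qed auto
      with c(1) total have "(of_nat c :: ennreal) \<le> of_nat L" by (meson order_trans)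
      then show ?thesis by simp
    qed
    define X where "X = \<delta> * Z k"
    define \<eta> where "\<eta> = \<delta> * (L + 2)"
    have err: "\<bar>f a - X\<bar> \<le> \<delta> * (c + 1)" using c(2) by (simp add: X_def)
    have "\<delta> * (real c + 1) \<le> \<delta> * (real L + 1)" using cL \<delta> by (intro mult_left_mono) auto
    then have err\<eta>: "\<bar>f a - X\<bar> + \<delta> \<le> \<eta>" using err unfolding \<eta>_def by (simp add: algebra_simps)
    have win: "emeasure \<nu> ({a<..b} \<times> ({X - \<eta>..X + \<eta>} \<inter> {0..})) = 0"
      using window[OF kn] by (simp add: X_def \<eta>_def strip)
    have sub: "emeasure \<nu> A = 0" if "A \<subseteq> B \<union> C" "B \<in> sets \<nu>" "C \<in> sets \<nu>" "emeasure \<nu> B = 0" "emeasure \<nu> C = 0" for A B C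
    proof -
      have "emeasure \<nu> A \<le> emeasure \<nu> (B \<union> C)" using that by (intro emeasure_mono) auto
      also have "\<dots> \<le> emeasure \<nu> B + emeasure \<nu> C" using that by (intro emeasure_subadditive) auto
      finally show ?thesis using that by simp
    qed
    have rs': "B \<in> sets borel \<Longrightarrow> B \<subseteq> {0..} \<Longrightarrow> {a<..b} \<times> B \<in> sets \<nu>" for B using rs[of B k] by (simp add: strip)
    have split: "{0<..b} \<times> {0..R} = ({0<..a} \<times> {0..R}) \<union> ({a<..b} \<times> {0..R})" using ab by auto
    have grow: "emeasure \<nu> ({0<..b} \<times> {0..R}) = emeasure \<nu> ({0<..a} \<times> {0..R}) + emeasure \<nu> ({a<..b} \<times> {0..R})"
      unfolding split by (intro plus_emeasure[symmetric] rs' rect_sets) auto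
    show ?case
    proof (cases "emeasure \<nu> ({a<..b} \<times> {0..<X}) = 0")
      case True
      have "emeasure \<nu> ({a<..b} \<times> {0..X + \<eta>}) = 0"
      proof (rule sub[OF _ _ _ True win])
        show "{a<..b} \<times> {0..X + \<eta>} \<subseteq> {a<..b} \<times> {0..<X} \<union> {a<..b} \<times> ({X - \<eta>..X + \<eta>} \<inter> {0..})"
          using err\<eta> \<delta> by auto
      qed (auto intro!: rs')
      then have fb: "f b = f a + (b - a)"
        using ab err\<eta> by (intro no_jump[of a b "X + \<eta>" b]) auto
      have Z: "Z (Suc k) = Z k + 1" using True by (simp add: ZS strip X_def)
      have "of_nat c \<le> emeasure \<nu> ({0<..b} \<times> {0..R})" using c(1) unfolding grow by (simp add: add_increasing2)
      moreover have "\<bar>f b - \<delta> * Z (Suc k)\<bar> \<le> \<delta> * (c + 1)"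
        using err by (simp add: fb ab Z X_def algebra_simps)
      moreover have "\<bar>f b\<bar> \<le> \<bar>f 0\<bar> + b" using fa fb ab by linarith
      ultimately show ?thesis unfolding b_def[symmetric] by (intro conjI exI[of _ c])
    next
      case False
      have ne: "emeasure \<nu> ({a<..b} \<times> {0..f a}) \<noteq> 0"
      proof
        assume z: "emeasure \<nu> ({a<..b} \<times> {0..f a}) = 0"
        have "emeasure \<nu> ({a<..b} \<times> {0..<X}) = 0"
        proof (rule sub[OF _ _ _ z win])
          show "{a<..b} \<times> {0..<X} \<subseteq> {a<..b} \<times> {0..f a} \<union> {a<..b} \<times> ({X - \<eta>..X + \<eta>} \<inter> {0..})"
            using err\<eta> \<delta> by auto
        qed (auto intro!: rs')
        then show False using False by simp
      qed
      have fa0: "0 \<le> f a"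
      proof (rule ccontr)
        assume "\<not> 0 \<le> f a"
        then have e: "{a<..b} \<times> {0..f a} = {}" by auto
        show False using ne unfolding e by simp
      qed
      have faR: "f a + (b - a) \<le> R" using fa fa0 bR by linarith
      have j: "\<bar>f b + f a\<bar> \<le> b - a"
      proof (rule one_jump[of a b R])
        show "emeasure \<nu> ({a<..b} \<times> {0..R}) \<le> 1" using single[OF kn] by (simp add: strip)
      qed (use ab faR fa0 ne in auto)
      have Z: "Z (Suc k) = - Z k" using False by (simp add: ZS strip X_def)
      have "1 \<le> emeasure \<nu> ({a<..b} \<times> {0..f a})"
      proof -
        have "{a<..b} \<times> {0..f a} \<in> sets quadrant_lborel" using ab by (intro quad_sets) auto
        then show ?thesis using int_\<nu> ne ennreal_of_enat_ge1 by metis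
      qed
      also have "\<dots> \<le> emeasure \<nu> ({a<..b} \<times> {0..R})"
        using faR ab by (intro emeasure_mono rs') auto
      finally have g1: "1 \<le> emeasure \<nu> ({a<..b} \<times> {0..R})" .
      have "of_nat (Suc c) \<le> emeasure \<nu> ({0<..b} \<times> {0..R})"
        unfolding grow of_nat_Suc add.commute[of 1] by (intro add_mono c(1) g1)
      moreover have "\<bar>f b - \<delta> * Z (Suc k)\<bar> \<le> \<delta> * real (Suc c + 1)"
      proof -
        have "\<bar>f b + X\<bar> \<le> \<bar>f b + f a\<bar> + \<bar>f a - X\<bar>" by linarith
        moreover have "\<delta> * real_of_int (Z (Suc k)) = - X" by (simp add: Z X_def)
        moreover have "\<delta> * real (Suc c + 1) = \<delta> + \<delta> * real (c + 1)" by (simp add: algebra_simps)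
        ultimately show ?thesis using j err ab(3) by linarith
      qed
      moreover have "\<bar>f b\<bar> \<le> \<bar>f 0\<bar> + b" using j fa ab by linarith
      ultimately show ?thesis unfolding b_def[symmetric] by (intro conjI exI[of _ "Suc c"])
    qed
  qed
  from key[of n] obtain c :: nat where c: "\<bar>f (real n * \<delta>)\<bar> \<le> \<bar>f 0\<bar> + real n * \<delta>"
    "of_nat c \<le> emeasure \<nu> ({0<..real n * \<delta>} \<times> {0..R})" "\<bar>f (real n * \<delta>) - \<delta> * Z n\<bar> \<le> \<delta> * (c + 1)" by auto
  have "(of_nat c :: ennreal) \<le> of_nat L" using c(2) total by (rule order_trans)
  then have "\<delta> * real (c + 1) \<le> \<delta> * real (L + 1)" using \<delta> by (intro mult_left_mono) auto
  with c(3) have "\<bar>f (real n * \<delta>) - \<delta> * Z n\<bar> \<le> \<delta> * real (L + 1)" by (rule order_trans)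
  with c(1) show ?thesis by blast
qed

end

section \<open>The Euler chain driven by a Poisson random measure\<close>

lemma strip_subset: "0 \<le> \<delta> \<Longrightarrow> strip \<delta> k \<subseteq> {0..}"
  unfolding strip_def by (auto intro: order_trans[of 0 "real k * \<delta>"])

lemma strip_rect_sets:
  "0 \<le> \<delta> \<Longrightarrow> B \<in> sets borel \<Longrightarrow> B \<subseteq> {0..} \<Longrightarrow> strip \<delta> k \<times> B \<in> sets quadrant_lborel"
  by (intro quad_sets strip_subset) (auto simp: strip_def)

lemma strip_disjoint:
  assumes "0 \<le> \<delta>" "i \<noteq> j" shows "strip \<delta> i \<inter> strip \<delta> j = {}"
proof -
  have "strip \<delta> i \<inter> strip \<delta> j = {}" if "i < j" for i j
  proof -
    have "real (Suc i) * \<delta> \<le> real j * \<delta>" using that assms(1) by (intro mult_right_mono) auto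
    then show ?thesis by (auto simp: strip_def)
  qed
  then show ?thesis using assms(2) by (metis inf_commute linorder_neq_iff)
qed

lemma emeasure_quadrant_rect:
  assumes "0 \<le> a" "a \<le> b" "B \<in> sets borel" "B \<subseteq> {0..}"
  shows "emeasure quadrant_lborel ({a<..b} \<times> B) = ennreal (b - a) * emeasure lborel B"
proof -
  have q: "{0..} \<times> {0..} \<in> sets (borel :: (real \<times> real) measure)" by (intro borel_Times) auto
  have "emeasure quadrant_lborel ({a<..b} \<times> B) = emeasure lborel ({a<..b} \<times> B)"
    unfolding quadrant_lborel_def using assms q by (subst emeasure_restrict_space) auto
  also have "\<dots> = emeasure lborel {a<..b} * emeasure lborel B"
    unfolding lborel_prod[symmetric] using assms by (intro lborel.emeasure_pair_measure_Times) auto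
  finally show ?thesis using assms by simp
qed

locale prm_space = prob_space M for M :: "'a measure" +
  fixes N :: "'a \<Rightarrow> (real \<times> real) measure"
  assumes prm: "poisson_random_measure M quadrant_lborel N"
begin

lemma N_measurable: "A \<in> sets quadrant_lborel \<Longrightarrow> (\<lambda>\<omega>. emeasure (N \<omega>) A) \<in> borel_measurable M"
  using prm unfolding poisson_random_measure_def poisson_distributed_def by blast

lemma N_pmf:
  assumes "A \<in> sets quadrant_lborel" "emeasure quadrant_lborel A = ennreal m" "0 \<le> m"
  shows "prob {\<omega> \<in> space M. emeasure (N \<omega>) A = of_nat k} = m ^ k / fact k * exp (- m)"
proof -
  have "poisson_distributed M (\<lambda>\<omega>. emeasure (N \<omega>) A) (ennreal m)"
    using prm assms unfolding poisson_random_measure_def by metis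
  then show ?thesis using assms(3) unfolding poisson_distributed_def by auto
qed

lemma N_void:
  assumes "A \<in> sets quadrant_lborel" "emeasure quadrant_lborel A = ennreal m" "0 \<le> m"
  shows "prob {\<omega> \<in> space M. emeasure (N \<omega>) A = 0} = exp (- m)"
  using N_pmf[OF assms, of 0] by simp

lemma N_integer: "\<omega> \<in> space M \<Longrightarrow> A \<in> sets quadrant_lborel \<Longrightarrow> \<exists>n. emeasure (N \<omega>) A = ennreal_of_enat n"
  using prm unfolding poisson_random_measure_def by blast

lemma N_nonvoid_le:
  assumes A: "A \<in> sets quadrant_lborel" "emeasure quadrant_lborel A = ennreal m" "0 \<le> m"
  shows "prob {\<omega> \<in> space M. emeasure (N \<omega>) A \<noteq> 0} \<le> m"
proof -
  note [measurable] = N_measurable[OF A(1)]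
  have "prob {\<omega> \<in> space M. emeasure (N \<omega>) A \<noteq> 0} = 1 - prob {\<omega> \<in> space M. emeasure (N \<omega>) A = 0}"
    by (subst prob_neg[symmetric]) auto
  also have "\<dots> \<le> m" using N_void[OF A] exp_ge_add_one_self[of "- m"] by simp
  finally show ?thesis .
qed

text \<open>Here \<open>1 - exp (- m) - m exp (- m) \<le> m\<^sup>2\<close> since \<open>exp (- m) \<ge> 1 - m\<close>.\<close>

lemma N_two_points_le:
  assumes A: "A \<in> sets quadrant_lborel" "emeasure quadrant_lborel A = ennreal m" "0 \<le> m"
  shows "prob {\<omega> \<in> space M. \<not> emeasure (N \<omega>) A \<le> 1} \<le> m\<^sup>2"
proof -
  note [measurable] = N_measurable[OF A(1)]
  have "{\<omega> \<in> space M. \<not> emeasure (N \<omega>) A \<le> 1} = space M - ({\<omega> \<in> space M. emeasure (N \<omega>) A = 0} \<union> {\<omega> \<in> space M. emeasure (N \<omega>) A = 1})"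
  proof -
    have "emeasure (N \<omega>) A \<le> 1 \<longleftrightarrow> emeasure (N \<omega>) A = 0 \<or> emeasure (N \<omega>) A = 1" if "\<omega> \<in> space M" for \<omega>
      using N_integer[OF that A(1)] ennreal_of_enat_ge1 by (metis antisym zero_le one_neq_zero order_refl)
    then show ?thesis by auto
  qed
  then have "prob {\<omega> \<in> space M. \<not> emeasure (N \<omega>) A \<le> 1}
     = 1 - prob ({\<omega> \<in> space M. emeasure (N \<omega>) A = 0} \<union> {\<omega> \<in> space M. emeasure (N \<omega>) A = 1})"
    by (simp only:) (rule prob_compl, measurable)
  also have "prob ({\<omega> \<in> space M. emeasure (N \<omega>) A = 0} \<union> {\<omega> \<in> space M. emeasure (N \<omega>) A = 1})
     = exp (- m) + m * exp (- m)"
    using N_void[OF A] N_pmf[OF A, of 1] by (subst finite_measure_Union) auto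
  also have "1 - (exp (- m) + m * exp (- m)) \<le> m\<^sup>2"
  proof -
    have "(1 - m) * (1 + m) \<le> exp (- m) * (1 + m)"
      using exp_ge_add_one_self[of "- m"] A(3) by (intro mult_right_mono) auto
    then show ?thesis by (simp add: algebra_simps power2_eq_square)
  qed
  finally show ?thesis .
qed

lemma N_many_points:
  assumes A: "A \<in> sets quadrant_lborel" "emeasure quadrant_lborel A = ennreal m" "0 \<le> m" and e: "0 < e"
  obtains L :: nat where "prob {\<omega> \<in> space M. \<not> emeasure (N \<omega>) A \<le> of_nat L} \<le> e"
proof -
  note [measurable] = N_measurable[OF A(1)]
  have "(\<lambda>k. m ^ k / fact k * exp (- m)) sums (exp m * exp (- m))"
    using exp_converges[of m] by (intro sums_mult2) (simp add: field_simps)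
  then have "(\<lambda>L. \<Sum>k\<le>L. m ^ k / fact k * exp (- m)) \<longlonglongrightarrow> 1"
    unfolding sums_def_le by (simp flip: exp_add)
  then have "\<forall>\<^sub>F L in sequentially. 1 - e < (\<Sum>k\<le>L. m ^ k / fact k * exp (- m))"
    by (rule order_tendstoD) (use e in auto)
  then obtain L where L: "1 - e < (\<Sum>k\<le>L. m ^ k / fact k * exp (- m))"
    unfolding eventually_sequentially by blast
  have "(\<Sum>k\<le>L. m ^ k / fact k * exp (- m)) = (\<Sum>k\<le>L. prob {\<omega> \<in> space M. emeasure (N \<omega>) A = of_nat k})"
    by (intro sum.cong refl N_pmf[OF A, symmetric])
  also have "\<dots> = prob (\<Union>k\<le>L. {\<omega> \<in> space M. emeasure (N \<omega>) A = of_nat k})"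
    by (intro finite_measure_finite_Union[symmetric]) (auto simp: disjoint_family_on_def)
  also have "\<dots> \<le> prob {\<omega> \<in> space M. emeasure (N \<omega>) A \<le> of_nat L}"
    by (intro finite_measure_mono) auto
  also have "\<dots> = 1 - prob {\<omega> \<in> space M. \<not> emeasure (N \<omega>) A \<le> of_nat L}"
    by (subst prob_neg[symmetric]) auto
  finally have "prob {\<omega> \<in> space M. \<not> emeasure (N \<omega>) A \<le> of_nat L} \<le> e" using L by linarith
  then show ?thesis by (rule that)
qed

definition hit :: "real \<Rightarrow> nat \<Rightarrow> real set \<Rightarrow> 'a \<Rightarrow> bool" where
  "hit \<delta> k B \<omega> \<longleftrightarrow> emeasure (N \<omega>) (strip \<delta> k \<times> B) \<noteq> 0"

text \<open>The Euler chain in units of the mesh \<open>\<delta>\<close>, started at the deterministic lattice point \<open>z\<close>; hence it is a function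
of the random measure alone.\<close>

primrec echain :: "real \<Rightarrow> int \<Rightarrow> nat \<Rightarrow> 'a \<Rightarrow> int" where
  "echain \<delta> z 0 \<omega> = z"
| "echain \<delta> z (Suc k) \<omega> = (if hit \<delta> k {0..<\<delta> * echain \<delta> z k \<omega>} \<omega> then - echain \<delta> z k \<omega> else echain \<delta> z k \<omega> + 1)"

abbreviation chain_at :: "real \<Rightarrow> int \<Rightarrow> nat \<Rightarrow> int \<Rightarrow> 'a set" where
  "chain_at \<delta> z k j \<equiv> {\<omega> \<in> space M. echain \<delta> z k \<omega> = j}"

abbreviation hit_is :: "real \<Rightarrow> nat \<Rightarrow> real set \<Rightarrow> bool \<Rightarrow> 'a set" where
  "hit_is \<delta> k B b \<equiv> {\<omega> \<in> space M. hit \<delta> k B \<omega> = b}"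

abbreviation chain_range :: "int \<Rightarrow> nat \<Rightarrow> int set" where
  "chain_range z k \<equiv> {- (\<bar>z\<bar> + int k)..\<bar>z\<bar> + int k}"

lemma echain_bound: "\<bar>echain \<delta> z k \<omega>\<bar> \<le> \<bar>z\<bar> + int k"
  by (induction k) auto

lemma hit_sets:
  assumes "0 \<le> \<delta>" "B \<in> sets borel" "B \<subseteq> {0..}"
    and F: "\<And>A. A \<in> sets quadrant_lborel \<Longrightarrow> (\<lambda>\<omega>. emeasure (N \<omega>) A) \<in> borel_measurable F"
  shows "{\<omega> \<in> space F. hit \<delta> k B \<omega>} \<in> sets F"
proof -
  note [measurable] = F[OF strip_rect_sets[OF assms(1-3), of k]]
  show ?thesis unfolding hit_def by measurable
qed

lemma echain_sets:
  assumes \<delta>: "0 \<le> \<delta>"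
    and F: "\<And>A. A \<in> sets quadrant_lborel \<Longrightarrow> (\<lambda>\<omega>. emeasure (N \<omega>) A) \<in> borel_measurable F"
  shows "{\<omega> \<in> space F. echain \<delta> z k \<omega> = j} \<in> sets F"
proof (induction k arbitrary: j)
  case 0
  then show ?case by (cases "z = j") auto
next
  case (Suc k)
  have h: "{\<omega> \<in> space F. hit \<delta> k {0..<\<delta> * real_of_int i} \<omega>} \<in> sets F" for i
    by (intro hit_sets \<delta> F) auto
  have "{\<omega> \<in> space F. echain \<delta> z (Suc k) \<omega> = j}
    = ({\<omega> \<in> space F. echain \<delta> z k \<omega> = - j} \<inter> {\<omega> \<in> space F. hit \<delta> k {0..<\<delta> * real_of_int (- j)} \<omega>})
    \<union> ({\<omega> \<in> space F. echain \<delta> z k \<omega> = j - 1} - {\<omega> \<in> space F. hit \<delta> k {0..<\<delta> * real_of_int (j - 1)} \<omega>})"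
    by (auto split: if_splits) presburger
  also have "\<dots> \<in> sets F" using Suc h by blast
  finally show ?case .
qed

text \<open>Prescribed occupation (\<open>e\<close>) of prescribed height ranges (\<open>B\<close>) in the time strips from \<open>k\<close> to \<open>n - 1\<close>.\<close>

definition futures :: "real \<Rightarrow> nat \<Rightarrow> nat \<Rightarrow> (nat \<Rightarrow> real set) \<Rightarrow> (nat \<Rightarrow> bool) \<Rightarrow> 'a set" where
  "futures \<delta> k n B e = {\<omega> \<in> space M. \<forall>i\<in>{k..<n}. hit \<delta> i (B i) \<omega> = e i}"

lemma futures_prob:
  assumes \<delta>: "0 \<le> \<delta>" and B: "\<And>i. B i \<in> sets borel \<and> B i \<subseteq> {0..}"
  shows "prob (futures \<delta> k n B e) = (\<Prod>i\<in>{k..<n}. prob (hit_is \<delta> i (B i) (e i)))"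
proof (cases "k < n")
  case False
  then show ?thesis by (simp add: futures_def prob_space)
next
  case True
  define X where "X i \<omega> = emeasure (N \<omega>) (strip \<delta> i \<times> B i)" for i \<omega>
  define S where "S i = (if e i then - {0} else {0 :: ennreal})" for i
  have "indep_vars (\<lambda>_. borel) X {..<n}"
  proof -
    have "disjoint_family_on (\<lambda>i. strip \<delta> i \<times> B i) {..<n} \<and> (\<forall>i<n. strip \<delta> i \<times> B i \<in> sets quadrant_lborel)"
      using strip_disjoint[OF \<delta>] B strip_rect_sets[OF \<delta>] by (fastforce simp: disjoint_family_on_def)
    then show ?thesis using prm unfolding poisson_random_measure_def X_def by blast
  qed
  then have "prob (\<Inter>i\<in>{k..<n}. X i -` S i \<inter> space M) = (\<Prod>i\<in>{k..<n}. prob (X i -` S i \<inter> space M))"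
    by (rule indep_varsD) (use True in \<open>auto simp: S_def\<close>)
  moreover have e: "X i -` S i \<inter> space M = hit_is \<delta> i (B i) (e i)" for i
    by (auto simp: X_def S_def hit_def)
  moreover have "(\<Inter>i\<in>{k..<n}. X i -` S i \<inter> space M) = futures \<delta> k n B e"
    unfolding e using True by (auto simp: futures_def)
  ultimately show ?thesis by simp
qed

text \<open>The chain reads a set of random height in each strip, so independence is proved by induction over \<open>k\<close>, for all
later strips at once. The value \<open>j\<close> at time \<open>k + 1\<close> has exactly two predecessors at time \<open>k\<close>: \<open>- j\<close> with a hit
and \<open>j - 1\<close> without one. For a fixed predecessor the height is fixed, and the strip \<open>k\<close> joins the future.\<close>

lemma echain_futures_indep:
  assumes \<delta>: "0 \<le> \<delta>"
  shows "(\<And>i. B i \<in> sets borel \<and> B i \<subseteq> {0..}) \<Longrightarrow>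
    prob (chain_at \<delta> z k j \<inter> futures \<delta> k (k + m) B e)
     = prob (chain_at \<delta> z k j) * prob (futures \<delta> k (k + m) B e)"
proof (induction k arbitrary: j m B e)
  case 0
  show ?case
  proof (cases "j = z")
    case True
    then have "chain_at \<delta> z 0 j = space M" by auto
    moreover have "space M \<inter> futures \<delta> 0 (0 + m) B e = futures \<delta> 0 (0 + m) B e" by (auto simp: futures_def)
    ultimately show ?thesis by (simp only: prob_space mult_1)
  qed auto
next
  case (Suc k)
  define C where "C i = {0..<\<delta> * real_of_int i}" for i :: int
  have fs: "futures \<delta> k n B e \<in> events" if B: "\<And>i. B i \<in> sets borel \<and> B i \<subseteq> {0..}" for k n B e
  proof -
    have "{\<omega> \<in> space M. hit \<delta> i (B i) \<omega>} \<in> events" for i using B by (intro hit_sets \<delta> N_measurable) auto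
    then have [measurable]: "Measurable.pred M (hit \<delta> i (B i))" for i by (simp add: pred_def)
    show ?thesis unfolding futures_def by measurable
  qed
  have es: "chain_at \<delta> z k j \<in> events" for k j by (intro echain_sets \<delta> N_measurable)
  have step: "prob (chain_at \<delta> z (Suc k) j \<inter> futures \<delta> (Suc k) (Suc k + m) B e)
      = (prob (chain_at \<delta> z k (- j)) * prob (hit_is \<delta> k (C (- j)) True)
       + prob (chain_at \<delta> z k (j - 1)) * prob (hit_is \<delta> k (C (j - 1)) False))
       * prob (futures \<delta> (Suc k) (Suc k + m) B e)"
    if B: "\<And>i. B i \<in> sets borel \<and> B i \<subseteq> {0..}" for j m B e
  proof -
    \<comment> \<open>The given future, preceded by the event that strip \<open>k\<close> is hit or not below the height \<open>\<delta> i\<close>.\<close>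
    define F where "F i b = futures \<delta> k (k + Suc m) (B(k := C i)) (e(k := b))" for i b
    have B': "(B(k := C i)) i' \<in> sets borel \<and> (B(k := C i)) i' \<subseteq> {0..}" for i i' using B by (auto simp: C_def)
    have F: "F i b = hit_is \<delta> k (C i) b \<inter> futures \<delta> (Suc k) (Suc k + m) B e" for i b
    proof -
      have "{k..<k + Suc m} = insert k {Suc k..<Suc k + m}" by auto
      then show ?thesis unfolding F_def futures_def by auto
    qed
    have pF: "prob (F i b) = prob (hit_is \<delta> k (C i) b) * prob (futures \<delta> (Suc k) (Suc k + m) B e)" for i b
    proof -
      have "{k..<k + Suc m} = insert k {Suc k..<Suc k + m}" by auto
      then show ?thesis unfolding F_def futures_prob[OF \<delta> B'] futures_prob[OF \<delta> B] by simp
    qed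
    have "chain_at \<delta> z (Suc k) j \<inter> futures \<delta> (Suc k) (Suc k + m) B e
      = (chain_at \<delta> z k (- j) \<inter> F (- j) True) \<union> (chain_at \<delta> z k (j - 1) \<inter> F (j - 1) False)"
      unfolding F C_def by (auto split: if_splits) presburger
    also have "prob \<dots> = prob (chain_at \<delta> z k (- j) \<inter> F (- j) True) + prob (chain_at \<delta> z k (j - 1) \<inter> F (j - 1) False)"
    proof (rule finite_measure_Union)
      show "(chain_at \<delta> z k (- j) \<inter> F (- j) True) \<inter> (chain_at \<delta> z k (j - 1) \<inter> F (j - 1) False) = {}"
        by auto presburger
    qed (auto intro!: sets.Int es fs[OF B'] simp: F_def)
    also have "\<dots> = prob (chain_at \<delta> z k (- j)) * prob (F (- j) True) + prob (chain_at \<delta> z k (j - 1)) * prob (F (j - 1) False)"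
      unfolding F_def by (simp only: Suc.IH[OF B'])
    finally show ?thesis unfolding pF by (simp add: algebra_simps)
  qed
  have "prob (chain_at \<delta> z (Suc k) j) = prob (chain_at \<delta> z k (- j)) * prob (hit_is \<delta> k (C (- j)) True)
       + prob (chain_at \<delta> z k (j - 1)) * prob (hit_is \<delta> k (C (j - 1)) False)"
  proof -
    have 1: "futures \<delta> (Suc k) (Suc k + 0) B e = space M" by (auto simp: futures_def)
    have 2: "chain_at \<delta> z (Suc k) j \<inter> space M = chain_at \<delta> z (Suc k) j" by auto
    have "prob (chain_at \<delta> z (Suc k) j \<inter> futures \<delta> (Suc k) (Suc k + 0) B e)
      = (prob (chain_at \<delta> z k (- j)) * prob (hit_is \<delta> k (C (- j)) True)
       + prob (chain_at \<delta> z k (j - 1)) * prob (hit_is \<delta> k (C (j - 1)) False))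
       * prob (futures \<delta> (Suc k) (Suc k + 0) B e)"
      by (rule step) (rule Suc.prems)
    then show ?thesis unfolding 1 2 prob_space by (simp only: mult_1_right)
  qed
  then show ?case by (simp only: step[OF Suc.prems])
qed

lemma echain_hit_indep:
  assumes \<delta>: "0 \<le> \<delta>" and B: "B \<in> sets borel" "B \<subseteq> {0..}"
  shows "prob (chain_at \<delta> z k j \<inter> hit_is \<delta> k B b)
     = prob (chain_at \<delta> z k j) * prob (hit_is \<delta> k B b)"
proof -
  have "futures \<delta> k (k + 1) (\<lambda>_. B) (\<lambda>_. b) = hit_is \<delta> k B b" by (auto simp: futures_def)
  then show ?thesis using echain_futures_indep[OF \<delta>, of "\<lambda>_. B" z k j 1 "\<lambda>_. b"] B by simp
qed

end

section \<open>Consistency of the Euler chain and exceptional events\<close>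

text \<open>The probability that the chain does not jump from height \<open>\<delta> j\<close> within one time step.\<close>

definition pstep :: "real \<Rightarrow> int \<Rightarrow> real" where
  "pstep \<delta> j = exp (- (\<delta> * max (\<delta> * j) 0))"

definition qstep :: "real \<Rightarrow> (int \<Rightarrow> real) \<Rightarrow> int \<Rightarrow> real" where
  "qstep \<delta> g j = pstep \<delta> j * g (j + 1) + (1 - pstep \<delta> j) * g (- j)"

text \<open>The error of one step is \<open>o(1/n)\<close> uniformly over bounded heights: for \<open>j \<ge> 0\<close> this is \<open>cmean_one_step\<close> with the
uniform continuity of \<open>mean0\<close>; for \<open>j < 0\<close> the step is exact.\<close>

lemma euler_consistency:
  fixes t X \<epsilon> :: real
  assumes t: "0 < t" and X: "0 \<le> X" and \<epsilon>: "0 < \<epsilon>"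
  obtains n0 :: nat where "0 < n0" "\<And>n k j. n0 \<le> n \<Longrightarrow> k < n \<Longrightarrow> \<bar>t / n * real_of_int j\<bar> \<le> X \<Longrightarrow>
     \<bar>qstep (t / n) (\<lambda>i. cmean (t - real (Suc k) * (t / n)) (t / n * i)) j - cmean (t - k * (t / n)) (t / n * j)\<bar> \<le> \<epsilon> / n"
proof -
  obtain B where B: "0 \<le> B" "\<And>s x. 0 \<le> s \<Longrightarrow> s \<le> t \<Longrightarrow> \<bar>cmean s x\<bar> \<le> B + \<bar>x\<bar>"
    using cmean_bound[of t] by blast
  define C where "C = B + X + t"
  define D where "D = t * X + t * t + 1"
  \<comment> \<open>With this modulus of continuity the second term of the one-step error is at most \<open>\<epsilon> / (2 n)\<close>.\<close>
  define w where "w = \<epsilon> / (2 * D)"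
  have den: "0 < D" using t X by (simp add: D_def add_nonneg_pos)
  have w: "0 < w" using \<epsilon> den by (simp add: w_def)
  define K where "K = {- (3 * t + X)..3 * t + X}"
  have "uniformly_continuous_on K mean0"
    unfolding K_def by (intro compact_uniformly_continuous continuous_on_subset[OF continuous_mean0]) auto
  then obtain d0 where d0: "0 < d0" "\<And>u v. u \<in> K \<Longrightarrow> v \<in> K \<Longrightarrow> \<bar>u - v\<bar> < d0 \<Longrightarrow> \<bar>mean0 u - mean0 v\<bar> < w"
    using w unfolding uniformly_continuous_on_def dist_real_def by (metis abs_minus_commute)
  define n0 where "n0 = Suc (nat \<lceil>max (t / d0) (2 * t\<^sup>2 * C / \<epsilon>)\<rceil>)"
  show ?thesis
  proof (rule that[of n0])
    show "0 < n0" by (simp add: n0_def)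
    fix n k :: nat and j :: int
    assume n: "n0 \<le> n" and k: "k < n" and jX: "\<bar>t / n * real_of_int j\<bar> \<le> X"
    have n1: "1 \<le> real n" using n by (simp add: n0_def)
    have nmax: "max (t / d0) (2 * t\<^sup>2 * C / \<epsilon>) < real n"
    proof -
      have "max (t / d0) (2 * t\<^sup>2 * C / \<epsilon>) \<le> real (nat \<lceil>max (t / d0) (2 * t\<^sup>2 * C / \<epsilon>)\<rceil>)" by (rule real_nat_ceiling_ge)
      also have "\<dots> < real n" using n unfolding n0_def by linarith
      finally show ?thesis .
    qed
    define d where "d = t / n"
    have d: "0 < d" "d \<le> t" "d < d0" 
    proof -
      show "0 < d" using t n1 by (simp add: d_def)
      show "d \<le> t" using t n1 by (simp add: d_def divide_le_eq mult_le_cancel_left1)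
      have "t / d0 < real n" using nmax by simp
      then show "d < d0" using n1 d0(1) by (simp add: d_def field_simps)
    qed
    define \<tau> where "\<tau> = t - real k * d"
    have \<tau>: "d \<le> \<tau>" "\<tau> \<le> t"
    proof -
      have "real (Suc k) * d \<le> real n * d" using k d by (intro mult_right_mono) auto
      also have "\<dots> = t" using n1 by (simp add: d_def)
      finally show "d \<le> \<tau>" by (simp add: \<tau>_def algebra_simps)
      show "\<tau> \<le> t" using d by (simp add: \<tau>_def)
    qed
    have \<tau>': "t - real (Suc k) * d = \<tau> - d" by (simp add: \<tau>_def algebra_simps)
    define x where "x = d * real_of_int j"
    have xX: "\<bar>x\<bar> \<le> X" using jX by (simp add: x_def d_def)
    have x1: "d * real_of_int (j + 1) = x + d" "d * real_of_int (- j) = - x" by (simp_all add: x_def algebra_simps)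
    have goal: "\<bar>qstep d (\<lambda>i. cmean (\<tau> - d) (d * i)) j - cmean \<tau> x\<bar> \<le> \<epsilon> / n"
    proof (cases "0 \<le> j")
      case True
      have x0: "0 \<le> x" using True d by (simp add: x_def)
      have p: "pstep d j = exp (- (d * x))" using x0 by (simp add: pstep_def x_def[symmetric])
      have "\<bar>cmean \<tau> x - (exp (- (d * x)) * cmean (\<tau> - d) (x + d) + (1 - exp (- (d * x))) * mean0 (\<tau> - d - x))\<bar>
          \<le> d\<^sup>2 * C + w * (d * x + d\<^sup>2)"
      proof (rule cmean_one_step)
        fix u assume u: "\<bar>u - (\<tau> - d - x)\<bar> \<le> d"
        have "u \<in> K" "\<tau> - d - x \<in> K" using u x0 xX \<tau> d t by (auto simp: K_def)
        then show "\<bar>mean0 u - mean0 (\<tau> - d - x)\<bar> \<le> w" using d0(2)[of u "\<tau> - d - x"] u d by auto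
      next
        show "\<bar>cmean (\<tau> - d) (x + d)\<bar> \<le> C" using B(2)[of "\<tau> - d" "x + d"] \<tau> d x0 xX by (simp add: C_def)
        have "cmean (\<tau> - d) (- x) = mean0 (\<tau> - d - x)" using x0 by (simp add: cmean_def)
        then show "\<bar>mean0 (\<tau> - d - x)\<bar> \<le> C" using B(2)[of "\<tau> - d" "- x"] \<tau> d x0 xX t by (simp add: C_def)
      qed (use x0 d \<tau> in auto)
      moreover have "qstep d (\<lambda>i. cmean (\<tau> - d) (d * i)) j
         = exp (- (d * x)) * cmean (\<tau> - d) (x + d) + (1 - exp (- (d * x))) * mean0 (\<tau> - d - x)"
        unfolding qstep_def p x1 using x0 by (simp add: cmean_def)
      moreover have "d\<^sup>2 * C + w * (d * x + d\<^sup>2) \<le> \<epsilon> / n"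
      proof -
        have C0: "0 \<le> C" using B(1) X t by (simp add: C_def)
        have 1: "d\<^sup>2 * C \<le> (\<epsilon> / 2) / n"
        proof -
          have "2 * t\<^sup>2 * C / \<epsilon> < real n" using nmax by simp
          then have "t\<^sup>2 * C \<le> \<epsilon> / 2 * n" using \<epsilon> by (simp add: field_simps)
          then have "t\<^sup>2 * C / (n * n) \<le> (\<epsilon> / 2 * n) / (n * n)" by (rule divide_right_mono) simp
          then show ?thesis using n1 by (simp add: d_def power2_eq_square)
        qed
        have "d * x + d\<^sup>2 \<le> d * X + d * t" using xX d x0 unfolding power2_eq_square by (intro add_mono mult_left_mono) auto
        also have "\<dots> \<le> D / n" using n1 by (simp add: D_def d_def field_simps)
        finally have "w * (d * x + d\<^sup>2) \<le> w * (D / n)" using w by (intro mult_left_mono) auto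
        also have "\<dots> = (\<epsilon> / 2) / n" using den by (simp add: w_def)
        finally show ?thesis using 1 by simp
      qed
      ultimately show ?thesis by (simp add: abs_minus_commute)
    next
      case False
      then have "real_of_int j \<le> - 1" by linarith
      then have xd: "x \<le> - d" using d mult_left_mono[of "real_of_int j" "-1" d] by (simp add: x_def)
      then have "pstep d j = 1" using d by (simp add: pstep_def x_def[symmetric] max_def)
      then have "qstep d (\<lambda>i. cmean (\<tau> - d) (d * i)) j = cmean (\<tau> - d) (x + d)" unfolding qstep_def x1 by simp
      also have "\<dots> = cmean \<tau> x" using xd d by (simp add: cmean_def)
      finally show ?thesis using \<epsilon> by simp
    qed
    show "\<bar>qstep (t / n) (\<lambda>i. cmean (t - real (Suc k) * (t / n)) (t / n * i)) j - cmean (t - k * (t / n)) (t / n * j)\<bar> \<le> \<epsilon> / n"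
      using goal unfolding x_def \<tau>'[symmetric] unfolding \<tau>_def d_def .
  qed
qed

context prm_space begin

lemma echain_hit_prob:
  assumes \<delta>: "0 \<le> \<delta>"
  shows "prob (hit_is \<delta> k {0..<\<delta> * real_of_int j} False) = pstep \<delta> j"
    and "prob (hit_is \<delta> k {0..<\<delta> * real_of_int j} True) = 1 - pstep \<delta> j"
proof -
  let ?B = "{0..<\<delta> * real_of_int j}"
  have s: "strip \<delta> k \<times> ?B \<in> sets quadrant_lborel" by (intro strip_rect_sets \<delta>) auto
  have "emeasure quadrant_lborel (strip \<delta> k \<times> ?B) = ennreal (real (Suc k) * \<delta> - real k * \<delta>) * emeasure lborel ?B"
    unfolding strip_def using \<delta> by (intro emeasure_quadrant_rect) (auto intro: mult_right_mono)
  also have "emeasure lborel ?B = ennreal (max (\<delta> * j) 0)" by (auto simp: max_def)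
  also have "ennreal (real (Suc k) * \<delta> - real k * \<delta>) * ennreal (max (\<delta> * j) 0) = ennreal (\<delta> * max (\<delta> * j) 0)"
    using \<delta> by (simp add: ennreal_mult'' algebra_simps)
  finally have m: "emeasure quadrant_lborel (strip \<delta> k \<times> ?B) = ennreal (\<delta> * max (\<delta> * j) 0)" .
  have "hit_is \<delta> k ?B False = {\<omega> \<in> space M. emeasure (N \<omega>) (strip \<delta> k \<times> ?B) = 0}"
    by (auto simp: hit_def)
  then show 1: "prob (hit_is \<delta> k ?B False) = pstep \<delta> j"
    using N_void[OF s m] \<delta> by (simp add: pstep_def)
  have [measurable]: "{\<omega> \<in> space M. hit \<delta> k ?B \<omega>} \<in> events" using \<delta> by (intro hit_sets N_measurable) auto
  have "hit_is \<delta> k ?B True = space M - hit_is \<delta> k ?B False" by auto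
  moreover have "hit_is \<delta> k ?B False = space M - {\<omega> \<in> space M. hit \<delta> k ?B \<omega>}" by auto
  then have "hit_is \<delta> k ?B False \<in> events" by (simp only:) measurable
  ultimately show "prob (hit_is \<delta> k ?B True) = 1 - pstep \<delta> j"
    using 1 prob_compl by metis
qed

lemma echain_in_range: "echain \<delta> z k \<omega> \<in> chain_range z k"
  using echain_bound[of \<delta> z k \<omega>] by auto

lemma echain_expectation:
  assumes \<delta>: "0 \<le> \<delta>"
  shows "expectation (\<lambda>\<omega>. g (echain \<delta> z k \<omega>)) =
    (\<Sum>j\<in>chain_range z k. prob (chain_at \<delta> z k j) * g j)" (is "_ = (\<Sum>j\<in>?S. prob (?A j) * g j)")
proof -
  have A: "?A j \<in> events" for j by (intro echain_sets \<delta> N_measurable)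
  have "expectation (\<lambda>\<omega>. g (echain \<delta> z k \<omega>)) = expectation (\<lambda>\<omega>. \<Sum>j\<in>?S. indicator (?A j) \<omega> * g j)"
  proof (rule Bochner_Integration.integral_cong[OF refl])
    fix \<omega> assume w: "\<omega> \<in> space M"
    have "(\<Sum>j\<in>?S. indicator (?A j) \<omega> * g j) = (\<Sum>j\<in>?S. if echain \<delta> z k \<omega> = j then g j else 0)"
      using w by (intro sum.cong refl) (auto simp: indicator_def)
    also have "\<dots> = g (echain \<delta> z k \<omega>)" using echain_in_range[of \<delta> z k \<omega>] by simp
    finally show "g (echain \<delta> z k \<omega>) = (\<Sum>j\<in>?S. indicator (?A j) \<omega> * g j)" by simp
  qed
  also have "\<dots> = (\<Sum>j\<in>?S. prob (?A j) * g j)"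
    using A by (subst Bochner_Integration.integral_sum) (auto intro!: sum.cong simp: emeasure_eq_measure)
  finally show ?thesis .
qed

lemma echain_prob_sum:
  assumes "0 \<le> \<delta>"
  shows "(\<Sum>j\<in>chain_range z k. prob (chain_at \<delta> z k j)) = 1"
  using echain_expectation[OF assms, of "\<lambda>_. 1" z k] by (simp add: prob_space)

lemma echain_expectation_step:
  assumes \<delta>: "0 \<le> \<delta>"
  shows "expectation (\<lambda>\<omega>. g (echain \<delta> z (Suc k) \<omega>)) =
    (\<Sum>j\<in>chain_range z k. prob (chain_at \<delta> z k j) * qstep \<delta> g j)"
    (is "_ = (\<Sum>j\<in>?S. prob (?A j) * _)")
proof -
  define H where "H j b = hit_is \<delta> k {0..<\<delta> * real_of_int j} b" for j b
  have A: "?A j \<in> events" for j by (intro echain_sets \<delta> N_measurable)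
  have h: "{\<omega> \<in> space M. hit \<delta> k {0..<\<delta> * real_of_int j} \<omega>} \<in> events" for j using \<delta> by (intro hit_sets N_measurable) auto
  have H: "H j b \<in> events" for j b
  proof -
    have "H j True = {\<omega> \<in> space M. hit \<delta> k {0..<\<delta> * real_of_int j} \<omega>}"
      "H j False = space M - {\<omega> \<in> space M. hit \<delta> k {0..<\<delta> * real_of_int j} \<omega>}" by (auto simp: H_def)
    then show ?thesis using h[of j] by (cases b) auto
  qed
  have AH: "prob (?A j \<inter> H j b) = prob (?A j) * prob (H j b)" for j b
    unfolding H_def using \<delta> by (intro echain_hit_indep) auto
  have "expectation (\<lambda>\<omega>. g (echain \<delta> z (Suc k) \<omega>))
     = expectation (\<lambda>\<omega>. \<Sum>j\<in>?S. indicator (?A j \<inter> H j False) \<omega> * g (j + 1) + indicator (?A j \<inter> H j True) \<omega> * g (- j))"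
  proof (rule Bochner_Integration.integral_cong[OF refl])
    fix \<omega> assume w: "\<omega> \<in> space M"
    have "(\<Sum>j\<in>?S. indicator (?A j \<inter> H j False) \<omega> * g (j + 1) + indicator (?A j \<inter> H j True) \<omega> * g (- j))
       = (\<Sum>j\<in>?S. if echain \<delta> z k \<omega> = j then g (echain \<delta> z (Suc k) \<omega>) else 0)"
      using w by (intro sum.cong refl) (auto simp: indicator_def H_def)
    also have "\<dots> = g (echain \<delta> z (Suc k) \<omega>)" using echain_in_range[of \<delta> z k \<omega>] by simp
    finally show "g (echain \<delta> z (Suc k) \<omega>) = (\<Sum>j\<in>?S. indicator (?A j \<inter> H j False) \<omega> * g (j + 1) + indicator (?A j \<inter> H j True) \<omega> * g (- j))"
      by simp
  qed
  also have "\<dots> = (\<Sum>j\<in>?S. prob (?A j \<inter> H j False) * g (j + 1) + prob (?A j \<inter> H j True) * g (- j))"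
    using A H by (subst Bochner_Integration.integral_sum) (auto intro!: sum.cong simp: emeasure_eq_measure)
  also have "\<dots> = (\<Sum>j\<in>?S. prob (?A j) * qstep \<delta> g j)"
    unfolding AH unfolding H_def echain_hit_prob[OF \<delta>] qstep_def by (intro sum.cong refl) (simp add: algebra_simps)
  finally show ?thesis .
qed

text \<open>The function \<open>V\<close> solves the backward equation of the chain up to \<open>e\<close> in each step; the errors telescope.\<close>

lemma echain_weak_error:
  assumes \<delta>: "0 \<le> \<delta>"
    and step: "\<And>k j. k < n \<Longrightarrow> \<bar>j\<bar> \<le> \<bar>z\<bar> + int k \<Longrightarrow> \<bar>qstep \<delta> (V (Suc k)) j - V k j\<bar> \<le> e"
  shows "\<bar>expectation (\<lambda>\<omega>. V n (echain \<delta> z n \<omega>)) - V 0 z\<bar> \<le> real n * e"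
proof -
  have "\<bar>expectation (\<lambda>\<omega>. V m (echain \<delta> z m \<omega>)) - V 0 z\<bar> \<le> real m * e" if "m \<le> n" for m
    using that
  proof (induction m)
    case 0
    then show ?case by (simp add: prob_space)
  next
    case (Suc m)
    let ?S = "chain_range z m"
    let ?p = "\<lambda>j. prob (chain_at \<delta> z m j)"
    have "\<bar>expectation (\<lambda>\<omega>. V (Suc m) (echain \<delta> z (Suc m) \<omega>)) - expectation (\<lambda>\<omega>. V m (echain \<delta> z m \<omega>))\<bar>
       = \<bar>\<Sum>j\<in>?S. ?p j * (qstep \<delta> (V (Suc m)) j - V m j)\<bar>"
      unfolding echain_expectation_step[OF \<delta>] echain_expectation[OF \<delta>] by (simp add: sum_subtractf right_diff_distrib)
    also have "\<dots> \<le> (\<Sum>j\<in>?S. \<bar>?p j * (qstep \<delta> (V (Suc m)) j - V m j)\<bar>)" by (rule sum_abs)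
    also have "\<dots> \<le> (\<Sum>j\<in>?S. ?p j * e)"
    proof (rule sum_mono)
      fix j assume "j \<in> ?S"
      then have "\<bar>j\<bar> \<le> \<bar>z\<bar> + int m" by auto
      with step[of m j] Suc.prems show "\<bar>?p j * (qstep \<delta> (V (Suc m)) j - V m j)\<bar> \<le> ?p j * e"
        by (simp add: abs_mult mult_left_mono)
    qed
    also have "\<dots> = e" using echain_prob_sum[OF \<delta>, of z m] by (simp flip: sum_distrib_right)
    finally show ?case using Suc by (simp add: algebra_simps)
  qed
  then show ?thesis by blast
qed

text \<open>The event on which the chain from \<open>z\<close> may lose the path: two points in one strip, more than \<open>L\<close> points in total,
or a point within \<open>\<delta> (L + 2)\<close> of the current height \<open>\<delta> j\<close> of the chain. The range of \<open>j\<close> contains all values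
that the chain can take at time \<open>k\<close>.\<close>

definition bad_from :: "real \<Rightarrow> nat \<Rightarrow> real \<Rightarrow> nat \<Rightarrow> int \<Rightarrow> 'a set" where
  "bad_from \<delta> n R L z = (\<Union>k<n. {\<omega> \<in> space M. \<not> emeasure (N \<omega>) (strip \<delta> k \<times> {0..R}) \<le> 1})
     \<union> {\<omega> \<in> space M. \<not> emeasure (N \<omega>) ({0<..real n * \<delta>} \<times> {0..R}) \<le> of_nat L}
     \<union> (\<Union>k<n. \<Union>j\<in>chain_range z k. chain_at \<delta> z k j \<inter>
          {\<omega> \<in> space M. hit \<delta> k ({\<delta> * j - \<delta> * (L + 2)..\<delta> * j + \<delta> * (L + 2)} \<inter> {0..}) \<omega>})"

lemma bad_from_sets:
  assumes \<delta>: "0 \<le> \<delta>" and sp: "space F = space M"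
    and F: "\<And>A. A \<in> sets quadrant_lborel \<Longrightarrow> (\<lambda>\<omega>. emeasure (N \<omega>) A) \<in> borel_measurable F"
  shows "bad_from \<delta> n R L z \<in> sets F"
proof -
  have [measurable]: "(\<lambda>\<omega>. emeasure (N \<omega>) (strip \<delta> k \<times> {0..R})) \<in> borel_measurable F"
    "(\<lambda>\<omega>. emeasure (N \<omega>) ({0<..real n * \<delta>} \<times> {0..R})) \<in> borel_measurable F" for k
    by (auto intro!: F strip_rect_sets \<delta> quad_sets)
  have [measurable]: "{\<omega> \<in> space F. echain \<delta> z k \<omega> = j} \<in> sets F" for k j by (intro echain_sets \<delta> F)
  have [measurable]: "{\<omega> \<in> space F. hit \<delta> k ({a..b} \<inter> {0..}) \<omega>} \<in> sets F" for k a b by (intro hit_sets \<delta> F) auto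
  show ?thesis unfolding bad_from_def sp[symmetric] by measurable
qed

text \<open>With \<open>n \<delta> = t\<close> fixed, the first and the last term are of order \<open>1/n\<close>, and the middle one is small for large
\<open>L\<close> uniformly in \<open>n\<close>. The last term uses that the height of the chain is independent of the current strip.\<close>

lemma bad_from_prob:
  assumes \<delta>: "0 \<le> \<delta>" and R: "0 \<le> R"
  shows "prob (bad_from \<delta> n R L z) \<le> real n * (\<delta> * R)\<^sup>2
      + prob {\<omega> \<in> space M. \<not> emeasure (N \<omega>) ({0<..real n * \<delta>} \<times> {0..R}) \<le> of_nat L}
      + real n * (2 * \<delta>\<^sup>2 * (real L + 2))"
proof -
  have [measurable]: "(\<lambda>\<omega>. emeasure (N \<omega>) (strip \<delta> k \<times> {0..R})) \<in> borel_measurable M"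
    "(\<lambda>\<omega>. emeasure (N \<omega>) ({0<..real n * \<delta>} \<times> {0..R})) \<in> borel_measurable M" for k
    by (auto intro!: N_measurable strip_rect_sets \<delta> quad_sets)
  have [measurable]: "chain_at \<delta> z k j \<in> sets M" for k j by (intro echain_sets \<delta> N_measurable)
  have [measurable]: "{\<omega> \<in> space M. hit \<delta> k ({a..b} \<inter> {0..}) \<omega>} \<in> sets M" for k a b by (intro hit_sets \<delta> N_measurable) auto
  have rect: "emeasure quadrant_lborel (strip \<delta> k \<times> B) = ennreal \<delta> * emeasure lborel B" if "B \<in> sets borel" "B \<subseteq> {0..}" for B k
    using emeasure_quadrant_rect[of "real k * \<delta>" "real (Suc k) * \<delta>" B] \<delta> that
    by (simp add: strip_def algebra_simps)
  have 1: "prob (\<Union>k<n. {\<omega> \<in> space M. \<not> emeasure (N \<omega>) (strip \<delta> k \<times> {0..R}) \<le> 1}) \<le> real n * (\<delta> * R)\<^sup>2"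
  proof -
    have "prob (\<Union>k<n. {\<omega> \<in> space M. \<not> emeasure (N \<omega>) (strip \<delta> k \<times> {0..R}) \<le> 1})
        \<le> (\<Sum>k<n. prob {\<omega> \<in> space M. \<not> emeasure (N \<omega>) (strip \<delta> k \<times> {0..R}) \<le> 1})"
      by (intro finite_measure_subadditive_finite) auto
    also have "\<dots> \<le> (\<Sum>k<n. (\<delta> * R)\<^sup>2)"
    proof (intro sum_mono N_two_points_le)
      show "emeasure quadrant_lborel (strip \<delta> k \<times> {0..R}) = ennreal (\<delta> * R)" for k
        using rect[of "{0..R}" k] R \<delta> by (simp add: ennreal_mult')
    qed (use R \<delta> in \<open>auto intro!: strip_rect_sets\<close>)
    finally show ?thesis by simp
  qed
  define W where "W j = {\<delta> * real_of_int j - \<delta> * real (L + 2)..\<delta> * real_of_int j + \<delta> * real (L + 2)} \<inter> {0..}" for j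
  have hW: "prob {\<omega> \<in> space M. hit \<delta> k (W j) \<omega>} \<le> 2 * \<delta>\<^sup>2 * (real L + 2)" for k j
  proof -
    let ?I = "{\<delta> * real_of_int j - \<delta> * real (L + 2)..\<delta> * real_of_int j + \<delta> * real (L + 2)}"
    have "emeasure lborel (W j) \<le> emeasure lborel ?I" by (intro emeasure_mono) (auto simp: W_def)
    also have "\<dots> = ennreal (2 * \<delta> * (real L + 2))" using \<delta> by (simp add: algebra_simps)
    finally have le: "emeasure lborel (W j) \<le> ennreal (2 * \<delta> * (real L + 2))" .
    then have fin: "emeasure lborel (W j) = ennreal (measure lborel (W j))"
      by (intro emeasure_eq_ennreal_measure) (auto simp: top_unique)
    have m: "measure lborel (W j) \<le> 2 * \<delta> * (real L + 2)" using le \<delta> unfolding fin by simp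
    have "prob {\<omega> \<in> space M. hit \<delta> k (W j) \<omega>} \<le> \<delta> * measure lborel (W j)"
      unfolding hit_def
    proof (rule N_nonvoid_le)
      show "emeasure quadrant_lborel (strip \<delta> k \<times> W j) = ennreal (\<delta> * measure lborel (W j))"
        using rect[of "W j" k] \<delta> fin by (simp add: W_def ennreal_mult')
    qed (use \<delta> in \<open>auto intro!: strip_rect_sets simp: W_def\<close>)
    also have "\<dots> \<le> \<delta> * (2 * \<delta> * (real L + 2))" using m \<delta> by (intro mult_left_mono) auto
    finally show ?thesis by (simp add: power2_eq_square algebra_simps)
  qed
  have [measurable]: "{\<omega> \<in> space M. hit \<delta> k (W j) \<omega>} \<in> sets M" for k j unfolding W_def by measurable
  let ?S = "\<lambda>k. chain_range z k"
  let ?E = "\<lambda>k j. chain_at \<delta> z k j \<inter> {\<omega> \<in> space M. hit \<delta> k (W j) \<omega>}"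
  have 3: "prob (\<Union>k<n. \<Union>j\<in>?S k. ?E k j) \<le> real n * (2 * \<delta>\<^sup>2 * (real L + 2))"
  proof -
    have "prob (\<Union>k<n. \<Union>j\<in>?S k. ?E k j) \<le> (\<Sum>k<n. prob (\<Union>j\<in>?S k. ?E k j))"
      by (intro finite_measure_subadditive_finite) auto
    also have "\<dots> \<le> (\<Sum>k<n. \<Sum>j\<in>?S k. prob (?E k j))"
      by (intro sum_mono finite_measure_subadditive_finite) auto
    also have "\<dots> \<le> (\<Sum>k<n. \<Sum>j\<in>?S k. prob (chain_at \<delta> z k j) * (2 * \<delta>\<^sup>2 * (real L + 2)))"
    proof (intro sum_mono)
      fix k j
      have "prob (?E k j) = prob (chain_at \<delta> z k j) * prob {\<omega> \<in> space M. hit \<delta> k (W j) \<omega>}"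
        using echain_hit_indep[OF \<delta>, of "W j" z k j True] by (simp add: W_def)
      also have "\<dots> \<le> prob (chain_at \<delta> z k j) * (2 * \<delta>\<^sup>2 * (real L + 2))"
        by (intro mult_left_mono hW) auto
      finally show "prob (?E k j) \<le> prob (chain_at \<delta> z k j) * (2 * \<delta>\<^sup>2 * (real L + 2))" .
    qed
    also have "\<dots> = real n * (2 * \<delta>\<^sup>2 * (real L + 2))"
      by (simp only: sum_distrib_right[symmetric] echain_prob_sum[OF \<delta>]) simp
    finally show ?thesis .
  qed
  define A1 where "A1 = (\<Union>k<n. {\<omega> \<in> space M. \<not> emeasure (N \<omega>) (strip \<delta> k \<times> {0..R}) \<le> 1})"
  define A2 where "A2 = {\<omega> \<in> space M. \<not> emeasure (N \<omega>) ({0<..real n * \<delta>} \<times> {0..R}) \<le> of_nat L}"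
  define A3 where "A3 = (\<Union>k<n. \<Union>j\<in>?S k. ?E k j)"
  have A: "A1 \<in> events" "A2 \<in> events" "A3 \<in> events"
  proof -
    show "A1 \<in> events" unfolding A1_def by (rule sets.finite_UN) auto
    show "A2 \<in> events" unfolding A2_def by measurable
    show "A3 \<in> events" unfolding A3_def by (rule sets.finite_UN) auto
  qed
  have "bad_from \<delta> n R L z = A1 \<union> A2 \<union> A3"
    by (simp only: bad_from_def W_def A1_def A2_def A3_def)
  then have "prob (bad_from \<delta> n R L z) \<le> prob A1 + prob A2 + prob A3"
    using measure_Un_le[of "A1 \<union> A2" M A3] measure_Un_le[of A1 M A2] A by auto
  then show ?thesis using 1 3 unfolding A1_def[symmetric] A2_def[symmetric] A3_def[symmetric] by linarith
qed

end

section \<open>Independence of the start and growth of the process\<close>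

locale telegraph = prm_space M N for M :: "'a measure" and N +
  fixes T :: "real \<Rightarrow> 'a \<Rightarrow> real"
  assumes sol: "telegraph_solution M N T"
    and normal: "distributed M lborel (T 0) std_normal_density"
    and indep: "indep_of_random_measure M quadrant_lborel (T 0) N"
begin

lemma T_measurable: "0 \<le> t \<Longrightarrow> T t \<in> borel_measurable M"
  using sol unfolding telegraph_solution_def by blast

lemma T0_measurable [measurable]: "T 0 \<in> borel_measurable M"
  by (rule T_measurable) simp

lemma path: "AE \<omega> in M. telegraph_path (N \<omega>) (\<lambda>s. T s \<omega>)"
proof -
  have "AE \<omega> in M. cadlag (\<lambda>t. T t \<omega>) \<and>
        (\<forall>t\<ge>0. set_integrable (N \<omega>) ({0<..t} \<times> {0..}) (jump_integrand (\<lambda>s. T s \<omega>)) \<and>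
               T t \<omega> = T 0 \<omega> + t
                 - 2 * (LINT p : {0<..t} \<times> {0..} | N \<omega>. jump_integrand (\<lambda>s. T s \<omega>) p))"
    using sol unfolding telegraph_solution_def by blast
  with AE_space show ?thesis
  proof eventually_elim
    fix \<omega> assume "\<omega> \<in> space M"
      and p: "cadlag (\<lambda>t. T t \<omega>) \<and>
        (\<forall>t\<ge>0. set_integrable (N \<omega>) ({0<..t} \<times> {0..}) (jump_integrand (\<lambda>s. T s \<omega>)) \<and>
               T t \<omega> = T 0 \<omega> + t
                 - 2 * (LINT p : {0<..t} \<times> {0..} | N \<omega>. jump_integrand (\<lambda>s. T s \<omega>) p))"
    then show "telegraph_path (N \<omega>) (\<lambda>s. T s \<omega>)"
      using prm N_integer unfolding poisson_random_measure_def
      by (intro telegraph_path.intro) blast+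
  qed
qed

text \<open>The sigma-algebra generated by the random measure, as it occurs in the independence assumption.\<close>

definition noise_algebra :: "'a measure" where
  "noise_algebra = vimage_algebra (space M) (\<lambda>\<omega>. \<lambda>A\<in>sets quadrant_lborel. emeasure (N \<omega>) A)
                (Pi\<^sub>M (sets quadrant_lborel) (\<lambda>_. borel))"

lemma space_noise_algebra: "space noise_algebra = space M" by (simp add: noise_algebra_def)

lemma N_measurable_noise_algebra:
  assumes A: "A \<in> sets quadrant_lborel" shows "(\<lambda>\<omega>. emeasure (N \<omega>) A) \<in> borel_measurable noise_algebra"
proof -
  have "(\<lambda>\<omega>. \<lambda>A\<in>sets quadrant_lborel. emeasure (N \<omega>) A) \<in> noise_algebra \<rightarrow>\<^sub>M Pi\<^sub>M (sets quadrant_lborel) (\<lambda>_. borel)"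
    unfolding noise_algebra_def by (rule measurable_vimage_algebra1) (auto simp: space_PiM)
  from measurable_compose[OF this measurable_component_singleton[OF A]] show ?thesis using A by simp
qed

lemma indep_T0_N: "indep_set (sets (vimage_algebra (space M) (T 0) borel)) (sets noise_algebra)"
  using indep unfolding indep_of_random_measure_def noise_algebra_def .

lemma indep_var_T0_N:
  assumes w: "w \<in> borel_measurable borel" and Y: "Y \<in> borel_measurable noise_algebra"
  shows "indep_var borel (\<lambda>\<omega>. w (T 0 \<omega>) :: real) borel (Y :: 'a \<Rightarrow> real)"
proof -
  let ?F0 = "vimage_algebra (space M) (T 0) borel"
  have T0: "T 0 \<in> borel_measurable ?F0" by (rule measurable_vimage_algebra1) auto
  have w0: "(\<lambda>\<omega>. w (T 0 \<omega>)) \<in> borel_measurable ?F0" by (rule measurable_compose[OF T0 w])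
  have s0: "sets ?F0 \<subseteq> events" "sets noise_algebra \<subseteq> events"
    using indep_setD_ev1[OF indep_T0_N] indep_setD_ev2[OF indep_T0_N] by auto
  have m1: "(\<lambda>\<omega>. w (T 0 \<omega>)) \<in> borel_measurable M" using w by measurable
  have m2: "Y \<in> borel_measurable M"
    using Y s0(2) unfolding measurable_def by (auto simp: space_noise_algebra)
  have sub1: "sigma_sets (space M) {(\<lambda>\<omega>. w (T 0 \<omega>)) -` A \<inter> space M |A. A \<in> sets borel} \<subseteq> sets ?F0"
    using sets.sigma_sets_subset[of "{(\<lambda>\<omega>. w (T 0 \<omega>)) -` A \<inter> space M |A. A \<in> sets borel}" ?F0] measurable_sets[OF w0]
    by (auto simp: space_vimage_algebra)
  have sub2: "sigma_sets (space M) {Y -` A \<inter> space M |A. A \<in> sets borel} \<subseteq> sets noise_algebra"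
    using sets.sigma_sets_subset[of "{Y -` A \<inter> space M |A. A \<in> sets borel}" noise_algebra] measurable_sets[OF Y]
    by (auto simp: space_noise_algebra)
  have "indep_set (sigma_sets (space M) {(\<lambda>\<omega>. w (T 0 \<omega>)) -` A \<inter> space M |A. A \<in> sets borel})
      (sigma_sets (space M) {Y -` A \<inter> space M |A. A \<in> sets borel})"
    using indep_T0_N unfolding indep_set_def
    by (rule indep_sets_mono_sets) (use sub1 sub2 in \<open>auto split: bool.split\<close>)
  then show ?thesis using m1 m2 unfolding indep_var_eq by auto
qed

lemma indep_event_T0_N:
  assumes "A \<in> sets borel" "G \<in> sets noise_algebra"
  shows "prob ({\<omega> \<in> space M. T 0 \<omega> \<in> A} \<inter> G) = prob {\<omega> \<in> space M. T 0 \<omega> \<in> A} * prob G"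
proof -
  have "T 0 -` A \<inter> space M \<in> sets (vimage_algebra (space M) (T 0) borel)"
    using assms by (intro in_vimage_algebra)
  moreover have "T 0 -` A \<inter> space M = {\<omega> \<in> space M. T 0 \<omega> \<in> A}" by auto
  ultimately show ?thesis using indep_setD[OF indep_T0_N _ assms(2)] by simp
qed

lemma T_near_echain:
  fixes n L :: nat
  assumes t: "0 < t" and n: "0 < n" and \<omega>: "\<omega> \<in> space M" and path: "telegraph_path (N \<omega>) (\<lambda>s. T s \<omega>)"
    and R: "\<bar>T 0 \<omega>\<bar> \<le> R" and good: "\<omega> \<notin> bad_from (t / n) n (R + t) L \<lfloor>T 0 \<omega> / (t / n)\<rfloor>"
  shows "\<bar>T t \<omega>\<bar> \<le> \<bar>T 0 \<omega>\<bar> + t"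
    and "\<bar>T t \<omega> - t / n * echain (t / n) \<lfloor>T 0 \<omega> / (t / n)\<rfloor> n \<omega>\<bar> \<le> t / n * (L + 1)"
proof -
  define \<delta> where "\<delta> = t / n"
  define z where "z = \<lfloor>T 0 \<omega> / \<delta>\<rfloor>"
  have \<delta>: "0 < \<delta>" "real n * \<delta> = t" using t n by (auto simp: \<delta>_def)
  have good': "\<omega> \<notin> bad_from \<delta> n (R + t) L z" using good by (simp add: \<delta>_def z_def)
  have "\<bar>T (real n * \<delta>) \<omega>\<bar> \<le> \<bar>T 0 \<omega>\<bar> + real n * \<delta> \<and> \<bar>T (real n * \<delta>) \<omega> - \<delta> * echain \<delta> z n \<omega>\<bar> \<le> \<delta> * (L + 1)"
  proof (rule telegraph_path.euler_coupling[OF path \<delta>(1), of "\<lambda>k. echain \<delta> z k \<omega>" n "R + t" L])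
    show "echain \<delta> z 0 \<omega> = \<lfloor>T 0 \<omega> / \<delta>\<rfloor>" by (simp add: z_def)
    show "echain \<delta> z (Suc k) \<omega> = (if emeasure (N \<omega>) (strip \<delta> k \<times> {0..<\<delta> * real_of_int (echain \<delta> z k \<omega>)}) \<noteq> 0
        then - echain \<delta> z k \<omega> else echain \<delta> z k \<omega> + 1)" for k
      by (simp add: hit_def)
    show "\<bar>T 0 \<omega>\<bar> + real n * \<delta> \<le> R + t" using R \<delta> by simp
    show "emeasure (N \<omega>) (strip \<delta> k \<times> {0..R + t}) \<le> 1" if "k < n" for k
      using good' \<omega> that unfolding bad_from_def by blast
    show "emeasure (N \<omega>) ({0<..real n * \<delta>} \<times> {0..R + t}) \<le> of_nat L"
      using good' \<omega> unfolding bad_from_def by blast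
    fix k assume k: "k < n"
    show "emeasure (N \<omega>) (strip \<delta> k \<times> ({\<delta> * real_of_int (echain \<delta> z k \<omega>) - \<delta> * real (L + 2)
           ..\<delta> * real_of_int (echain \<delta> z k \<omega>) + \<delta> * real (L + 2)} \<inter> {0..})) = 0"
      using good' \<omega> k echain_in_range[of \<delta> z k \<omega>] unfolding bad_from_def hit_def by blast
  qed
  then show "\<bar>T t \<omega>\<bar> \<le> \<bar>T 0 \<omega>\<bar> + t"
    "\<bar>T t \<omega> - t / n * echain (t / n) \<lfloor>T 0 \<omega> / (t / n)\<rfloor> n \<omega>\<bar> \<le> t / n * (L + 1)"
    unfolding \<delta>(2) by (auto simp: \<delta>_def z_def)
qed

text \<open>The event that the start lies in \<open>[-R, R]\<close> and rounds down to the lattice point \<open>\<delta> z\<close>.\<close>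

definition cell :: "real \<Rightarrow> real \<Rightarrow> int \<Rightarrow> 'a set" where
  "cell \<delta> R z = {\<omega> \<in> space M. T 0 \<omega> \<in> {x. \<lfloor>x / \<delta>\<rfloor> = z \<and> \<bar>x\<bar> \<le> R}}"

definition cells :: "real \<Rightarrow> real \<Rightarrow> int set" where
  "cells \<delta> R = {\<lfloor>- R / \<delta>\<rfloor>..\<lfloor>R / \<delta>\<rfloor>}"

lemma finite_cells: "finite (cells \<delta> R)" by (simp add: cells_def)

lemma cellsI: "0 < \<delta> \<Longrightarrow> \<bar>x\<bar> \<le> R \<Longrightarrow> \<lfloor>x / \<delta>\<rfloor> \<in> cells \<delta> R"
  using floor_mono[OF divide_right_mono[of "- R" x \<delta>]] floor_mono[OF divide_right_mono[of x R \<delta>]]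
  by (auto simp: cells_def)

lemma cell_borel: "{x :: real. \<lfloor>x / \<delta>\<rfloor> = z \<and> \<bar>x\<bar> \<le> R} \<in> sets borel"
  by measurable

lemma cell_events: "cell \<delta> R z \<in> events"
  unfolding cell_def using cell_borel[of \<delta> z R] by measurable

lemma cell_prob_sum: "(\<Sum>z\<in>cells \<delta> R. prob (cell \<delta> R z)) \<le> 1"
proof -
  have "(\<Sum>z\<in>cells \<delta> R. prob (cell \<delta> R z)) = prob (\<Union>z\<in>cells \<delta> R. cell \<delta> R z)"
    by (intro finite_measure_finite_Union[symmetric]) (auto simp: finite_cells cell_events disjoint_family_on_def cell_def)
  also have "\<dots> \<le> 1" by (rule prob_le_1)
  finally show ?thesis .
qed

definition bad_event :: "real \<Rightarrow> nat \<Rightarrow> nat \<Rightarrow> real \<Rightarrow> 'a set" where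
  "bad_event t n L R = (\<Union>z\<in>cells (t / n) R. cell (t / n) R z \<inter> bad_from (t / n) n (R + t) L z)"

lemma bad_event_events: "0 < t \<Longrightarrow> bad_event t n L R \<in> events"
  unfolding bad_event_def by (intro sets.finite_UN finite_cells sets.Int cell_events bad_from_sets N_measurable) auto

text \<open>On each cell the chain starts from a fixed lattice point, and the cell is independent of the random measure;
so the uniform bound of \<open>bad_from_prob\<close> carries over to the union of the cells.\<close>

lemma bad_event_small:
  assumes t: "0 < t" and R: "0 \<le> R" and e: "0 < e"
  obtains L n0 :: nat where "0 < n0" "\<And>n. n0 \<le> n \<Longrightarrow> prob (bad_event t n L R) \<le> e"
proof -
  have A: "{0<..t} \<times> {0..R + t} \<in> sets quadrant_lborel" by (intro quad_sets) auto
  have m: "emeasure quadrant_lborel ({0<..t} \<times> {0..R + t}) = ennreal (t * (R + t))"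
    using emeasure_quadrant_rect[of 0 t "{0..R + t}"] t R by (simp add: ennreal_mult')
  obtain L :: nat where L: "prob {\<omega> \<in> space M. \<not> emeasure (N \<omega>) ({0<..t} \<times> {0..R + t}) \<le> of_nat L} \<le> e / 2"
    using N_many_points[OF A m, of "e / 2"] e t R by auto
  define c where "c = t\<^sup>2 * (R + t)\<^sup>2 + 2 * t\<^sup>2 * (real L + 2)"
  define n0 where "n0 = Suc (nat \<lceil>2 * c / e\<rceil>)"
  show ?thesis
  proof (rule that[of n0 L])
    show "0 < n0" by (simp add: n0_def)
    fix n assume n: "n0 \<le> n"
    have n1: "0 < real n" using n by (simp add: n0_def)
    have "2 * c / e \<le> real (nat \<lceil>2 * c / e\<rceil>)" by (rule real_nat_ceiling_ge)
    also have "\<dots> \<le> real n" using n unfolding n0_def by linarith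
    finally have cn: "c / n \<le> e / 2" using e n1 by (simp add: field_simps)
    define \<delta> where "\<delta> = t / n"
    have \<delta>: "0 < \<delta>" "real n * \<delta> = t" using t n1 by (auto simp: \<delta>_def)
    have bz: "prob (bad_from \<delta> n (R + t) L z) \<le> e" for z
    proof -
      have "prob (bad_from \<delta> n (R + t) L z) \<le> real n * (\<delta> * (R + t))\<^sup>2 + e / 2 + real n * (2 * \<delta>\<^sup>2 * (real L + 2))"
        using bad_from_prob[of \<delta> "R + t" n L z] \<delta> L R t unfolding \<delta>(2) by simp
      also have "\<dots> = c / n + e / 2" using n1 by (simp add: c_def \<delta>_def power2_eq_square field_simps)
      finally show ?thesis using cn by linarith
    qed
    have "prob (bad_event t n L R) \<le> (\<Sum>z\<in>cells \<delta> R. prob (cell \<delta> R z \<inter> bad_from \<delta> n (R + t) L z))"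
      unfolding bad_event_def \<delta>_def[symmetric] using \<delta>
      by (intro finite_measure_subadditive_finite finite_cells image_subsetI sets.Int cell_events bad_from_sets N_measurable) auto
    also have "\<dots> = (\<Sum>z\<in>cells \<delta> R. prob (cell \<delta> R z) * prob (bad_from \<delta> n (R + t) L z))"
      unfolding cell_def using \<delta>
      by (intro sum.cong refl indep_event_T0_N cell_borel bad_from_sets space_noise_algebra N_measurable_noise_algebra) auto
    also have "\<dots> \<le> (\<Sum>z\<in>cells \<delta> R. prob (cell \<delta> R z) * e)"
      by (intro sum_mono mult_left_mono bz) auto
    also have "\<dots> = (\<Sum>z\<in>cells \<delta> R. prob (cell \<delta> R z)) * e" by (simp add: sum_distrib_right)
    also have "\<dots> \<le> 1 * e" using cell_prob_sum e by (intro mult_right_mono) auto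
    finally show "prob (bad_event t n L R) \<le> e" by simp
  qed
qed

lemma not_bad_event:
  assumes t: "0 < t" and n: "0 < n" and \<omega>: "\<omega> \<in> space M" and R: "\<bar>T 0 \<omega>\<bar> \<le> R" and nb: "\<omega> \<notin> bad_event t n L R"
  shows "\<omega> \<notin> bad_from (t / n) n (R + t) L \<lfloor>T 0 \<omega> / (t / n)\<rfloor>"
  using nb cellsI[of "t / n" "T 0 \<omega>" R] \<omega> R t n unfolding bad_event_def cell_def by auto

text \<open>Only a jump at which two points share their time could break this bound. The coupling shows that on
\<open>\<bar>T 0\<bar> \<le> R\<close> the bound fails inside an event of arbitrarily small probability only, for every \<open>R\<close>.\<close>

lemma T_growth:
  assumes t: "0 \<le> t" shows "AE \<omega> in M. \<bar>T t \<omega>\<bar> \<le> \<bar>T 0 \<omega>\<bar> + t"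
proof (cases "t = 0")
  case False
  then have t: "0 < t" using t by simp
  note [measurable] = T_measurable[OF less_imp_le[OF t]]
  have "AE \<omega> in M. \<not> (\<bar>T 0 \<omega>\<bar> \<le> real R \<and> \<not> \<bar>T t \<omega>\<bar> \<le> \<bar>T 0 \<omega>\<bar> + t)" for R :: nat
  proof -
    define E where "E = {\<omega> \<in> space M. \<bar>T 0 \<omega>\<bar> \<le> real R \<and> \<not> \<bar>T t \<omega>\<bar> \<le> \<bar>T 0 \<omega>\<bar> + t}"
    have E: "E \<in> events" unfolding E_def by measurable
    have "prob E \<le> 0 + e" if e: "0 < e" for e
    proof -
      obtain L n0 :: nat where n0: "0 < n0" "\<And>n. n0 \<le> n \<Longrightarrow> prob (bad_event t n L R) \<le> e"
        by (rule bad_event_small[OF t _ e, of "real R"]) auto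
      have "AE \<omega> in M. \<omega> \<in> E \<longrightarrow> \<omega> \<in> bad_event t n0 L R"
        using path
      proof eventually_elim
        fix \<omega> assume p: "telegraph_path (N \<omega>) (\<lambda>s. T s \<omega>)"
        show "\<omega> \<in> E \<longrightarrow> \<omega> \<in> bad_event t n0 L R"
        proof (intro impI, rule ccontr)
          assume "\<omega> \<in> E" "\<omega> \<notin> bad_event t n0 L R"
          then show False
            using T_near_echain(1)[OF t n0(1) _ p _ not_bad_event[OF t n0(1)]] by (auto simp: E_def)
        qed
      qed
      then have "prob E \<le> prob (bad_event t n0 L R)" by (intro finite_measure_mono_AE bad_event_events t)
      also have "\<dots> \<le> e" by (rule n0(2)) simp
      finally show ?thesis by simp
    qed
    then have "prob E \<le> 0" by (rule field_le_epsilon)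
    then have "prob E = 0" using measure_nonneg[of M E] by linarith
    then have "AE \<omega> in M. \<omega> \<notin> E" using prob_eq_0[OF E] by simp
    with AE_space show ?thesis by eventually_elim (auto simp: E_def)
  qed
  then have "AE \<omega> in M. \<forall>R::nat. \<not> (\<bar>T 0 \<omega>\<bar> \<le> real R \<and> \<not> \<bar>T t \<omega>\<bar> \<le> \<bar>T 0 \<omega>\<bar> + t)"
    unfolding AE_all_countable by blast
  then show ?thesis
  proof eventually_elim
    fix \<omega> assume a: "\<forall>R::nat. \<not> (\<bar>T 0 \<omega>\<bar> \<le> real R \<and> \<not> \<bar>T t \<omega>\<bar> \<le> \<bar>T 0 \<omega>\<bar> + t)"
    obtain R :: nat where "\<bar>T 0 \<omega>\<bar> \<le> real R" using real_arch_simple by blast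
    then show "\<bar>T t \<omega>\<bar> \<le> \<bar>T 0 \<omega>\<bar> + t" using a by blast
  qed
qed auto

end

section \<open>Identification of the covariance\<close>

lemma cmean_borel: "0 \<le> t \<Longrightarrow> cmean t \<in> borel_measurable borel"
proof -
  assume t: "0 \<le> t"
  have "(\<lambda>p. (t, fst p, snd p)) \<in> borel \<Otimes>\<^sub>M borel \<rightarrow>\<^sub>M (borel \<Otimes>\<^sub>M borel \<Otimes>\<^sub>M borel :: (real \<times> real \<times> real) measure)"
    by measurable
  from measurable_compose[OF this jump_cmean_measurable(1)]
  have [measurable]: "(\<lambda>p. jump_cmean t (fst p) (snd p)) \<in> borel_measurable (borel \<Otimes>\<^sub>M borel)" by (simp only: prod.case)
  have "(\<lambda>x. LINT r|lborel. jump_dens x r * jump_cmean t x r) \<in> borel_measurable borel"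
    by (rule lborel.borel_measurable_lebesgue_integral) (simp add: case_prod_unfold)
  moreover have "cmean t = (\<lambda>x. LINT r|lborel. jump_dens x r * jump_cmean t x r)"
    by (rule ext) (rule cmean_kernel[OF t])
  ultimately show ?thesis by (simp only:)
qed

lemma floor_grid_bounds:
  fixes d x :: real
  assumes d: "0 < d" shows "x - d \<le> d * \<lfloor>x / d\<rfloor>" "d * \<lfloor>x / d\<rfloor> \<le> x"
proof -
  have "x / d - 1 \<le> \<lfloor>x / d\<rfloor>" by linarith
  from mult_left_mono[OF this less_imp_le[OF d]] show "x - d \<le> d * \<lfloor>x / d\<rfloor>"
    using d by (simp add: right_diff_distrib)
  have "\<lfloor>x / d\<rfloor> \<le> x / d" by linarith
  from mult_left_mono[OF this less_imp_le[OF d]] show "d * \<lfloor>x / d\<rfloor> \<le> x" using d by simp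
qed

lemma floor_grid_tendsto:
  fixes t x :: real
  assumes t: "0 < t" shows "(\<lambda>n. t / real n * \<lfloor>x / (t / real n)\<rfloor>) \<longlonglongrightarrow> x"
proof (rule tendsto_sandwich)
  show "(\<lambda>n. x - t / real n) \<longlonglongrightarrow> x" "(\<lambda>n. x) \<longlonglongrightarrow> x" by real_asymp simp
  show "\<forall>\<^sub>F n in sequentially. x - t / real n \<le> t / real n * \<lfloor>x / (t / real n)\<rfloor>"
    using eventually_gt_at_top[of 0]
    by eventually_elim (intro floor_grid_bounds, use t in simp)
  show "\<forall>\<^sub>F n in sequentially. t / real n * \<lfloor>x / (t / real n)\<rfloor> \<le> x"
    using eventually_gt_at_top[of 0]
    by eventually_elim (intro floor_grid_bounds, use t in simp)
qed

context telegraph begin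

lemma echain_borel_noise_algebra: 
  assumes "0 \<le> \<delta>" shows "(\<lambda>\<omega>. real_of_int (echain \<delta> z n \<omega>)) \<in> borel_measurable noise_algebra"
proof -
  have "echain \<delta> z n \<in> noise_algebra \<rightarrow>\<^sub>M count_space UNIV"
  proof (subst measurable_count_space_eq2_countable, intro conjI ballI)
    fix j show "echain \<delta> z n -` {j} \<inter> space noise_algebra \<in> sets noise_algebra"
      using echain_sets[OF assms N_measurable_noise_algebra, of z n j] by (simp add: vimage_def Int_def conj_commute)
  qed auto
  then show ?thesis by (rule measurable_compose) simp
qed

text \<open>The chain from a lattice point \<open>z\<close> that meets \<open>[-R, R]\<close> stays within distance \<open>R + 2 t\<close> of the origin, where the
one-step estimate holds. At the final time the backward function is the identity (\<open>cmean_0\<close>).\<close>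

lemma conditional_mean_approx:
  fixes n :: nat
  assumes t: "0 < t" and n: "0 < n" and R: "0 \<le> R"
    and step: "\<And>k j. k < n \<Longrightarrow> \<bar>t / n * real_of_int j\<bar> \<le> R + 2 * t \<Longrightarrow>
     \<bar>qstep (t / n) (\<lambda>i. cmean (t - real (Suc k) * (t / n)) (t / n * i)) j - cmean (t - k * (t / n)) (t / n * j)\<bar> \<le> e / n"
    and z: "z \<in> cells (t / n) R"
  shows "\<bar>expectation (\<lambda>\<omega>. t / n * echain (t / n) z n \<omega>) - cmean t (t / n * z)\<bar> \<le> e"
    and "\<bar>t / n * real_of_int z\<bar> \<le> R + t / n"
proof -
  define \<delta> where "\<delta> = t / n"
  have \<delta>: "0 < \<delta>" "real n * \<delta> = t" using t n by (auto simp: \<delta>_def)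
  have zb: "\<bar>\<delta> * real_of_int z\<bar> \<le> R + \<delta>"
  proof -
    have z1: "\<lfloor>- R / \<delta>\<rfloor> \<le> z" "z \<le> \<lfloor>R / \<delta>\<rfloor>" using z by (auto simp: cells_def \<delta>_def)
    have "- R / \<delta> - 1 \<le> real_of_int z" using z1 by linarith
    from mult_left_mono[OF this less_imp_le[OF \<delta>(1)]] have 1: "- R - \<delta> \<le> \<delta> * real_of_int z"
      using \<delta> by (simp add: right_diff_distrib)
    have "real_of_int z \<le> R / \<delta>" using z1 by linarith
    from mult_left_mono[OF this less_imp_le[OF \<delta>(1)]] have 2: "\<delta> * real_of_int z \<le> R"
      using \<delta> by simp
    show ?thesis using 1 2 \<delta> R by linarith
  qed
  then show "\<bar>t / n * real_of_int z\<bar> \<le> R + t / n" by (simp add: \<delta>_def)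
  have \<delta>t: "\<delta> \<le> t" using n t by (simp add: \<delta>_def divide_le_eq mult_le_cancel_left1)
  define V where "V k j = cmean (t - real k * \<delta>) (\<delta> * real_of_int j)" for k :: nat and j :: int
  have "\<bar>expectation (\<lambda>\<omega>. V n (echain \<delta> z n \<omega>)) - V 0 z\<bar> \<le> real n * (e / n)"
  proof (rule echain_weak_error)
    fix k j assume k: "k < n" and j: "\<bar>j\<bar> \<le> \<bar>z\<bar> + int k"
    have "\<bar>\<delta> * real_of_int j\<bar> = \<delta> * \<bar>real_of_int j\<bar>" using \<delta> by (simp add: abs_mult)
    also have "\<dots> \<le> \<delta> * (\<bar>real_of_int z\<bar> + real n)"
    proof (rule mult_left_mono)
      have "\<bar>real_of_int j\<bar> \<le> \<bar>real_of_int z\<bar> + real k" using j by linarith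
      then show "\<bar>real_of_int j\<bar> \<le> \<bar>real_of_int z\<bar> + real n" using k by simp
    qed (use \<delta> in simp)
    also have "\<dots> = \<bar>\<delta> * real_of_int z\<bar> + t" using \<delta> by (simp add: abs_mult algebra_simps)
    also have "\<dots> \<le> R + 2 * t" using zb \<delta>t by simp
    finally have "\<bar>t / n * real_of_int j\<bar> \<le> R + 2 * t" by (simp add: \<delta>_def)
    from step[OF k this] show "\<bar>qstep \<delta> (V (Suc k)) j - V k j\<bar> \<le> e / n"
      unfolding V_def \<delta>_def by simp
  qed (use \<delta> in simp)
  then show "\<bar>expectation (\<lambda>\<omega>. t / n * echain (t / n) z n \<omega>) - cmean t (t / n * z)\<bar> \<le> e"
    using n \<delta> by (simp add: V_def cmean_0 \<delta>_def)
qed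

text \<open>The truncation keeps all heights bounded. Three errors add up: between \<open>T t\<close> and the chain (coupling),
between the mean of the chain and \<open>cmean\<close> at the lattice point (weak error, using the independence of the start),
and between \<open>cmean\<close> at the lattice point and at \<open>T 0\<close>. The last one tends to \<open>0\<close> by dominated convergence because
\<open>cmean\<close> is continuous off \<open>0\<close> and \<open>T 0 \<noteq> 0\<close> almost surely.\<close>

lemma truncated_mean:
  assumes t: "0 < t" and R: "0 \<le> R"
  defines "W \<equiv> \<lambda>\<omega>. T 0 \<omega> * indicator {- R..R} (T 0 \<omega>)"
  shows "expectation (\<lambda>\<omega>. W \<omega> * T t \<omega>) = expectation (\<lambda>\<omega>. W \<omega> * cmean t (T 0 \<omega>))"
proof -
  note [measurable] = T_measurable[OF less_imp_le[OF t]] cmean_borel[OF less_imp_le[OF t]]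
  have Wm [measurable]: "W \<in> borel_measurable M" unfolding W_def by measurable
  have WR: "\<bar>W \<omega>\<bar> \<le> R" for \<omega> unfolding W_def by (auto simp: indicator_def R)
  have W0: "W \<omega> = 0" if "\<not> \<bar>T 0 \<omega>\<bar> \<le> R" for \<omega> using that unfolding W_def by (auto simp: indicator_def)
  obtain B where B: "0 \<le> B" "\<And>s x. 0 \<le> s \<Longrightarrow> s \<le> t \<Longrightarrow> \<bar>cmean s x\<bar> \<le> B + \<bar>x\<bar>"
    using cmean_bound[of t] by blast
  define g where "g n \<omega> = t / real n * \<lfloor>T 0 \<omega> / (t / real n)\<rfloor>" for n \<omega>
  have gm [measurable]: "g n \<in> borel_measurable M" for n unfolding g_def by measurable
  have gb: "\<bar>g n \<omega>\<bar> \<le> R + t" if "0 < n" "\<bar>T 0 \<omega>\<bar> \<le> R" for n \<omega>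
  proof -
    have d: "0 < t / real n" "t / real n \<le> t" using t that by (auto simp: divide_le_eq mult_le_cancel_left1)
    show ?thesis using floor_grid_bounds[OF d(1), of "T 0 \<omega>"] that d unfolding g_def by linarith
  qed
  have lim: "(\<lambda>n. expectation (\<lambda>\<omega>. W \<omega> * cmean t (g (Suc n) \<omega>))) \<longlonglongrightarrow> expectation (\<lambda>\<omega>. W \<omega> * cmean t (T 0 \<omega>))"
  proof (rule integral_dominated_convergence)
    have "AE x in lborel. 0 < std_normal_density x \<longrightarrow> x \<noteq> 0"
      using AE_lborel_singleton[of "0::real"] by eventually_elim simp
    then have "AE \<omega> in M. T 0 \<omega> \<noteq> 0" using distributed_AE2[OF normal, of "\<lambda>x. x \<noteq> 0"] by simp
    then show "AE \<omega> in M. (\<lambda>n. W \<omega> * cmean t (g (Suc n) \<omega>)) \<longlonglongrightarrow> W \<omega> * cmean t (T 0 \<omega>)"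
    proof eventually_elim
      fix \<omega> assume x: "T 0 \<omega> \<noteq> 0"
      have "(\<lambda>n. g (Suc n) \<omega>) \<longlonglongrightarrow> T 0 \<omega>"
        unfolding g_def using floor_grid_tendsto[OF t] by (rule LIMSEQ_Suc)
      then show "(\<lambda>n. W \<omega> * cmean t (g (Suc n) \<omega>)) \<longlonglongrightarrow> W \<omega> * cmean t (T 0 \<omega>)"
        using t x by (intro tendsto_mult_left cmean_continuous) auto
    qed
    show "AE \<omega> in M. norm (W \<omega> * cmean t (g (Suc n) \<omega>)) \<le> R * (B + (R + t))" for n
    proof (rule AE_I2)
      fix \<omega>
      show "norm (W \<omega> * cmean t (g (Suc n) \<omega>)) \<le> R * (B + (R + t))"
      proof (cases "\<bar>T 0 \<omega>\<bar> \<le> R")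
        case True
        have "\<bar>cmean t (g (Suc n) \<omega>)\<bar> \<le> B + (R + t)"
          using B(2)[of t "g (Suc n) \<omega>"] gb[OF _ True, of "Suc n"] t by linarith
        then show ?thesis unfolding real_norm_def abs_mult using R by (intro mult_mono WR) auto
      qed (use W0 R B t in simp)
    qed
  qed simp_all
  have main: "\<exists>n0. \<forall>n\<ge>n0. \<bar>expectation (\<lambda>\<omega>. W \<omega> * T t \<omega>) - expectation (\<lambda>\<omega>. W \<omega> * cmean t (g (Suc n) \<omega>))\<bar> \<le> R * (2 * R + 3 * t + 2) * e"
    if e: "0 < e" for e
  proof -
    obtain L n1 :: nat where n1: "0 < n1" "\<And>n. n1 \<le> n \<Longrightarrow> prob (bad_event t n L R) \<le> e"
      using bad_event_small[OF t R e] by blast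
    have X: "0 \<le> R + 2 * t" using R t by simp
    obtain n2 :: nat where n2: "0 < n2" "\<And>n k j. n2 \<le> n \<Longrightarrow> k < n \<Longrightarrow> \<bar>t / n * real_of_int j\<bar> \<le> R + 2 * t \<Longrightarrow>
     \<bar>qstep (t / n) (\<lambda>i. cmean (t - real (Suc k) * (t / n)) (t / n * i)) j - cmean (t - k * (t / n)) (t / n * j)\<bar> \<le> e / n"
      using euler_consistency[OF t X e] by blast
    \<comment> \<open>The three bounds on \<open>n\<close> control the exceptional event, the weak error, and the coupling distance
      \<open>\<delta> (L + 1)\<close>, in this order.\<close>
    define n3 where "n3 = nat \<lceil>t * (L + 1) / e\<rceil>"
    show ?thesis
    proof (intro exI[of _ "n1 + n2 + n3"] allI impI)
      fix m :: nat assume m: "n1 + n2 + n3 \<le> m"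
      define n where "n = Suc m"
      have n: "0 < n" "n1 \<le> n" "n2 \<le> n" "n3 \<le> n" using m by (auto simp: n_def)
      define \<delta> where "\<delta> = t / n"
      have \<delta>: "0 < \<delta>" "real n * \<delta> = t" "\<delta> \<le> t" using t n by (auto simp: \<delta>_def divide_le_eq mult_le_cancel_left1)
      have \<delta>L: "\<delta> * (L + 1) \<le> e"
      proof -
        have "t * (L + 1) / e \<le> real n3" unfolding n3_def by (rule real_nat_ceiling_ge)
        also have "\<dots> \<le> real n" using n by simp
        finally have "t * (L + 1) \<le> real n * e" using e by (simp add: divide_le_eq)
        then show ?thesis using n by (simp add: \<delta>_def divide_le_eq mult.commute)
      qed
      \<comment> \<open>The weight \<open>W\<close> is split by cells, so that on each part the chain has a deterministic start.\<close>
      define w where "w z x = x * indicator {x. \<lfloor>x / \<delta>\<rfloor> = z \<and> \<bar>x\<bar> \<le> R} x" for z and x :: real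
      have wm [measurable]: "w z \<in> borel_measurable borel" for z unfolding w_def using cell_borel[of \<delta> z R] by measurable
      have wcell: "\<bar>w z (T 0 \<omega>)\<bar> \<le> R * indicator (cell \<delta> R z) \<omega>" if "\<omega> \<in> space M" for z \<omega>
        using that R by (auto simp: w_def cell_def indicator_def)
      have wsum: "(\<Sum>z\<in>cells \<delta> R. w z (T 0 \<omega>) * h z) = W \<omega> * h \<lfloor>T 0 \<omega> / \<delta>\<rfloor>" for \<omega> and h :: "int \<Rightarrow> real"
      proof -
        have "(\<Sum>z\<in>cells \<delta> R. w z (T 0 \<omega>) * h z) = (\<Sum>z\<in>cells \<delta> R. if \<lfloor>T 0 \<omega> / \<delta>\<rfloor> = z then W \<omega> * h z else 0)"
          by (intro sum.cong refl) (auto simp: w_def W_def indicator_def)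
        also have "\<dots> = W \<omega> * h \<lfloor>T 0 \<omega> / \<delta>\<rfloor>"
          using cellsI[OF \<delta>(1), of "T 0 \<omega>" R] W0[of \<omega>] finite_cells[of \<delta> R] by (auto simp: sum.delta)
        finally show ?thesis .
      qed
      define Y where "Y z \<omega> = \<delta> * echain \<delta> z n \<omega>" for z \<omega>
      have YF: "Y z \<in> borel_measurable noise_algebra" for z
        unfolding Y_def using echain_borel_noise_algebra[of \<delta>] \<delta> by (intro borel_measurable_times) auto
      have Yb: "\<bar>Y z \<omega>\<bar> \<le> R + 2 * t" if "z \<in> cells \<delta> R" for z \<omega>
      proof -
        have 1: "\<bar>\<delta> * real_of_int z\<bar> \<le> R + \<delta>"
          using conditional_mean_approx(2)[OF t n(1) R n2(2)[OF n(3)]] that unfolding \<delta>_def by blast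
        have "\<bar>Y z \<omega>\<bar> \<le> \<delta> * (\<bar>real_of_int z\<bar> + real n)"
          unfolding Y_def abs_mult using \<delta>(1) echain_bound[of \<delta> z n \<omega>] by (auto intro!: mult_left_mono)
        also have "\<dots> = \<bar>\<delta> * real_of_int z\<bar> + t"
          by (simp only: distrib_left mult.commute[of \<delta> "real n"] \<delta>(2) abs_mult abs_of_pos[OF \<delta>(1)])
        also have "\<dots> \<le> (R + \<delta>) + t" using 1 by (rule add_right_mono)
        also have "\<dots> \<le> R + 2 * t" using \<delta>(3) by simp
        finally show ?thesis .
      qed
      have ind: "indep_var borel (\<lambda>\<omega>. w z (T 0 \<omega>)) borel (Y z)" for z
        by (rule indep_var_T0_N) (use wm YF in auto)
      have Ym [measurable]: "Y z \<in> borel_measurable M" for z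
        using indep_var_rv2[OF ind[of z]] by simp
      have wi: "integrable M (\<lambda>\<omega>. w z (T 0 \<omega>))" for z
        by (rule integrable_const_bound[where B = R]) (use R in \<open>auto simp: w_def indicator_def\<close>)
      have Yi: "integrable M (Y z)" if "z \<in> cells \<delta> R" for z
        by (rule integrable_const_bound[where B = "R + 2 * t"]) (use Yb[OF that] in auto)
      have wY: "integrable M (\<lambda>\<omega>. w z (T 0 \<omega>) * Y z \<omega>)"
        "expectation (\<lambda>\<omega>. w z (T 0 \<omega>) * Y z \<omega>) = expectation (\<lambda>\<omega>. w z (T 0 \<omega>)) * expectation (Y z)"
        if "z \<in> cells \<delta> R" for z
        using indep_var_integrable[OF ind wi Yi[OF that]] indep_var_lebesgue_integral[OF ind wi Yi[OF that]] by auto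
      define Z where "Z \<omega> = Y \<lfloor>T 0 \<omega> / \<delta>\<rfloor> \<omega>" for \<omega>
      have WZ: "W \<omega> * Z \<omega> = (\<Sum>z\<in>cells \<delta> R. w z (T 0 \<omega>) * Y z \<omega>)" for \<omega>
        using wsum[of \<omega> "\<lambda>z. Y z \<omega>"] by (simp add: Z_def)
      have WZi: "integrable M (\<lambda>\<omega>. W \<omega> * Z \<omega>)" unfolding WZ by (intro Bochner_Integration.integrable_sum wY)
      have EWZ: "expectation (\<lambda>\<omega>. W \<omega> * Z \<omega>) = (\<Sum>z\<in>cells \<delta> R. expectation (\<lambda>\<omega>. w z (T 0 \<omega>)) * expectation (Y z))"
        unfolding WZ by (subst Bochner_Integration.integral_sum) (auto intro: wY simp: wY(2))
      have Wv: "W \<omega> * cmean t (g n \<omega>) = (\<Sum>z\<in>cells \<delta> R. w z (T 0 \<omega>) * cmean t (\<delta> * z))" for \<omega>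
        using wsum[of \<omega> "\<lambda>z. cmean t (\<delta> * z)"] by (simp add: g_def \<delta>_def)
      have EWv: "expectation (\<lambda>\<omega>. W \<omega> * cmean t (g n \<omega>)) = (\<Sum>z\<in>cells \<delta> R. expectation (\<lambda>\<omega>. w z (T 0 \<omega>)) * cmean t (\<delta> * z))"
        unfolding Wv by (subst Bochner_Integration.integral_sum) (auto intro: wi)
      have D2: "\<bar>expectation (\<lambda>\<omega>. W \<omega> * Z \<omega>) - expectation (\<lambda>\<omega>. W \<omega> * cmean t (g n \<omega>))\<bar> \<le> R * e"
      proof -
        have "\<bar>expectation (\<lambda>\<omega>. W \<omega> * Z \<omega>) - expectation (\<lambda>\<omega>. W \<omega> * cmean t (g n \<omega>))\<bar>
           = \<bar>\<Sum>z\<in>cells \<delta> R. expectation (\<lambda>\<omega>. w z (T 0 \<omega>)) * (expectation (Y z) - cmean t (\<delta> * z))\<bar>"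
          unfolding EWZ EWv by (simp add: sum_subtractf right_diff_distrib)
        also have "\<dots> \<le> (\<Sum>z\<in>cells \<delta> R. \<bar>expectation (\<lambda>\<omega>. w z (T 0 \<omega>)) * (expectation (Y z) - cmean t (\<delta> * z))\<bar>)"
          by (rule sum_abs)
        also have "\<dots> \<le> (\<Sum>z\<in>cells \<delta> R. (R * prob (cell \<delta> R z)) * e)"
        proof (rule sum_mono)
          fix z assume z: "z \<in> cells \<delta> R"
          have "\<bar>expectation (\<lambda>\<omega>. w z (T 0 \<omega>))\<bar> \<le> expectation (\<lambda>\<omega>. \<bar>w z (T 0 \<omega>)\<bar>)" by (rule integral_abs_bound)
          also have "\<dots> \<le> expectation (\<lambda>\<omega>. R * indicator (cell \<delta> R z) \<omega>)"
            by (intro integral_mono integrable_abs wi integrable_mult_right wcell)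
               (auto simp: cell_events emeasure_eq_measure)
          also have "\<dots> = R * prob (cell \<delta> R z)" by (simp add: cell_events)
          finally have 1: "\<bar>expectation (\<lambda>\<omega>. w z (T 0 \<omega>))\<bar> \<le> R * prob (cell \<delta> R z)" .
          have 2: "\<bar>expectation (Y z) - cmean t (\<delta> * z)\<bar> \<le> e"
            using conditional_mean_approx(1)[OF t n(1) R n2(2)[OF n(3)]] z unfolding \<delta>_def Y_def by blast
          show "\<bar>expectation (\<lambda>\<omega>. w z (T 0 \<omega>)) * (expectation (Y z) - cmean t (\<delta> * z))\<bar> \<le> (R * prob (cell \<delta> R z)) * e"
            unfolding abs_mult using R by (intro mult_mono 1 2) auto
        qed
        also have "\<dots> = (R * e) * (\<Sum>z\<in>cells \<delta> R. prob (cell \<delta> R z))" by (simp add: sum_distrib_left mult_ac)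
        also have "\<dots> \<le> (R * e) * 1" using cell_prob_sum R e by (intro mult_left_mono) auto
        finally show ?thesis by simp
      qed
      have WTi: "integrable M (\<lambda>\<omega>. W \<omega> * T t \<omega>)"
      proof (rule integrable_const_bound[where B = "R * (R + t)"])
        show "AE \<omega> in M. norm (W \<omega> * T t \<omega>) \<le> R * (R + t)"
          using T_growth[OF less_imp_le[OF t]]
        proof eventually_elim
          fix \<omega> assume a: "\<bar>T t \<omega>\<bar> \<le> \<bar>T 0 \<omega>\<bar> + t"
          show "norm (W \<omega> * T t \<omega>) \<le> R * (R + t)"
          proof (cases "\<bar>T 0 \<omega>\<bar> \<le> R")
            case True
            then show ?thesis unfolding real_norm_def abs_mult using a R t by (intro mult_mono WR) auto
          qed (use W0 R t in simp)
        qed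
      qed measurable
      have D1: "\<bar>expectation (\<lambda>\<omega>. W \<omega> * T t \<omega>) - expectation (\<lambda>\<omega>. W \<omega> * Z \<omega>)\<bar> \<le> R * e + R * (2 * R + 3 * t) * e"
      proof -
        have "\<bar>expectation (\<lambda>\<omega>. W \<omega> * T t \<omega>) - expectation (\<lambda>\<omega>. W \<omega> * Z \<omega>)\<bar>
          = \<bar>expectation (\<lambda>\<omega>. W \<omega> * T t \<omega> - W \<omega> * Z \<omega>)\<bar>"
          using WTi WZi by simp
        also have "\<dots> \<le> expectation (\<lambda>\<omega>. \<bar>W \<omega> * T t \<omega> - W \<omega> * Z \<omega>\<bar>)" by (rule integral_abs_bound)
        also have "\<dots> \<le> expectation (\<lambda>\<omega>. R * e + R * (2 * R + 3 * t) * indicator (bad_event t n L R) \<omega>)"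
        proof (rule integral_mono_AE)
          show "integrable M (\<lambda>\<omega>. \<bar>W \<omega> * T t \<omega> - W \<omega> * Z \<omega>\<bar>)" using WTi WZi by auto
          show "integrable M (\<lambda>\<omega>. R * e + R * (2 * R + 3 * t) * indicator (bad_event t n L R) \<omega>)"
            using bad_event_events[OF t] by (auto simp: emeasure_eq_measure)
          show "AE \<omega> in M. \<bar>W \<omega> * T t \<omega> - W \<omega> * Z \<omega>\<bar> \<le> R * e + R * (2 * R + 3 * t) * indicator (bad_event t n L R) \<omega>"
            using T_growth[OF less_imp_le[OF t]] path AE_space
          proof eventually_elim
            fix \<omega> assume a: "\<bar>T t \<omega>\<bar> \<le> \<bar>T 0 \<omega>\<bar> + t" and p: "telegraph_path (N \<omega>) (\<lambda>s. T s \<omega>)" and sp: "\<omega> \<in> space M"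
            show "\<bar>W \<omega> * T t \<omega> - W \<omega> * Z \<omega>\<bar> \<le> R * e + R * (2 * R + 3 * t) * indicator (bad_event t n L R) \<omega>"
            proof (cases "\<bar>T 0 \<omega>\<bar> \<le> R")
              case True
              have "\<bar>T t \<omega> - Z \<omega>\<bar> \<le> e + (2 * R + 3 * t) * indicator (bad_event t n L R) \<omega>"
              proof (cases "\<omega> \<in> bad_event t n L R")
                case False
                have "\<bar>T t \<omega> - Z \<omega>\<bar> \<le> \<delta> * (L + 1)"
                  using T_near_echain(2)[OF t n(1) sp p True not_bad_event[OF t n(1) sp True False]]
                  by (simp add: Z_def Y_def \<delta>_def)
                then show ?thesis using \<delta>L False by simp
              next
                case bad_from: True
                have "\<bar>Z \<omega>\<bar> \<le> R + 2 * t" unfolding Z_def by (rule Yb) (rule cellsI[OF \<delta>(1) True])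
                then show ?thesis using a True bad_from e by simp
              qed
              then have "\<bar>W \<omega>\<bar> * \<bar>T t \<omega> - Z \<omega>\<bar> \<le> R * (e + (2 * R + 3 * t) * indicator (bad_event t n L R) \<omega>)"
                using R by (intro mult_mono WR) auto
              then show ?thesis by (simp add: algebra_simps flip: abs_mult)
            qed (use W0 R t e in simp)
          qed
        qed
        also have "\<dots> = R * e + R * (2 * R + 3 * t) * prob (bad_event t n L R)"
          using bad_event_events[OF t] by (simp add: emeasure_eq_measure prob_space)
        also have "\<dots> \<le> R * e + R * (2 * R + 3 * t) * e"
          using n1(2)[OF n(2)] R t by (intro add_left_mono mult_left_mono) auto
        finally show ?thesis .
      qed
      have "\<bar>expectation (\<lambda>\<omega>. W \<omega> * T t \<omega>) - expectation (\<lambda>\<omega>. W \<omega> * cmean t (g n \<omega>))\<bar>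
         \<le> R * e + R * (2 * R + 3 * t) * e + R * e" using D1 D2 by linarith
      also have "\<dots> = R * (2 * R + 3 * t + 2) * e" by (simp add: algebra_simps)
      finally show "\<bar>expectation (\<lambda>\<omega>. W \<omega> * T t \<omega>) - expectation (\<lambda>\<omega>. W \<omega> * cmean t (g (Suc m) \<omega>))\<bar> \<le> R * (2 * R + 3 * t + 2) * e"
        by (simp add: n_def)
    qed
  qed
  define C where "C = R * (2 * R + 3 * t + 2) + 1"
  have C: "0 < C" using R t by (simp add: C_def add_nonneg_pos)
  have "(\<lambda>n. expectation (\<lambda>\<omega>. W \<omega> * cmean t (g (Suc n) \<omega>))) \<longlonglongrightarrow> expectation (\<lambda>\<omega>. W \<omega> * T t \<omega>)"
  proof (rule LIMSEQ_I)
    fix e :: real assume e: "0 < e"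
    obtain n0 where n0: "\<forall>n\<ge>n0. \<bar>expectation (\<lambda>\<omega>. W \<omega> * T t \<omega>) - expectation (\<lambda>\<omega>. W \<omega> * cmean t (g (Suc n) \<omega>))\<bar> \<le> R * (2 * R + 3 * t + 2) * (e / C)"
      using main[of "e / C"] e C by auto
    have "R * (2 * R + 3 * t + 2) * (e / C) < C * (e / C)"
      using e C by (intro mult_strict_right_mono) (auto simp: C_def)
    also have "\<dots> = e" using C by simp
    finally show "\<exists>no. \<forall>n\<ge>no. norm (expectation (\<lambda>\<omega>. W \<omega> * cmean t (g (Suc n) \<omega>)) - expectation (\<lambda>\<omega>. W \<omega> * T t \<omega>)) < e"
      using n0 by (intro exI[of _ n0]) (auto simp: abs_minus_commute intro: le_less_trans)
  qed
  then show ?thesis using lim by (rule LIMSEQ_unique)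
qed

end

context telegraph begin

lemma T0_poly_integrable: "integrable M (\<lambda>\<omega>. \<bar>T 0 \<omega>\<bar> ^ k)"
  using distributed_integrable[OF normal, of "\<lambda>x. \<bar>x\<bar> ^ k"] integrable_std_normal_moment_abs[of k] by simp

lemma T0_growth_integrable: "integrable M (\<lambda>\<omega>. \<bar>T 0 \<omega>\<bar> * (\<bar>T 0 \<omega>\<bar> + c))"
  using T0_poly_integrable[of 2] T0_poly_integrable[of 1] by (simp add: distrib_left power2_eq_square)

lemma T0_product_bound:
  assumes t: "0 \<le> t" shows "AE \<omega> in M. \<bar>T 0 \<omega> * T t \<omega>\<bar> \<le> \<bar>T 0 \<omega>\<bar> * (\<bar>T 0 \<omega>\<bar> + t)"
  using T_growth[OF t] by eventually_elim (auto simp: abs_mult intro!: mult_left_mono)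

text \<open>The truncation is removed by dominated convergence, using \<open>\<bar>T t\<bar> \<le> \<bar>T 0\<bar> + t\<close> and the moments of the normal law.\<close>

lemma covK_eq_cov_formula:
  assumes t: "0 \<le> t" shows "covK M T t 0 = cov_formula t"
proof -
  note [measurable] = T_measurable[OF t] cmean_borel[OF t]
  have 1: "expectation (\<lambda>\<omega>. T 0 \<omega> * T t \<omega>) = expectation (\<lambda>\<omega>. T 0 \<omega> * cmean t (T 0 \<omega>))"
  proof (cases "t = 0")
    case True then show ?thesis by (simp add: cmean_0)
  next
    case False
    then have t': "0 < t" using t by simp
    obtain B where B: "0 \<le> B" "\<And>s x. 0 \<le> s \<Longrightarrow> s \<le> t \<Longrightarrow> \<bar>cmean s x\<bar> \<le> B + \<bar>x\<bar>"
      using cmean_bound[of t] by blast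
    have ind1: "(\<lambda>n. T 0 \<omega> * indicator {- real n..real n} (T 0 \<omega>) * c) \<longlonglongrightarrow> T 0 \<omega> * c" for \<omega> c
    proof (rule tendsto_eventually)
      have "\<forall>\<^sub>F n in sequentially. \<bar>T 0 \<omega>\<bar> \<le> real n"
        using eventually_ge_at_top[of "nat \<lceil>\<bar>T 0 \<omega>\<bar>\<rceil>"] by eventually_elim linarith
      then show "\<forall>\<^sub>F n in sequentially. T 0 \<omega> * indicator {- real n..real n} (T 0 \<omega>) * c = T 0 \<omega> * c"
        by eventually_elim (auto simp: indicator_def)
    qed
    have "(\<lambda>n. expectation (\<lambda>\<omega>. T 0 \<omega> * indicator {- real n..real n} (T 0 \<omega>) * T t \<omega>)) \<longlonglongrightarrow> expectation (\<lambda>\<omega>. T 0 \<omega> * T t \<omega>)"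
    proof (rule integral_dominated_convergence[OF _ _ T0_growth_integrable[of t]])
      show "AE \<omega> in M. norm (T 0 \<omega> * indicator {- real n..real n} (T 0 \<omega>) * T t \<omega>) \<le> \<bar>T 0 \<omega>\<bar> * (\<bar>T 0 \<omega>\<bar> + t)" for n
        using T0_product_bound[OF t] by eventually_elim (auto simp: indicator_def t intro!: mult_nonneg_nonneg)
    qed (use ind1 in auto)
    moreover have "(\<lambda>n. expectation (\<lambda>\<omega>. T 0 \<omega> * indicator {- real n..real n} (T 0 \<omega>) * cmean t (T 0 \<omega>))) \<longlonglongrightarrow> expectation (\<lambda>\<omega>. T 0 \<omega> * cmean t (T 0 \<omega>))"
    proof (rule integral_dominated_convergence[OF _ _ T0_growth_integrable[of B]])
      show "AE \<omega> in M. norm (T 0 \<omega> * indicator {- real n..real n} (T 0 \<omega>) * cmean t (T 0 \<omega>)) \<le> \<bar>T 0 \<omega>\<bar> * (\<bar>T 0 \<omega>\<bar> + B)" for n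
      proof (rule AE_I2)
        fix \<omega>
        have "\<bar>T 0 \<omega>\<bar> * \<bar>cmean t (T 0 \<omega>)\<bar> \<le> \<bar>T 0 \<omega>\<bar> * (\<bar>T 0 \<omega>\<bar> + B)"
          using B(2)[of t "T 0 \<omega>"] t by (intro mult_left_mono) auto
        then show "norm (T 0 \<omega> * indicator {- real n..real n} (T 0 \<omega>) * cmean t (T 0 \<omega>)) \<le> \<bar>T 0 \<omega>\<bar> * (\<bar>T 0 \<omega>\<bar> + B)"
          using B(1) by (auto simp: indicator_def abs_mult intro!: mult_nonneg_nonneg)
      qed
    qed (use ind1 in auto)
    ultimately show ?thesis using truncated_mean[OF t', of "real n" for n] by (simp add: LIMSEQ_unique)
  qed
  have "covK M T t 0 = expectation (\<lambda>\<omega>. T 0 \<omega> * T t \<omega>)" by (simp add: covK_def mult.commute)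
  also note 1
  also have "expectation (\<lambda>\<omega>. T 0 \<omega> * cmean t (T 0 \<omega>)) = (LINT x|lborel. std_normal_density x * (x * cmean t x))"
    by (rule distributed_integral[OF normal, symmetric]) auto
  finally show ?thesis by (simp add: cov_formula_def mult.assoc)
qed

text \<open>Paths are right-continuous at \<open>0\<close> and \<open>K(0, 0)\<close> is the variance \<open>1\<close>.\<close>

lemma covK_near_0:
  obtains s0 where "0 < s0" "\<And>s. 0 \<le> s \<Longrightarrow> s \<le> s0 \<Longrightarrow> 1/2 \<le> covK M T s 0"
proof -
  have K0: "covK M T 0 0 = 1"
  proof -
    have "covK M T 0 0 = (LINT x|lborel. std_normal_density x * (x * x))"
      unfolding covK_def by (rule distributed_integral[OF normal, symmetric]) auto
    also have "\<dots> = 1" using std_normal_moment_even[of 1] by (simp add: has_bochner_integral_iff power2_eq_square)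
    finally show ?thesis .
  qed
  have "\<exists>s0>0. \<forall>s. 0 \<le> s \<longrightarrow> s \<le> s0 \<longrightarrow> 1/2 \<le> covK M T s 0"
  proof (rule ccontr)
    assume "\<not> ?thesis"
    then have "\<forall>n::nat. \<exists>s. 0 \<le> s \<and> s \<le> 1 / (real n + 1) \<and> covK M T s 0 < 1/2"
      by (auto simp: not_le)
    then obtain s where s: "\<And>n. 0 \<le> s n" "\<And>n. s n \<le> 1 / (real n + 1)" "\<And>n. covK M T (s n) 0 < 1/2"
      by metis
    have spos: "0 < s n" for n
    proof -
      have "s n \<noteq> 0" using s(3)[of n] K0 by auto
      then show ?thesis using s(1)[of n] by simp
    qed
    have snz: "s n \<noteq> 0" for n using spos[of n] by simp
    have s1: "s n \<le> 1" for n
    proof -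
      have "1 / (real n + 1) \<le> 1" by simp
      then show ?thesis using s(2)[of n] by linarith
    qed
    have s0: "s \<longlonglongrightarrow> 0"
    proof (rule tendsto_sandwich[OF _ _ tendsto_const])
      show "(\<lambda>n. 1 / (real n + 1)) \<longlonglongrightarrow> 0" by real_asymp
    qed (use s in \<open>auto intro!: always_eventually\<close>)
    have lim: "filterlim s (at_right 0) sequentially"
      using s0 spos snz by (auto simp: filterlim_at intro!: always_eventually)
    have [measurable]: "T (s n) \<in> borel_measurable M" for n by (rule T_measurable[OF s(1)])
    have "(\<lambda>n. expectation (\<lambda>\<omega>. T 0 \<omega> * T (s n) \<omega>)) \<longlonglongrightarrow> expectation (\<lambda>\<omega>. T 0 \<omega> * T 0 \<omega>)"
    proof (rule integral_dominated_convergence[OF _ _ T0_growth_integrable[of 1]])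
      show "AE \<omega> in M. (\<lambda>n. T 0 \<omega> * T (s n) \<omega>) \<longlonglongrightarrow> T 0 \<omega> * T 0 \<omega>"
        using path
      proof eventually_elim
        fix \<omega> assume "telegraph_path (N \<omega>) (\<lambda>s. T s \<omega>)"
        then have "cadlag (\<lambda>s. T s \<omega>)" by (rule telegraph_path.cadlag)
        then have "((\<lambda>s. T s \<omega>) \<longlongrightarrow> T 0 \<omega>) (at_right 0)" by (auto simp: cadlag_def continuous_within)
        from filterlim_compose[OF this lim] show "(\<lambda>n. T 0 \<omega> * T (s n) \<omega>) \<longlonglongrightarrow> T 0 \<omega> * T 0 \<omega>"
          by (intro tendsto_mult_left)
      qed
      show "AE \<omega> in M. norm (T 0 \<omega> * T (s n) \<omega>) \<le> \<bar>T 0 \<omega>\<bar> * (\<bar>T 0 \<omega>\<bar> + 1)" for n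
        using T0_product_bound[OF s(1)]
      proof eventually_elim
        fix \<omega> assume "\<bar>T 0 \<omega> * T (s n) \<omega>\<bar> \<le> \<bar>T 0 \<omega>\<bar> * (\<bar>T 0 \<omega>\<bar> + s n)"
        also have "\<dots> \<le> \<bar>T 0 \<omega>\<bar> * (\<bar>T 0 \<omega>\<bar> + 1)" using s1[of n] by (intro mult_left_mono) auto
        finally show "norm (T 0 \<omega> * T (s n) \<omega>) \<le> \<bar>T 0 \<omega>\<bar> * (\<bar>T 0 \<omega>\<bar> + 1)" by simp
      qed
    qed simp_all
    then have "(\<lambda>n. covK M T (s n) 0) \<longlonglongrightarrow> 1" using K0 by (simp add: covK_def mult.commute)
    then have "1 \<le> (1/2 :: real)" by (rule LIMSEQ_le_const2) (use s(3) in \<open>auto intro: less_imp_le\<close>)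
    then show False by simp
  qed
  then show ?thesis using that by blast
qed

lemma covK_integral:
  shows "set_integrable lborel {0..} (\<lambda>s. covK M T s 0)" "(LINT s:{0..}|lborel. covK M T s 0) = 0"
proof -
  have eq: "indicator {0..} s *\<^sub>R covK M T s 0 = indicator {0..} s *\<^sub>R cov_formula s" for s
    using covK_eq_cov_formula[of s] by (auto simp: indicator_def)
  show "set_integrable lborel {0..} (\<lambda>s. covK M T s 0)" "(LINT s:{0..}|lborel. covK M T s 0) = 0"
    using cov_formula_integral unfolding set_integrable_def set_lebesgue_integral_def eq by auto
qed

end

theorem proposition2p9:
  fixes M :: "'a measure"
    and N :: "'a \<Rightarrow> (real \<times> real) measure"
    and T :: "real \<Rightarrow> 'a \<Rightarrow> real"
  assumes "prob_space M"
    and "poisson_random_measure M quadrant_lborel N"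
    and "telegraph_solution M N T"
    and "distributed M lborel (T 0) std_normal_density"
    and "indep_of_random_measure M quadrant_lborel (T 0) N"
  shows "(\<forall>\<rho>>0. set_integrable lborel {0..} (\<lambda>s. exp (- \<rho> * s) * covK M T s 0))
    \<and> set_integrable lborel {0..} (\<lambda>s. covK M T s 0)
    \<and> continuous_on {0<..} (sigma_sq M T)
    \<and> (sigma_sq M T \<longlongrightarrow> 8 * (LINT s : {0..} | lborel. covK M T s 0)) (at_right 0)
    \<and> 8 * (LINT s : {0..} | lborel. covK M T s 0) = 0
    \<and> (sigma_sq M T \<longlongrightarrow> 0) at_top
    \<and> bdd_above (sigma_sq M T ` {0<..})
    \<and> (\<exists>\<rho>star>0. sigma_sq M T \<rho>star = (SUP \<rho>\<in>{0<..}. sigma_sq M T \<rho>))"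
proof -
  interpret telegraph M N T
    using assms by (intro telegraph.intro prm_space.intro prm_space_axioms.intro telegraph_axioms.intro)
  let ?K = "\<lambda>s. covK M T s 0"
  let ?S = "sigma_sq M T"
  let ?L = "\<lambda>\<rho>. LINT s:{0..}|lborel. exp (- \<rho> * s) * ?K s"
  note K = covK_integral
  have S: "?S = (\<lambda>\<rho>. 8 * ?L \<rho>)" by (simp add: fun_eq_iff sigma_sq_def)
  have S0: "?S 0 = 0" by (simp add: S K)
  have c0: "continuous_on {0..} ?S" unfolding S
    by (intro continuous_on_mult_left damped_continuous K)
  have c: "continuous_on {0<..} ?S" by (rule continuous_on_subset[OF c0]) auto
  have "(?S \<longlongrightarrow> ?S 0) (at 0 within {0..})" using c0 by (auto simp: continuous_on_def)
  then have l0: "(?S \<longlongrightarrow> 0) (at_right 0)"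
    unfolding S0 by (rule tendsto_mono[rotated]) (intro at_le, auto)
  have l1: "(?S \<longlongrightarrow> 0) at_top"
    unfolding S using tendsto_mult_left[OF damped_at_top[OF K(1)], of 8] by simp
  obtain s0 where s0: "0 < s0" "\<And>s. 0 \<le> s \<Longrightarrow> s \<le> s0 \<Longrightarrow> 1/2 \<le> ?K s" using covK_near_0 by blast
  obtain p where p: "0 < p" "0 < ?L p" using damped_positive[OF K(1) s0] by blast
  have p': "0 < ?S p" using p by (simp add: S)
  obtain m where m: "0 < m" "\<And>x. 0 < x \<Longrightarrow> ?S x \<le> ?S m"
    using maximum_exists_from_limits[OF c l0 l1 p(1) p'] by blast
  have bdd: "bdd_above (?S ` {0<..})" using m(2) by (auto intro!: bdd_aboveI[of _ "?S m"])
  have "?S m = (SUP \<rho>\<in>{0<..}. ?S \<rho>)"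
    using m by (intro cSup_eq_maximum[symmetric]) auto
  then show ?thesis
    using damped_integrable[OF K(1)] K c l0 l1 bdd m(1) by auto
qed

end
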